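(* Let $A\ast_{C,\varphi}$ be an HNN-extension, where $A$ is a finitely generated group, $C$ is a finite subgroup of $A$, and $\varphi\colon C\to A$ is a monomorphism. Let $S_C$ be the set of all non-trivial elements of $C$. Let $S_A$ be a finite generating set of $A$ containing $S_C$ and $\varphi(S_C)$. If the marked group $(A,S_A)$ is of type $\mathsf{R}$, then the marked group $(A\ast_{C,\varphi}, S_A\cup\{t\})$ is of type $\mathsf{R}$, where $t$ is the stable letter.
   Context: For a metric space $X$ and a real number $r\ge 0$, the Rips complex $R_r(X)$ is the simplicial complex whose simplices are the non-empty finite subsets of $X$ of diameter $\le r$. A marked group is a pair $(G,S)$, where $G$ is a finitely generated group and $S$ is a finite generating set of $G$. The group $G$ is equipped with the word metric $d_S$: $d_S(g,g)=0$ and, for $g\neq h$, $d_S(g,h)$ is the least $k\in\mathbb{N}$ such that $g^{-1}h=s_1\cdots s_k$ for some $s_1,\ldots,s_k\in S\cup S^{-1}$. Write $R_r(G,S)$ for the Rips complex $R_r(G,d_S)$. A marked group $(G,S)$ is of type $\mathsf{R}$ if there exists a real number $r_0\ge 0$ such that for all real $r\ge r_0$ the Rips complex $R_r(G,S)$ is contractible. The HNN-extension is the group $A\ast_{C,\varphi}=\langle A,t\mid tct^{-1}=\varphi(c)\text{ for all } c\in C\rangle$ (the convention $t^{-1}ct=\varphi(c)$ amounts to replacing $t$ by $t^{-1}$ and gives the same word metric); $A$ is regarded as a subgroup via the canonical embedding. *)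

theory Defs
  imports "HOL-Analysis.Analysis" "HOL-Algebra.Generated_Groups"
begin

section \<open>Geometric realization of an abstract simplicial complex\<close>

text \<open>
  A simplicial complex is given by its set \<^term>\<open>K\<close> of simplices: non-empty finite sets of vertices,
  closed under passing to non-empty subsets.  Points of the realization are barycentric coordinates.
\<close>

definition closed_simplex :: "'v set \<Rightarrow> ('v \<Rightarrow> real) set" where
  "closed_simplex \<sigma> = {x. (\<forall>v. 0 \<le> x v) \<and> (\<forall>v. v \<notin> \<sigma> \<longrightarrow> x v = 0) \<and> (\<Sum>v\<in>\<sigma>. x v) = 1}"

text \<open>
  The realization carries the weak topology with respect to its closed simplices.  On a function
  space \<^term>\<open>top_of_set\<close> refers to the product topology, so for finite \<^term>\<open>\<sigma>\<close> the space
  \<^term>\<open>top_of_set (closed_simplex \<sigma>)\<close> is a simplex with its usual Euclidean topology.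
\<close>

definition geometric_realization :: "'v set set \<Rightarrow> ('v \<Rightarrow> real) topology" where
  "geometric_realization K = topology (\<lambda>U. U \<subseteq> (\<Union>\<sigma>\<in>K. closed_simplex \<sigma>) \<and>
     (\<forall>\<sigma>\<in>K. openin (top_of_set (closed_simplex \<sigma>)) (U \<inter> closed_simplex \<sigma>)))"

lemma openin_geometric_realization:
  "openin (geometric_realization K) U \<longleftrightarrow> U \<subseteq> (\<Union>\<sigma>\<in>K. closed_simplex \<sigma>) \<and>
     (\<forall>\<sigma>\<in>K. openin (top_of_set (closed_simplex \<sigma>)) (U \<inter> closed_simplex \<sigma>))"
proof -
  have "istopology (\<lambda>U. U \<subseteq> (\<Union>\<sigma>\<in>K. closed_simplex \<sigma>) \<and>
     (\<forall>\<sigma>\<in>K. openin (top_of_set (closed_simplex \<sigma>)) (U \<inter> closed_simplex \<sigma>)))"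
    unfolding istopology_def
  proof (intro conjI allI impI ballI; (elim conjE)?)
    fix S T \<sigma>
    assume "\<forall>\<sigma>\<in>K. openin (top_of_set (closed_simplex \<sigma>)) (S \<inter> closed_simplex \<sigma>)"
      "\<forall>\<sigma>\<in>K. openin (top_of_set (closed_simplex \<sigma>)) (T \<inter> closed_simplex \<sigma>)" "\<sigma> \<in> K"
    then have "openin (top_of_set (closed_simplex \<sigma>))
        ((S \<inter> closed_simplex \<sigma>) \<inter> (T \<inter> closed_simplex \<sigma>))"
      by (blast intro: openin_Int)
    then show "openin (top_of_set (closed_simplex \<sigma>)) (S \<inter> T \<inter> closed_simplex \<sigma>)"
      by (simp add: Int_ac)
  next
    fix \<U> \<sigma>
    assume "\<forall>U\<in>\<U>. U \<subseteq> (\<Union>\<sigma>\<in>K. closed_simplex \<sigma>) \<and>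
        (\<forall>\<sigma>\<in>K. openin (top_of_set (closed_simplex \<sigma>)) (U \<inter> closed_simplex \<sigma>))" "\<sigma> \<in> K"
    then have "openin (top_of_set (closed_simplex \<sigma>)) (\<Union>U\<in>\<U>. U \<inter> closed_simplex \<sigma>)"
      by blast
    then show "openin (top_of_set (closed_simplex \<sigma>)) (\<Union>\<U> \<inter> closed_simplex \<sigma>)"
      by (simp add: Int_commute Int_Union)
  qed blast+
  then show ?thesis
    by (simp add: geometric_realization_def)
qed

lemma topspace_geometric_realization:
  "topspace (geometric_realization K) = (\<Union>\<sigma>\<in>K. closed_simplex \<sigma>)"
proof
  show "topspace (geometric_realization K) \<subseteq> (\<Union>\<sigma>\<in>K. closed_simplex \<sigma>)"
    using openin_geometric_realization openin_topspace by blast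
  have "(\<Union>\<sigma>\<in>K. closed_simplex \<sigma>) \<inter> closed_simplex \<tau> = closed_simplex \<tau>" if "\<tau> \<in> K" for \<tau>
    using that by blast
  then have "openin (geometric_realization K) (\<Union>\<sigma>\<in>K. closed_simplex \<sigma>)"
    by (simp add: openin_geometric_realization)
  then show "(\<Union>\<sigma>\<in>K. closed_simplex \<sigma>) \<subseteq> topspace (geometric_realization K)"
    by (rule openin_subset)
qed


section \<open>Rips complexes\<close>

definition rips_complex :: "'a set \<Rightarrow> ('a \<Rightarrow> 'a \<Rightarrow> real) \<Rightarrow> real \<Rightarrow> 'a set set" where
  "rips_complex M d r =
     {\<sigma>. \<sigma> \<subseteq> M \<and> finite \<sigma> \<and> \<sigma> \<noteq> {} \<and> (SUP (x, y)\<in>\<sigma> \<times> \<sigma>. d x y) \<le> r}"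


section \<open>Marked groups and type R\<close>

definition marked_group :: "('a, 'b) monoid_scheme \<Rightarrow> 'a set \<Rightarrow> bool" where
  "marked_group G S \<longleftrightarrow> group G \<and> finite S \<and> S \<subseteq> carrier G \<and> generate G S = carrier G"

definition word_metric :: "('a, 'b) monoid_scheme \<Rightarrow> 'a set \<Rightarrow> 'a \<Rightarrow> 'a \<Rightarrow> real" where
  "word_metric G S g h =
     (if g = h then 0
      else real (LEAST k. \<exists>ss. length ss = k \<and> set ss \<subseteq> S \<union> m_inv G ` S \<and>
                   inv\<^bsub>G\<^esub> g \<otimes>\<^bsub>G\<^esub> h = foldr (mult G) ss \<one>\<^bsub>G\<^esub>))"

definition type_R :: "('a, 'b) monoid_scheme \<Rightarrow> 'a set \<Rightarrow> bool" where
  "type_R G S \<longleftrightarrow> marked_group G S \<and>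
     (\<exists>r\<^sub>0\<ge>0. \<forall>r\<ge>r\<^sub>0. contractible_space
        (geometric_realization (rips_complex (carrier G) (word_metric G S) r)))"


section \<open>Group presentations\<close>

text \<open>
  A word over generators \<^term>\<open>X\<close> is a list of pairs: \<^term>\<open>(x, True)\<close> stands for $x$ and
  \<^term>\<open>(x, False)\<close> for $x^{-1}$.  A pair \<^term>\<open>(u, v)\<close> of words in \<^term>\<open>R\<close> is the defining
  relation $u = v$.
\<close>

type_synonym 'g gword = "('g \<times> bool) list"

definition gwords :: "'g set \<Rightarrow> 'g gword set" where
  "gwords X = lists (X \<times> UNIV)"

inductive_set presentation_rel :: "'g set \<Rightarrow> ('g gword \<times> 'g gword) set \<Rightarrow> ('g gword \<times> 'g gword) set"
  for X :: "'g set" and R :: "('g gword \<times> 'g gword) set" where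
  refl: "u \<in> gwords X \<Longrightarrow> (u, u) \<in> presentation_rel X R"
| sym: "(u, v) \<in> presentation_rel X R \<Longrightarrow> (v, u) \<in> presentation_rel X R"
| trans: "(u, v) \<in> presentation_rel X R \<Longrightarrow> (v, w) \<in> presentation_rel X R \<Longrightarrow>
    (u, w) \<in> presentation_rel X R"
| append: "(u, u') \<in> presentation_rel X R \<Longrightarrow> (v, v') \<in> presentation_rel X R \<Longrightarrow>
    (u @ v, u' @ v') \<in> presentation_rel X R"
| cancel: "x \<in> X \<Longrightarrow> ([(x, b), (x, \<not> b)], []) \<in> presentation_rel X R"
| relation: "(u, v) \<in> R \<Longrightarrow> u \<in> gwords X \<Longrightarrow> v \<in> gwords X \<Longrightarrow> (u, v) \<in> presentation_rel X R"

definition presented_group :: "'g set \<Rightarrow> ('g gword \<times> 'g gword) set \<Rightarrow> 'g gword set monoid" where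
  "presented_group X R =
     \<lparr>carrier = gwords X // presentation_rel X R,
      mult = (\<lambda>P Q. \<Union>u\<in>P. \<Union>v\<in>Q. presentation_rel X R `` {u @ v}),
      one = presentation_rel X R `` {[]}\<rparr>"

lemma presentation_rel_gwords:
  assumes "(u, v) \<in> presentation_rel X R"
  shows "u \<in> gwords X \<and> v \<in> gwords X"
  using assms by induction (auto simp: gwords_def)

lemma equiv_presentation_rel: "equiv (gwords X) (presentation_rel X R)"
proof (rule equivI)
  show "presentation_rel X R \<subseteq> gwords X \<times> gwords X"
    using presentation_rel_gwords by fast
  show "refl_on (gwords X) (presentation_rel X R)"
    by (simp add: refl_on_def presentation_rel.refl)
  show "Relation.sym (presentation_rel X R)"
    by (rule symI) (rule presentation_rel.sym)
  show "Relation.trans (presentation_rel X R)"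
    by (rule transI) (rule presentation_rel.trans)
qed

lemma presented_group_mult:
  assumes "u \<in> gwords X" "v \<in> gwords X"
  shows "presentation_rel X R `` {u} \<otimes>\<^bsub>presented_group X R\<^esub> presentation_rel X R `` {v} =
    presentation_rel X R `` {u @ v}"
proof -
  have "presentation_rel X R `` {u' @ v'} = presentation_rel X R `` {u @ v}"
    if "(u, u') \<in> presentation_rel X R" "(v, v') \<in> presentation_rel X R" for u' v'
    using equiv_class_eq[OF equiv_presentation_rel presentation_rel.append[OF that]] by simp
  moreover have "u \<in> presentation_rel X R `` {u}" "v \<in> presentation_rel X R `` {v}"
    using assms by (auto intro: presentation_rel.refl)
  ultimately show ?thesis
    unfolding presented_group_def monoid.simps by blast
qed

lemma presentation_rel_inverse:
  assumes "u \<in> gwords X"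
  shows "(rev (map (apsnd Not) u) @ u, []) \<in> presentation_rel X R"
  using assms
proof (induction u)
  case Nil
  then show ?case
    by (simp add: presentation_rel.refl gwords_def)
next
  case (Cons a u)
  obtain x b where a: "a = (x, b)" by fastforce
  have x: "x \<in> X" and u: "u \<in> gwords X"
    using Cons.prems by (auto simp: gwords_def a)
  then have ru: "rev (map (apsnd Not) u) \<in> gwords X"
    by (fastforce simp: gwords_def)
  have "([(x, \<not> b), (x, b)] @ u, [] @ u) \<in> presentation_rel X R"
    using presentation_rel.append[OF presentation_rel.cancel[OF x, of "\<not> b"]
        presentation_rel.refl[OF u]] by simp
  then have "(rev (map (apsnd Not) u) @ [(x, \<not> b), (x, b)] @ u, rev (map (apsnd Not) u) @ [] @ u)
      \<in> presentation_rel X R"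
    by (rule presentation_rel.append[OF presentation_rel.refl[OF ru]])
  then show ?case
    using presentation_rel.trans Cons.IH[OF u] by (fastforce simp: a)
qed

lemma group_presented_group: "group (presented_group X R)"
proof (rule groupI)
  let ?G = "presented_group X R" and ?c = "\<lambda>u. presentation_rel X R `` {u}"
  have carr: "P \<in> carrier ?G \<longleftrightarrow> (\<exists>u\<in>gwords X. P = ?c u)" for P
    by (auto simp: presented_group_def quotient_def)
  have nil: "[] \<in> gwords X" and app: "\<And>u v. u \<in> gwords X \<Longrightarrow> v \<in> gwords X \<Longrightarrow> u @ v \<in> gwords X"
    by (auto simp: gwords_def)
  have one: "\<one>\<^bsub>?G\<^esub> = ?c []"
    by (simp add: presented_group_def)
  show "\<one>\<^bsub>?G\<^esub> \<in> carrier ?G"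
    using nil one carr by blast
  fix P Q T
  assume "P \<in> carrier ?G"
  then obtain u where u: "u \<in> gwords X" "P = ?c u" using carr by blast
  show "\<one>\<^bsub>?G\<^esub> \<otimes>\<^bsub>?G\<^esub> P = P"
    using u nil by (simp add: one presented_group_mult)
  have ru: "rev (map (apsnd Not) u) \<in> gwords X"
    using u by (fastforce simp: gwords_def)
  then have "?c (rev (map (apsnd Not) u)) \<otimes>\<^bsub>?G\<^esub> P = \<one>\<^bsub>?G\<^esub>"
    using equiv_class_eq[OF equiv_presentation_rel presentation_rel_inverse[OF u(1)]] u
    by (simp add: one presented_group_mult)
  then show "\<exists>Q\<in>carrier ?G. Q \<otimes>\<^bsub>?G\<^esub> P = \<one>\<^bsub>?G\<^esub>"
    using ru carr by blast
  assume "Q \<in> carrier ?G"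
  then obtain v where v: "v \<in> gwords X" "Q = ?c v" using carr by blast
  show "P \<otimes>\<^bsub>?G\<^esub> Q \<in> carrier ?G"
    using u v app carr by (auto simp: presented_group_mult)
  assume "T \<in> carrier ?G"
  then obtain w where w: "w \<in> gwords X" "T = ?c w" using carr by blast
  show "P \<otimes>\<^bsub>?G\<^esub> Q \<otimes>\<^bsub>?G\<^esub> T = P \<otimes>\<^bsub>?G\<^esub> (Q \<otimes>\<^bsub>?G\<^esub> T)"
    using u v w app by (simp add: presented_group_mult)
qed


section \<open>HNN-extensions\<close>

datatype 'a hnn_gen = Base 'a | Stable

text \<open>
  The presentation $\langle A, t \mid t c t^{-1} = \varphi(c),\ c \in C\rangle$: the generators are
  the elements of $A$ and the letter $t$, and the relations are the multiplication table of $A$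
  together with $t c t^{-1} = \varphi(c)$ for $c \in C$.
\<close>

definition hnn_gens :: "('a, 'b) monoid_scheme \<Rightarrow> 'a hnn_gen set" where
  "hnn_gens A = insert Stable (Base ` carrier A)"

definition hnn_rels ::
  "('a, 'b) monoid_scheme \<Rightarrow> 'a set \<Rightarrow> ('a \<Rightarrow> 'a) \<Rightarrow> ('a hnn_gen gword \<times> 'a hnn_gen gword) set" where
  "hnn_rels A C \<phi> =
     {([(Base a, True), (Base b, True)], [(Base (a \<otimes>\<^bsub>A\<^esub> b), True)]) | a b.
        a \<in> carrier A \<and> b \<in> carrier A} \<union>
     {([(Stable, True), (Base c, True), (Stable, False)], [(Base (\<phi> c), True)]) | c. c \<in> C}"

definition hnn_extension ::
  "('a, 'b) monoid_scheme \<Rightarrow> 'a set \<Rightarrow> ('a \<Rightarrow> 'a) \<Rightarrow> 'a hnn_gen gword set monoid" where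
  "hnn_extension A C \<phi> = presented_group (hnn_gens A) (hnn_rels A C \<phi>)"

definition hnn_embedding ::
  "('a, 'b) monoid_scheme \<Rightarrow> 'a set \<Rightarrow> ('a \<Rightarrow> 'a) \<Rightarrow> 'a \<Rightarrow> 'a hnn_gen gword set" where
  "hnn_embedding A C \<phi> a = presentation_rel (hnn_gens A) (hnn_rels A C \<phi>) `` {[(Base a, True)]}"

definition stable_letter ::
  "('a, 'b) monoid_scheme \<Rightarrow> 'a set \<Rightarrow> ('a \<Rightarrow> 'a) \<Rightarrow> 'a hnn_gen gword set" where
  "stable_letter A C \<phi> = presentation_rel (hnn_gens A) (hnn_rels A C \<phi>) `` {[(Stable, True)]}"

end

theory Submission
  imports Defs "HOL-Library.Sublist"
begin

text \<open>
  The Cayley graph of the HNN-extension is a tree of copies of the Cayley graph of \<open>A\<close> (the cosets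
  of \<open>A\<close>), adjacent copies being joined by a matching between two cosets of $C$ and
  $\varphi(C)$. Since \<open>S\<^sub>A\<close> contains $C$ and $\varphi(C)$ up to the unit, these cosets have diameter at most 1;
  hence the copies are isometrically embedded. Suppose that \<open>Y\<close> and \<open>W\<close> meet in a finite set \<open>P\<close> of
  diameter at most 1 through which every path from \<open>Y\<close> to \<open>W\<close> passes. A simplex having vertices on both
  sides of \<open>P\<close> can be enlarged by any vertex of \<open>P\<close>, so the Rips complex of \<open>Y \<union> W\<close> deforms onto the
  union of those of \<open>Y\<close> and \<open>W\<close>, which meet in the simplex \<open>P\<close>; if that of \<open>W\<close> is contractible, it further
  deforms onto the Rips complex of \<open>Y\<close>. Attaching the copies one at a time, in an order compatible
  with the tree, and concatenating the infinitely many deformations at a geometric rate, one deforms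
  the Rips complex of the whole group onto that of \<open>A\<close>. The structure of the Cayley graph is read off from
  the action of the group on normal forms.
\<close>

section \<open>Geometric realizations\<close>

definition simplicial :: "'v set set \<Rightarrow> bool" where
  "simplicial K \<longleftrightarrow> (\<forall>\<sigma>\<in>K. finite \<sigma> \<and> \<sigma> \<noteq> {} \<and> (\<forall>\<tau>\<subseteq>\<sigma>. \<tau> \<noteq> {} \<longrightarrow> \<tau> \<in> K))"

lemma simplicialD:
  assumes "simplicial K" "\<sigma> \<in> K"
  shows "finite \<sigma>" "\<sigma> \<noteq> {}" "\<tau> \<subseteq> \<sigma> \<Longrightarrow> \<tau> \<noteq> {} \<Longrightarrow> \<tau> \<in> K"
  using assms unfolding simplicial_def by blast+

definition points :: "'v set set \<Rightarrow> ('v \<Rightarrow> real) set" where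
  "points K = (\<Union>\<sigma>\<in>K. closed_simplex \<sigma>)"

lemma topspace_realization [simp]: "topspace (geometric_realization K) = points K"
  by (simp add: topspace_geometric_realization points_def)

lemma openin_realization:
  "openin (geometric_realization K) U \<longleftrightarrow>
     U \<subseteq> points K \<and> (\<forall>\<sigma>\<in>K. openin (top_of_set (closed_simplex \<sigma>)) (U \<inter> closed_simplex \<sigma>))"
  by (simp add: openin_geometric_realization points_def)

lemma pointsI [intro]: "\<sigma> \<in> K \<Longrightarrow> x \<in> closed_simplex \<sigma> \<Longrightarrow> x \<in> points K"
  by (auto simp: points_def)

lemma pointsE:
  assumes "x \<in> points K"
  obtains \<sigma> where "\<sigma> \<in> K" "x \<in> closed_simplex \<sigma>"
  using assms by (auto simp: points_def)

lemma points_mono: "L \<subseteq> K \<Longrightarrow> points L \<subseteq> points K"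
  by (auto simp: points_def)

abbreviation unit_interval :: "real topology" where
  "unit_interval \<equiv> top_of_set {0..1}"

lemma closed_simplex_mono:
  assumes "\<sigma> \<subseteq> \<tau>" "finite \<tau>"
  shows "closed_simplex \<sigma> \<subseteq> closed_simplex \<tau>"
proof
  fix x assume x: "x \<in> closed_simplex \<sigma>"
  then have "(\<Sum>v\<in>\<tau>. x v) = (\<Sum>v\<in>\<sigma>. x v)"
    using assms by (intro sum.mono_neutral_right) (auto simp: closed_simplex_def)
  with x assms show "x \<in> closed_simplex \<tau>"
    by (auto simp: closed_simplex_def)
qed

lemma closed_simplex_support:
  assumes "x \<in> closed_simplex \<sigma>" "finite \<sigma>"
  shows "{v. x v \<noteq> 0} \<subseteq> \<sigma>" "{v. x v \<noteq> 0} \<noteq> {}" "finite {v. x v \<noteq> 0}"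
    "x \<in> closed_simplex {v. x v \<noteq> 0}"
proof -
  show s: "{v. x v \<noteq> 0} \<subseteq> \<sigma>"
    using assms by (auto simp: closed_simplex_def)
  then show "finite {v. x v \<noteq> 0}"
    using assms finite_subset by blast
  have "(\<Sum>v\<in>\<sigma>. x v) \<noteq> 0"
    using assms by (auto simp: closed_simplex_def)
  then show "{v. x v \<noteq> 0} \<noteq> {}"
    by (metis (mono_tags, lifting) empty_Collect_eq sum.neutral)
  have "(\<Sum>v\<in>\<sigma>. x v) = (\<Sum>v | x v \<noteq> 0. x v)"
    using assms s by (intro sum.mono_neutral_right) auto
  then show "x \<in> closed_simplex {v. x v \<noteq> 0}"
    using assms by (auto simp: closed_simplex_def)
qed

lemma points_support:
  assumes "simplicial K"
  shows "x \<in> points K \<longleftrightarrow> {v. x v \<noteq> 0} \<in> K \<and> x \<in> closed_simplex {v. x v \<noteq> 0}"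
proof
  assume "x \<in> points K"
  then obtain \<sigma> where s: "\<sigma> \<in> K" "x \<in> closed_simplex \<sigma>" by (rule pointsE)
  with assms have "finite \<sigma>" by (auto dest: simplicialD)
  with s closed_simplex_support[OF s(2)] show "{v. x v \<noteq> 0} \<in> K \<and> x \<in> closed_simplex {v. x v \<noteq> 0}"
    using simplicialD(3)[OF assms s(1)] by blast
qed (auto simp: points_def)

lemma closed_simplex_support_subset:
  assumes "x \<in> closed_simplex \<tau>" "finite \<tau>" "finite \<sigma>"
  shows "x \<in> closed_simplex \<sigma> \<longleftrightarrow> {v. x v \<noteq> 0} \<subseteq> \<sigma>"
  using closed_simplex_support[OF assms(1,2)] closed_simplex_support(1)[of x \<sigma>] closed_simplex_mono[of _ \<sigma>] assms(3)
  by blast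

lemma closed_closed_simplex: "closed (closed_simplex \<sigma>)"
proof -
  have "closed_simplex \<sigma> = (\<Inter>v. {x. 0 \<le> x v}) \<inter> (\<Inter>v\<in>-\<sigma>. {x. x v = 0}) \<inter> {x. (\<Sum>v\<in>\<sigma>. x v) = 1}"
    by (auto simp: closed_simplex_def)
  moreover have "continuous_on UNIV (\<lambda>x::'a\<Rightarrow>real. x v)" for v
    by (intro continuous_on_product_coordinates)
  ultimately show ?thesis
    by (auto intro!: closed_Int closed_INT closed_Collect_le closed_Collect_eq continuous_on_sum continuous_intros)
qed

lemma continuous_on_coordinate:
  "continuous_on S f \<Longrightarrow> continuous_on S (\<lambda>x. f x v)"
  for f :: "_ \<Rightarrow> 'v \<Rightarrow> real"
  by (rule continuous_on_product_then_coordinatewise)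

lemma continuous_map_from_geometric_realization_prod:
  assumes "\<And>\<sigma>. \<sigma> \<in> K \<Longrightarrow> continuous_map (prod_topology unit_interval (top_of_set (closed_simplex \<sigma>))) T h"
  shows "continuous_map (prod_topology unit_interval (geometric_realization K)) T h"
  unfolding continuous_map_def
proof (intro conjI allI impI)
  let ?X = "prod_topology unit_interval (geometric_realization K)"
  show "h \<in> topspace ?X \<rightarrow> topspace T"
    using assms by (fastforce simp: points_def continuous_map_def)
  fix U assume U: "openin T U"
  define V where "V = {z \<in> topspace ?X. h z \<in> U}"
  have V: "openin (prod_topology unit_interval (top_of_set (closed_simplex \<sigma>)))
      (V \<inter> {0..1} \<times> closed_simplex \<sigma>)" if "\<sigma> \<in> K" for \<sigma>
  proof -
    have "V \<inter> {0..1} \<times> closed_simplex \<sigma> =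
        {z \<in> topspace (prod_topology unit_interval (top_of_set (closed_simplex \<sigma>))). h z \<in> U}"
      using that by (auto simp: V_def points_def)
    then show ?thesis
      using openin_continuous_map_preimage[OF assms[OF that] U] by simp
  qed
  have "\<exists>A B. openin unit_interval A \<and> openin (geometric_realization K) B \<and> t \<in> A \<and> x \<in> B \<and> A \<times> B \<subseteq> V"
    if tx: "(t, x) \<in> V" for t x
  proof -
    have t: "t \<in> {0..1}" and "x \<in> points K"
      using tx by (auto simp: V_def points_def)
    then obtain \<sigma> where \<sigma>: "\<sigma> \<in> K" "x \<in> closed_simplex \<sigma>" by (metis pointsE)
    then have "(t, x) \<in> V \<inter> {0..1} \<times> closed_simplex \<sigma>" using tx t by auto
    then obtain A B where AB: "openin unit_interval A" "t \<in> A" "x \<in> B"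
        "A \<times> B \<subseteq> V \<inter> {0..1} \<times> closed_simplex \<sigma>"
      using V[OF \<sigma>(1)] unfolding openin_prod_topology_alt by meson
    obtain e where e: "e > 0" "cball t e \<inter> {0..1} \<subseteq> A"
      using AB(1,2) by (auto simp: openin_contains_cball)
    define C where "C = cball t e \<inter> {0..1}"
    have C: "compactin unit_interval C"
      by (auto simp: C_def compactin_subtopology intro: compact_Int_closed)
    define W where "W = {y \<in> points K. C \<times> {y} \<subseteq> V}"
    have "openin (top_of_set (closed_simplex \<tau>)) (W \<inter> closed_simplex \<tau>)" if \<tau>: "\<tau> \<in> K" for \<tau>
    proof (subst openin_subopen, intro ballI)
      fix y assume y: "y \<in> W \<inter> closed_simplex \<tau>"
      have "C \<times> {y} \<subseteq> V \<inter> {0..1} \<times> closed_simplex \<tau>"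
        using y by (auto simp: W_def C_def)
      then obtain P Q where PQ: "openin (top_of_set (closed_simplex \<tau>)) Q" "C \<subseteq> P" "y \<in> Q"
          "P \<times> Q \<subseteq> V \<inter> {0..1} \<times> closed_simplex \<tau>"
        using tube_lemma_left[OF V[OF \<tau>] C, of y] y by auto
      have "Q \<subseteq> closed_simplex \<tau>"
        using PQ(1) openin_imp_subset by blast
      then have "Q \<subseteq> W \<inter> closed_simplex \<tau>"
        using PQ \<tau> by (auto simp: W_def intro: pointsI)
      then show "\<exists>Q. openin (top_of_set (closed_simplex \<tau>)) Q \<and> y \<in> Q \<and> Q \<subseteq> W \<inter> closed_simplex \<tau>"
        using PQ by blast
    qed
    then have "openin (geometric_realization K) W"
      by (auto simp: openin_realization W_def)
    moreover have "x \<in> W"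
    proof -
      have "C \<times> {x} \<subseteq> A \<times> B" using e AB by (auto simp: C_def)
      then show ?thesis using AB \<sigma> by (auto simp: W_def)
    qed
    moreover have "openin unit_interval (ball t e \<inter> {0..1})"
      by (metis Int_commute open_ball openin_open_Int)
    moreover have "(ball t e \<inter> {0..1}) \<times> W \<subseteq> V"
      by (auto simp: W_def C_def)
    ultimately show ?thesis
      using t e by (meson IntI centre_in_ball)
  qed
  then show "openin ?X V"
    unfolding openin_prod_topology_alt by blast
qed

lemma prod_unit_interval_simplex:
  "prod_topology unit_interval (top_of_set S) = top_of_set ({0..1} \<times> S)"
  by simp

lemma continuous_map_from_geometric_realization:
  assumes "\<And>\<sigma>. \<sigma> \<in> K \<Longrightarrow> continuous_map (top_of_set (closed_simplex \<sigma>)) T f"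
  shows "continuous_map (geometric_realization K) T f"
  unfolding continuous_map_def
proof (intro conjI allI impI)
  show "f \<in> topspace (geometric_realization K) \<rightarrow> topspace T"
    using assms by (fastforce simp: points_def continuous_map_def)
  fix U assume U: "openin T U"
  have "{x \<in> points K. f x \<in> U} \<inter> closed_simplex \<sigma> = {x \<in> topspace (top_of_set (closed_simplex \<sigma>)). f x \<in> U}"
    if "\<sigma> \<in> K" for \<sigma> using that by (auto intro: pointsI)
  then show "openin (geometric_realization K) {x \<in> topspace (geometric_realization K). f x \<in> U}"
    using openin_continuous_map_preimage[OF assms U]
    by (auto simp: openin_realization points_def)
qed

lemma continuous_map_simplex_inclusion:
  assumes "\<sigma> \<in> K"
  shows "continuous_map (top_of_set (closed_simplex \<sigma>)) (geometric_realization K) (\<lambda>x. x)"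
  unfolding continuous_map_def
proof (intro conjI allI impI)
  show "(\<lambda>x. x) \<in> topspace (top_of_set (closed_simplex \<sigma>)) \<rightarrow> topspace (geometric_realization K)"
    using assms by (auto simp: points_def)
  fix U assume "openin (geometric_realization K) U"
  then have "openin (top_of_set (closed_simplex \<sigma>)) (U \<inter> closed_simplex \<sigma>)"
    using assms by (simp add: openin_realization)
  moreover have "{x \<in> topspace (top_of_set (closed_simplex \<sigma>)). x \<in> U} = U \<inter> closed_simplex \<sigma>" by auto
  ultimately show "openin (top_of_set (closed_simplex \<sigma>)) {x \<in> topspace (top_of_set (closed_simplex \<sigma>)). x \<in> U}"
    by metis
qed

lemma continuous_map_into_geometric_realization:
  assumes "\<tau> \<in> K" "continuous_on S f" "f ` S \<subseteq> closed_simplex \<tau>"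
  shows "continuous_map (top_of_set S) (geometric_realization K) f"
proof -
  have "continuous_map (top_of_set S) (top_of_set (closed_simplex \<tau>)) f"
    using assms by (auto simp: continuous_map_in_subtopology)
  from continuous_map_compose[OF this continuous_map_simplex_inclusion[OF assms(1)]]
  show ?thesis by (simp add: o_def)
qed

lemma continuous_map_simplex_restrict:
  assumes "continuous_map (prod_topology unit_interval (geometric_realization K)) T h" "\<sigma> \<in> K"
  shows "continuous_map (prod_topology unit_interval (top_of_set (closed_simplex \<sigma>))) T h"
proof -
  have "continuous_map (prod_topology unit_interval (top_of_set (closed_simplex \<sigma>)))
      (prod_topology unit_interval (geometric_realization K)) (\<lambda>z. (fst z, snd z))"
    by (intro continuous_map_pairedI continuous_map_fst
        continuous_map_compose[OF continuous_map_snd continuous_map_simplex_inclusion[OF assms(2)], unfolded o_def])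
  from continuous_map_compose[OF this assms(1)] show ?thesis
    by (simp add: o_def)
qed

lemma closedin_geometric_realization:
  "closedin (geometric_realization K) C \<longleftrightarrow> C \<subseteq> points K \<and> (\<forall>\<sigma>\<in>K. closed (C \<inter> closed_simplex \<sigma>))"
proof -
  have "openin (top_of_set (closed_simplex \<sigma>)) ((points K - C) \<inter> closed_simplex \<sigma>) \<longleftrightarrow>
      closed (C \<inter> closed_simplex \<sigma>)" if "\<sigma> \<in> K" "C \<subseteq> points K" for \<sigma>
  proof -
    have "(points K - C) \<inter> closed_simplex \<sigma> = closed_simplex \<sigma> - (C \<inter> closed_simplex \<sigma>)"
      using that by (auto intro: pointsI)
    then have "openin (top_of_set (closed_simplex \<sigma>)) ((points K - C) \<inter> closed_simplex \<sigma>) \<longleftrightarrow>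
       closedin (top_of_set (closed_simplex \<sigma>)) (C \<inter> closed_simplex \<sigma>)"
      by (simp add: closedin_def)
    also have "\<dots> \<longleftrightarrow> closed (C \<inter> closed_simplex \<sigma>)"
      using closedin_closed_eq closed_closed_simplex by auto
    finally show ?thesis .
  qed
  then show ?thesis
    unfolding closedin_def openin_realization topspace_realization
    by blast
qed

lemma points_Int_simplex:
  assumes "simplicial L" "finite \<sigma>"
  shows "points L \<inter> closed_simplex \<sigma> = (\<Union>\<tau>\<in>{\<tau>\<in>L. \<tau> \<subseteq> \<sigma>}. closed_simplex \<tau>)"
proof (intro subset_antisym subsetI)
  fix x assume "x \<in> points L \<inter> closed_simplex \<sigma>"
  then show "x \<in> (\<Union>\<tau>\<in>{\<tau>\<in>L. \<tau> \<subseteq> \<sigma>}. closed_simplex \<tau>)"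
    using points_support[OF assms(1)] closed_simplex_support(1)[of x \<sigma>] assms(2) by blast
next
  fix x assume "x \<in> (\<Union>\<tau>\<in>{\<tau>\<in>L. \<tau> \<subseteq> \<sigma>}. closed_simplex \<tau>)"
  then show "x \<in> points L \<inter> closed_simplex \<sigma>"
    using closed_simplex_mono[OF _ assms(2)] by blast
qed

lemma geometric_realization_subcomplex:
  assumes K: "simplicial K" and L: "simplicial L" and "L \<subseteq> K"
  shows "subtopology (geometric_realization K) (points L) = geometric_realization L"
proof (subst eq_commute, subst topology_eq, intro allI iffI)
  have LK: "points L \<subseteq> points K" using assms(3) by (rule points_mono)
  fix U
  have 1: "openin (subtopology (geometric_realization K) (points L)) U \<Longrightarrow> openin (geometric_realization L) U" for U
  proof -
    assume "openin (subtopology (geometric_realization K) (points L)) U"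
    then obtain V where V: "openin (geometric_realization K) V" "U = V \<inter> points L"
      by (auto simp: openin_subtopology)
    have "U \<inter> closed_simplex \<sigma> = V \<inter> closed_simplex \<sigma>" if "\<sigma> \<in> L" for \<sigma>
      using V that by auto
    then show "openin (geometric_realization L) U"
      using V \<open>L \<subseteq> K\<close> by (auto simp: openin_realization)
  qed
  then show "openin (subtopology (geometric_realization K) (points L)) U \<Longrightarrow> openin (geometric_realization L) U" .
  assume U: "openin (geometric_realization L) U"
  define C where "C = points L - U"
  have "closedin (geometric_realization L) C"
    using openin_closedin_eq[of "geometric_realization L" U] U by (simp add: C_def)
  then have C: "\<And>\<tau>. \<tau> \<in> L \<Longrightarrow> closed (C \<inter> closed_simplex \<tau>)"
    by (auto simp: closedin_geometric_realization)
  have "closed (C \<inter> closed_simplex \<sigma>)" if "\<sigma> \<in> K" for \<sigma>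
  proof -
    have fin: "finite \<sigma>" using simplicialD[OF K that] by auto
    have "C \<inter> closed_simplex \<sigma> = C \<inter> (points L \<inter> closed_simplex \<sigma>)"
      by (auto simp: C_def)
    also have "\<dots> = (\<Union>\<tau>\<in>{\<tau>\<in>L. \<tau> \<subseteq> \<sigma>}. C \<inter> closed_simplex \<tau>)"
      unfolding points_Int_simplex[OF L fin] by blast
    also have "closed \<dots>"
      using C fin by (intro closed_UN) auto
    finally show ?thesis .
  qed
  then have "closedin (geometric_realization K) C"
    using LK by (auto simp: closedin_geometric_realization C_def)
  then have "openin (geometric_realization K) (points K - C)"
    by (metis closedin_def topspace_realization)
  moreover have "U = (points K - C) \<inter> points L"
    using openin_subset[OF U] LK by (auto simp: C_def points_def)
  ultimately show "openin (subtopology (geometric_realization K) (points L)) U"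
    by (auto simp: openin_subtopology)
qed

section \<open>Strong deformation retractions\<close>

lemma points_Un: "points (K \<union> L) = points K \<union> points L"
  by (simp add: points_def)

lemma continuous_on_sum_coordinates:
  fixes f :: "'b::topological_space \<Rightarrow> 'v \<Rightarrow> real"
  assumes "continuous_on S f"
  shows "continuous_on S (\<lambda>x. \<Sum>v\<in>B. f x v)"
  by (intro continuous_on_sum continuous_on_coordinate assms)

lemma homotopic_straight_line:
  assumes K: "simplicial K"
    and f: "\<And>\<sigma>. \<sigma> \<in> K \<Longrightarrow> continuous_on (closed_simplex \<sigma>) f"
    and im: "\<And>\<sigma>. \<sigma> \<in> K \<Longrightarrow> \<exists>\<tau>\<in>K. \<sigma> \<subseteq> \<tau> \<and> f ` closed_simplex \<sigma> \<subseteq> closed_simplex \<tau>"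
    and fixed: "\<And>x. x \<in> F \<Longrightarrow> f x = x"
  shows "homotopic_with (\<lambda>h. \<forall>x\<in>F. h x = x) (geometric_realization K) (geometric_realization K) id f"
proof -
  define h where "h = (\<lambda>z. (\<lambda>v. (1 - fst z) * snd z v + fst z * f (snd z) v))"
  have "continuous_map (prod_topology unit_interval (geometric_realization K)) (geometric_realization K) h"
  proof (rule continuous_map_from_geometric_realization_prod)
    fix \<sigma> assume \<sigma>: "\<sigma> \<in> K"
    then obtain \<tau> where \<tau>: "\<tau> \<in> K" "\<sigma> \<subseteq> \<tau>" "f ` closed_simplex \<sigma> \<subseteq> closed_simplex \<tau>"
      using im by blast
    have "continuous_on ({0..1} \<times> closed_simplex \<sigma>) (\<lambda>z. f (snd z))"
      by (rule continuous_on_compose2[OF f[OF \<sigma>]]) (auto intro: continuous_intros)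
    then have "continuous_on ({0..1} \<times> closed_simplex \<sigma>) (\<lambda>z. f (snd z) v)" for v
      by (rule continuous_on_coordinate)
    moreover have "continuous_on ({0..1} \<times> closed_simplex \<sigma>) (\<lambda>z. snd z v)" for v
      by (intro continuous_on_coordinate continuous_on_snd continuous_on_id)
    ultimately have "continuous_on ({0..1} \<times> closed_simplex \<sigma>) h"
      unfolding h_def
      by (intro continuous_on_coordinatewise_then_product continuous_on_add continuous_on_mult
          continuous_on_diff continuous_on_const continuous_on_fst continuous_on_id)
    moreover have "h ` ({0..1} \<times> closed_simplex \<sigma>) \<subseteq> closed_simplex \<tau>"
    proof clarify
      fix t :: real and x assume t: "t \<in> {0..1}" and x: "x \<in> closed_simplex \<sigma>"
      have "x \<in> closed_simplex \<tau>" "f x \<in> closed_simplex \<tau>"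
        using x \<tau> closed_simplex_mono[of \<sigma> \<tau>] simplicialD(1)[OF K] by auto
      then show "h (t, x) \<in> closed_simplex \<tau>"
        using t by (auto simp: h_def closed_simplex_def sum.distrib sum_distrib_left[symmetric])
    qed
    ultimately show "continuous_map (prod_topology unit_interval (top_of_set (closed_simplex \<sigma>)))
        (geometric_realization K) h"
      unfolding prod_unit_interval_simplex by (rule continuous_map_into_geometric_realization[OF \<tau>(1)])
  qed
  moreover have "h (t, x) = x" if "x \<in> F" for t x
    using fixed[OF that] by (auto simp: h_def algebra_simps)
  ultimately show ?thesis
    unfolding homotopic_with_def by (intro exI[of _ h]) (auto simp: h_def)
qed

definition strong_deformation_retract :: "'v set set \<Rightarrow> 'v set set \<Rightarrow> bool" where
  "strong_deformation_retract K L \<longleftrightarrow> (\<exists>f. f ` points K \<subseteq> points L \<and>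
     homotopic_with (\<lambda>h. \<forall>x\<in>points L. h x = x) (geometric_realization K) (geometric_realization K) id f)"

lemma strong_deformation_retract_trans:
  assumes K: "simplicial K" and L: "simplicial L" "L \<subseteq> K" and M: "M \<subseteq> L"
    and KL: "strong_deformation_retract K L" and LM: "strong_deformation_retract L M"
  shows "strong_deformation_retract K M"
proof -
  obtain f where f: "f ` points K \<subseteq> points L"
    "homotopic_with (\<lambda>h. \<forall>x\<in>points L. h x = x) (geometric_realization K) (geometric_realization K) id f"
    using KL unfolding strong_deformation_retract_def by blast
  obtain g where g: "g ` points L \<subseteq> points M"
    "homotopic_with (\<lambda>h. \<forall>x\<in>points M. h x = x) (geometric_realization L) (geometric_realization L) id g"
    using LM unfolding strong_deformation_retract_def by blast
  have sub_ML: "points M \<subseteq> points L" by (rule points_mono[OF M])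
  have LK: "subtopology (geometric_realization K) (points L) = geometric_realization L"
    by (rule geometric_realization_subcomplex[OF K L])
  have 1: "homotopic_with (\<lambda>h. \<forall>x\<in>points M. h x = x) (geometric_realization K) (geometric_realization K) id f"
    by (rule homotopic_with_mono[OF f(2)]) (use sub_ML in blast)
  have fL: "continuous_map (geometric_realization K) (geometric_realization L) f"
    using homotopic_with_imp_continuous_maps[OF f(2)] f(1)
    by (auto simp: LK[symmetric] continuous_map_in_subtopology )
  have ffix: "\<And>x. x \<in> points M \<Longrightarrow> f x = x"
    using homotopic_with_imp_property[OF f(2)] sub_ML by blast
  have "continuous_map (geometric_realization L) (geometric_realization K) id"
    unfolding LK[symmetric] by (simp add: continuous_map_from_subtopology)
  from homotopic_with_compose_continuous_map_left[OF g(2) this, of "\<lambda>h. \<forall>x\<in>points M. h x = x"]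
  have "homotopic_with (\<lambda>h. \<forall>x\<in>points M. h x = x) (geometric_realization L) (geometric_realization K) id g"
    by simp
  from homotopic_with_compose_continuous_map_right[OF this fL, of "\<lambda>h. \<forall>x\<in>points M. h x = x"]
  have "homotopic_with (\<lambda>h. \<forall>x\<in>points M. h x = x) (geometric_realization K) (geometric_realization K) f (g \<circ> f)"
    using ffix by (simp add: o_def)
  from homotopic_with_trans[OF 1 this]
  show ?thesis
    unfolding strong_deformation_retract_def using f(1) g(1) by (intro exI[of _ "g \<circ> f"]) (auto simp: image_subset_iff)
qed

lemma strong_deformation_retract_union:
  assumes K1: "simplicial K1" and K2: "simplicial K2" and "L \<subseteq> K1"
    and int: "points K1 \<inter> points K2 \<subseteq> points L" and strong_deformation_retract: "strong_deformation_retract K2 L"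
  shows "strong_deformation_retract (K1 \<union> K2) K1"
proof -
  let ?K = "K1 \<union> K2"
  obtain f h where f: "f ` points K2 \<subseteq> points L"
    and h: "continuous_map (prod_topology unit_interval (geometric_realization K2)) (geometric_realization K2) h"
      "\<And>x. h (0, x) = x" "\<And>x. h (1, x) = f x" "\<And>t x. t \<in> {0..1} \<Longrightarrow> x \<in> points L \<Longrightarrow> h (t, x) = x"
    using strong_deformation_retract unfolding strong_deformation_retract_def homotopic_with_def by auto
  have K: "simplicial ?K" using K1 K2 by (auto simp: simplicial_def)
  define h' where "h' = (\<lambda>(t, x). if x \<in> points K2 then h (t, x) else x)"
  have "continuous_map (prod_topology unit_interval (geometric_realization ?K)) (geometric_realization ?K) h'"
  proof (rule continuous_map_from_geometric_realization_prod)
    fix \<sigma> assume \<sigma>: "\<sigma> \<in> ?K"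
    show "continuous_map (prod_topology unit_interval (top_of_set (closed_simplex \<sigma>))) (geometric_realization ?K) h'"
    proof (cases "\<sigma> \<in> K2")
      case True
      have "continuous_map (geometric_realization K2) (geometric_realization ?K) id"
        unfolding geometric_realization_subcomplex[OF K K2 Un_upper2, symmetric]
        by (simp add: continuous_map_from_subtopology)
      from continuous_map_compose[OF continuous_map_simplex_restrict[OF h(1) True] this]
      have "continuous_map (prod_topology unit_interval (top_of_set (closed_simplex \<sigma>))) (geometric_realization ?K) h"
        by simp
      then show ?thesis
        by (rule continuous_map_eq) (use True in \<open>auto simp: h'_def\<close>)
    next
      case False
      then have s: "\<sigma> \<in> K1" using \<sigma> by auto
      have "continuous_map (prod_topology unit_interval (top_of_set (closed_simplex \<sigma>))) (geometric_realization ?K) snd"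
        by (rule continuous_map_compose[OF continuous_map_snd continuous_map_simplex_inclusion[OF \<sigma>], unfolded o_def])
      then show ?thesis
      proof (rule continuous_map_eq)
        fix z assume "z \<in> topspace (prod_topology unit_interval (top_of_set (closed_simplex \<sigma>)))"
        then have z: "fst z \<in> {0..1}" "snd z \<in> points K1" using s by auto
        show "snd z = h' z"
        proof (cases "snd z \<in> points K2")
          case True
          then have "snd z \<in> points L" using z int by blast
          then have "h (fst z, snd z) = snd z" using h(4) z by blast
          then show ?thesis using True by (cases z) (simp add: h'_def)
        qed (cases z, simp add: h'_def)
      qed
    qed
  qed
  moreover have "h' (t, x) = x" if t: "t \<in> {0..1}" and x: "x \<in> points K1" for t x
  proof (cases "x \<in> points K2")
    case True
    then have "x \<in> points L" using x int by blast
    then show ?thesis using h(4) t by (simp add: h'_def)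
  qed (simp add: h'_def)
  ultimately have "homotopic_with (\<lambda>h. \<forall>x\<in>points K1. h x = x) (geometric_realization ?K) (geometric_realization ?K)
     id (\<lambda>x. h' (1, x))"
    unfolding homotopic_with_def by (intro exI[of _ h']) (auto simp: h'_def h)
  moreover have "(\<lambda>x. h' (1, x)) ` points ?K \<subseteq> points K1"
  proof (rule image_subsetI)
    fix x assume x: "x \<in> points ?K"
    show "h' (1, x) \<in> points K1"
    proof (cases "x \<in> points K2")
      case True
      then have "f x \<in> points L" using f by blast
      then show ?thesis using True points_mono[OF \<open>L \<subseteq> K1\<close>] by (auto simp: h'_def h(3))
    qed (use x in \<open>auto simp: h'_def points_Un\<close>)
  qed
  ultimately show ?thesis unfolding strong_deformation_retract_def by blast
qed

lemma contractible_space_sdr: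
  assumes K: "simplicial K" and L: "simplicial L" "L \<subseteq> K"
    and "strong_deformation_retract K L" and contr: "contractible_space (geometric_realization L)"
  shows "contractible_space (geometric_realization K)"
proof -
  obtain f where f: "f ` points K \<subseteq> points L"
    "homotopic_with (\<lambda>h. \<forall>x\<in>points L. h x = x) (geometric_realization K) (geometric_realization K) id f"
    using assms(4) unfolding strong_deformation_retract_def by blast
  have LK: "subtopology (geometric_realization K) (points L) = geometric_realization L"
    by (rule geometric_realization_subcomplex[OF K L])
  have fL: "continuous_map (geometric_realization K) (geometric_realization L) f"
    using homotopic_with_imp_continuous_maps[OF f(2)] f(1)
    by (auto simp: LK[symmetric] continuous_map_in_subtopology )
  have incl: "continuous_map (geometric_realization L) (geometric_realization K) id"
    unfolding LK[symmetric] by (simp add: continuous_map_from_subtopology)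
  have "homotopic_with (\<lambda>h. True) (geometric_realization K) (geometric_realization K) (id \<circ> f) id"
    using homotopic_with_mono[OF f(2), of "\<lambda>h. True"] by (simp add: homotopic_with_sym)
  then show ?thesis
    by (rule homotopy_dominated_contractibility[OF incl fL _ contr])
qed

lemma continuous_map_simplexwise:
  assumes "\<And>\<sigma>. \<sigma> \<in> K \<Longrightarrow> continuous_on (closed_simplex \<sigma>) f"
    and "\<And>\<sigma>. \<sigma> \<in> K \<Longrightarrow> \<exists>\<tau>\<in>L. f ` closed_simplex \<sigma> \<subseteq> closed_simplex \<tau>"
  shows "continuous_map (geometric_realization K) (geometric_realization L) f"
  using assms by (meson continuous_map_from_geometric_realization continuous_map_into_geometric_realization)

lemma sum_closed_simplex:
  assumes "x \<in> closed_simplex \<sigma>" "finite \<sigma>" "finite B"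
  shows "(\<Sum>v\<in>\<sigma> \<inter> B. x v) = (\<Sum>v\<in>B. x v)"
  using assms by (intro sum.mono_neutral_left) (auto simp: closed_simplex_def)

lemma simplicial_faces:
  assumes "finite P"
  shows "simplicial {\<tau>. \<tau> \<subseteq> P \<and> \<tau> \<noteq> {}}"
  using assms finite_subset by (auto simp: simplicial_def)

lemma points_faces:
  assumes "finite P" "P \<noteq> {}"
  shows "points {\<tau>. \<tau> \<subseteq> P \<and> \<tau> \<noteq> {}} = closed_simplex P"
  using assms closed_simplex_mono[of _ P] by (auto simp: points_def)

text \<open>
  A contraction \<open>H\<close> of \<open>K\<close> need not fix the simplex \<open>P\<close>. With \<open>mass x\<close> the total weight of \<open>x\<close> on \<open>P\<close>, the
  map \<open>\<mu>\<close> doubles this weight (up to 1), so that a neighbourhood of \<open>P\<close> is pushed into \<open>P\<close>, and \<open>\<rho>\<close>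
  retracts \<open>K\<close> onto \<open>P\<close>. Running \<open>H\<close> only up to time \<open>m x\<close>, which vanishes on \<open>P\<close>, gives homotopies
  relative to \<open>P\<close> from \<open>\<mu>\<close> and from \<open>\<rho> \<circ> \<mu>\<close> to one and the same map: where \<open>mass x \<le> 1/2\<close> both end
  in the constant value of \<open>H\<close> at time 1, and elsewhere \<open>\<mu> x\<close> lies in \<open>P\<close> already.
\<close>

lemma strong_deformation_retract_faces:
  assumes K: "simplicial K" and P: "P \<in> K" and contr: "contractible_space (geometric_realization K)"
  shows "strong_deformation_retract K {\<tau>. \<tau> \<subseteq> P \<and> \<tau> \<noteq> {}}"
proof -
  have finP: "finite P" and "P \<noteq> {}" using simplicialD[OF K P] by auto
  then obtain p0 where p0: "p0 \<in> P" by blast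
  have pts: "points {\<tau>. \<tau> \<subseteq> P \<and> \<tau> \<noteq> {}} = closed_simplex P"
    by (rule points_faces) fact+
  let ?X = "geometric_realization K"
  let ?Q = "\<lambda>h :: ('a \<Rightarrow> real) \<Rightarrow> 'a \<Rightarrow> real. \<forall>x\<in>closed_simplex P. h x = x"
  obtain a H where H: "continuous_map (prod_topology unit_interval ?X) ?X H"
    "\<And>x. H (0, x) = x" "\<And>x. H (1, x) = a"
    using contr unfolding contractible_space_def homotopic_with_def by auto
  define mass where "mass x = (\<Sum>v\<in>P. x v)" for x :: "'a \<Rightarrow> real"
  define \<mu> where "\<mu> x v = (if v \<in> P then x v / max (1/2) (mass x)
      else x v * (max 0 (1 - 2 * mass x) / max (1/2) (1 - mass x)))" for x :: "'a \<Rightarrow> real" and v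
  define \<rho> where "\<rho> x v = (if v \<in> P then x v + (if v = p0 then 1 - mass x else 0) else 0)" for x :: "'a \<Rightarrow> real" and v
  define m where "m x = min 1 (2 - 2 * mass x)" for x
  have cont_mass: "continuous_on S mass" for S
    unfolding mass_def by (intro continuous_on_sum_coordinates continuous_on_id)
  have cont_coord: "continuous_on S (\<lambda>x :: 'a \<Rightarrow> real. x v)" for S v
    by (intro continuous_on_coordinate continuous_on_id)
  have mass: "0 \<le> mass x" "mass x \<le> 1" "(\<Sum>v\<in>\<sigma>\<inter>P. x v) = mass x" "(\<Sum>v\<in>\<sigma>-P. x v) = 1 - mass x"
    if "x \<in> closed_simplex \<sigma>" "\<sigma> \<in> K" for x \<sigma>
  proof -
    have fin: "finite \<sigma>" using simplicialD[OF K that(2)] by auto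
    show 1: "(\<Sum>v\<in>\<sigma>\<inter>P. x v) = mass x"
      using sum_closed_simplex[OF that(1) fin finP] by (simp add: mass_def)
    have "(\<Sum>v\<in>\<sigma>. x v) = (\<Sum>v\<in>\<sigma>\<inter>P. x v) + (\<Sum>v\<in>\<sigma>-P. x v)"
      using fin by (metis sum.Int_Diff)
    then show 2: "(\<Sum>v\<in>\<sigma>-P. x v) = 1 - mass x" using 1 that by (auto simp: closed_simplex_def)
    have nn: "\<And>v. 0 \<le> x v" using that by (auto simp: closed_simplex_def)
    show "0 \<le> mass x" "mass x \<le> 1"
      using 1 2 sum_nonneg[of "\<sigma>\<inter>P" x] sum_nonneg[of "\<sigma>-P" x] nn by auto
  qed
  have mass_pts: "0 \<le> mass x" "mass x \<le> 1" if "x \<in> points K" for x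
    using that mass(1,2) by (auto elim: pointsE)
  have massP: "mass x = 1" if "x \<in> closed_simplex P" for x
    using that by (auto simp: mass_def closed_simplex_def)
  have \<mu>_simplex: "\<mu> ` closed_simplex \<sigma> \<subseteq> closed_simplex \<sigma>" if "\<sigma> \<in> K" for \<sigma>
  proof (rule image_subsetI)
    fix x assume x: "x \<in> closed_simplex \<sigma>"
    note m = mass[OF x that]
    have fin: "finite \<sigma>" using simplicialD[OF K that] by auto
    have "(\<Sum>v\<in>\<sigma>. \<mu> x v) = (\<Sum>v\<in>\<sigma>\<inter>P. \<mu> x v) + (\<Sum>v\<in>\<sigma>-P. \<mu> x v)"
      using fin by (metis sum.Int_Diff)
    also have "\<dots> = (\<Sum>v\<in>\<sigma>\<inter>P. x v / max (1/2) (mass x))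
        + (\<Sum>v\<in>\<sigma>-P. x v * (max 0 (1 - 2 * mass x) / max (1/2) (1 - mass x)))"
      by (intro arg_cong2[where f="(+)"] sum.cong) (auto simp: \<mu>_def)
    also have "\<dots> = mass x / max (1/2) (mass x) + (1 - mass x) * (max 0 (1 - 2 * mass x) / max (1/2) (1 - mass x))"
      by (simp add: m(3,4) sum_divide_distrib[symmetric] sum_distrib_right[symmetric])
    also have "\<dots> = 1"
      using m(1,2) by (auto simp: max_def field_simps)
    finally have "(\<Sum>v\<in>\<sigma>. \<mu> x v) = 1" .
    then show "\<mu> x \<in> closed_simplex \<sigma>"
      using x by (auto simp: closed_simplex_def \<mu>_def)
  qed
  have \<mu>_cont: "continuous_on S \<mu>" for S
  proof (rule continuous_on_coordinatewise_then_product)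
    fix v
    show "continuous_on S (\<lambda>x. \<mu> x v)"
      by (cases "v \<in> P") (auto simp: \<mu>_def intro!: continuous_on_divide continuous_on_mult continuous_on_max
          continuous_on_diff continuous_on_const cont_mass cont_coord)
  qed
  have \<mu>_fix: "\<mu> x = x" if "x \<in> closed_simplex P" for x
    using that massP[OF that] by (auto simp: \<mu>_def closed_simplex_def fun_eq_iff)
  have 1: "homotopic_with ?Q ?X ?X id \<mu>"
    by (rule homotopic_straight_line[OF K]) (use \<mu>_cont \<mu>_simplex \<mu>_fix in blast)+
  have \<rho>_simplex: "\<rho> ` closed_simplex \<sigma> \<subseteq> closed_simplex P" if "\<sigma> \<in> K" for \<sigma>
  proof (rule image_subsetI)
    fix x assume x: "x \<in> closed_simplex \<sigma>"
    have "(\<Sum>v\<in>P. \<rho> x v) = (\<Sum>v\<in>P. x v) + (\<Sum>v\<in>P. if v = p0 then 1 - mass x else 0)"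
      by (simp add: \<rho>_def sum.distrib)
    also have "\<dots> = 1"
      using finP p0 by (simp add: mass_def)
    finally show "\<rho> x \<in> closed_simplex P"
      using x mass(2)[OF x that] by (auto simp: closed_simplex_def \<rho>_def)
  qed
  have \<rho>_cont: "continuous_on S \<rho>" for S
  proof (rule continuous_on_coordinatewise_then_product)
    fix v
    show "continuous_on S (\<lambda>x. \<rho> x v)"
      by (cases "v \<in> P"; cases "v = p0") (auto simp: \<rho>_def intro!: continuous_on_add
          continuous_on_diff continuous_on_const cont_mass cont_coord)
  qed
  have \<rho>_fix: "\<rho> x = x" if "x \<in> closed_simplex P" for x
    using that massP[OF that] by (auto simp: \<rho>_def closed_simplex_def fun_eq_iff)
  have \<rho>_map: "continuous_map ?X ?X \<rho>"
    by (rule continuous_map_simplexwise) (use \<rho>_cont \<rho>_simplex P in blast)+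
  have \<mu>_map: "continuous_map ?X ?X \<mu>"
    by (rule continuous_map_simplexwise) (use \<mu>_cont \<mu>_simplex in blast)+
  have m_map: "continuous_map ?X euclideanreal m"
    by (rule continuous_map_from_geometric_realization)
      (auto simp: m_def intro!: continuous_on_min continuous_on_const continuous_on_diff continuous_on_mult cont_mass)
  have m01: "0 \<le> m x" "m x \<le> 1" if "x \<in> points K" for x
    using mass_pts[OF that] by (auto simp: m_def)
  have slide: "homotopic_with ?Q ?X ?X g (\<lambda>x. H (m x, g x))"
    if g: "continuous_map ?X ?X g" and gfix: "\<And>x. x \<in> closed_simplex P \<Longrightarrow> g x = x" for g
  proof -
    define h where "h = (\<lambda>(t, x). H (min t (m x), g x))"
    have "continuous_map (prod_topology unit_interval ?X) (prod_topology unit_interval ?X)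
        (\<lambda>z. (min (fst z) (m (snd z)), g (snd z)))"
    proof (rule continuous_map_pairedI)
      have "continuous_map (prod_topology unit_interval ?X) euclideanreal (\<lambda>z. min (fst z) (m (snd z)))"
        by (intro continuous_map_real_min continuous_map_compose[OF continuous_map_snd m_map, unfolded o_def]
           continuous_map_into_fulltopology[OF continuous_map_fst])
      then show "continuous_map (prod_topology unit_interval ?X) unit_interval (\<lambda>z. min (fst z) (m (snd z)))"
        using m01 by (auto simp: continuous_map_in_subtopology)
      show "continuous_map (prod_topology unit_interval ?X) ?X (\<lambda>z. g (snd z))"
        by (rule continuous_map_compose[OF continuous_map_snd g, unfolded o_def])
    qed
    from continuous_map_compose[OF this H(1)]
    have "continuous_map (prod_topology unit_interval ?X) ?X h"
      by (simp add: h_def o_def case_prod_unfold)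
    moreover have "h (0, x) = g x" if "x \<in> topspace ?X" for x
      using m01[of x] that H(2) by (simp add: h_def min_def)
    moreover have "h (1, x) = H (m x, g x)" if "x \<in> topspace ?X" for x
      using m01[of x] that by (simp add: h_def min_def)
    moreover have "h (t, x) = x" if "t \<in> {0..1}" "x \<in> closed_simplex P" for t x
      using that massP[of x] gfix[of x] H(2) by (simp add: h_def m_def min_absorb2)
    moreover have "?Q u \<longleftrightarrow> ?Q w" if "\<And>x. x \<in> topspace ?X \<Longrightarrow> u x = w x" for u w
      using that P by (intro ball_cong HOL.refl) force
    ultimately show ?thesis
      by (subst homotopic_with) (blast, intro exI[of _ h] conjI ballI, simp_all)
  qed
  have 2: "homotopic_with ?Q ?X ?X \<mu> (\<lambda>x. H (m x, \<mu> x))"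
    by (rule slide[OF \<mu>_map \<mu>_fix])
  have \<rho>\<mu>: "continuous_map ?X ?X (\<lambda>x. \<rho> (\<mu> x))"
    using continuous_map_compose[OF \<mu>_map \<rho>_map] by (simp add: o_def)
  have 4: "homotopic_with ?Q ?X ?X (\<lambda>x. H (m x, \<rho> (\<mu> x))) (\<lambda>x. \<rho> (\<mu> x))"
    by (rule homotopic_with_symD, rule slide[OF \<rho>\<mu>]) (simp add: \<mu>_fix \<rho>_fix)
  have 3: "homotopic_with ?Q ?X ?X (\<lambda>x. H (m x, \<mu> x)) (\<lambda>x. H (m x, \<rho> (\<mu> x)))"
  proof (rule homotopic_with_equal)
    show "?Q (\<lambda>x. H (m x, \<mu> x))" using homotopic_with_imp_property[OF 2] by blast
    show "?Q (\<lambda>x. H (m x, \<rho> (\<mu> x)))" using homotopic_with_imp_property[OF 4] by blast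
    show "continuous_map ?X ?X (\<lambda>x. H (m x, \<mu> x))" using homotopic_with_imp_continuous_maps[OF 2] by blast
    fix x assume "x \<in> topspace ?X"
    then obtain \<sigma> where \<sigma>: "\<sigma> \<in> K" "x \<in> closed_simplex \<sigma>" by (auto elim: pointsE)
    show "H (m x, \<mu> x) = H (m x, \<rho> (\<mu> x))"
    proof (cases "mass x \<le> 1/2")
      case True
      then have "m x = 1" by (simp add: m_def)
      then show ?thesis by (simp add: H)
    next
      case False
      have fin: "finite \<sigma>" using simplicialD[OF K \<sigma>(1)] by auto
      have "\<mu> x \<in> closed_simplex \<sigma>" using \<mu>_simplex \<sigma> by blast
      moreover have "\<mu> x v = 0" if "v \<notin> P" for v
        using False that by (simp add: \<mu>_def)
      ultimately have "\<mu> x \<in> closed_simplex P"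
        using closed_simplex_support_subset[of "\<mu> x" \<sigma> P] fin finP by blast
      then show ?thesis by (simp add: \<rho>_fix)
    qed
  qed
  have "homotopic_with ?Q ?X ?X id (\<lambda>x. \<rho> (\<mu> x))"
    using homotopic_with_trans[OF homotopic_with_trans[OF homotopic_with_trans[OF 1 2] 3] 4] .
  moreover have "(\<lambda>x. \<rho> (\<mu> x)) ` points K \<subseteq> closed_simplex P"
    using \<mu>_simplex \<rho>_simplex by (fastforce elim: pointsE)
  ultimately show ?thesis
    unfolding strong_deformation_retract_def pts by blast
qed

text \<open>
  Each coordinate in \<open>B\<close> is lowered by the total weight on \<open>D\<close> (stopping at 0) and vice versa, and the
  weight removed is given to \<open>p0\<close>. The lighter of the two sides ends up with weight 0, and nothing
  happens when one of them has weight 0. Unlike a proportional rescaling this involves no division.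
\<close>

lemma strong_deformation_retract_push:
  fixes K :: "'v set set"
  assumes K: "simplicial K" and BD: "B \<inter> D = {}" "p0 \<notin> B" "p0 \<notin> D"
    and ins: "\<And>\<sigma>. \<sigma> \<in> K \<Longrightarrow> \<sigma> \<inter> B \<noteq> {} \<Longrightarrow> \<sigma> \<inter> D \<noteq> {} \<Longrightarrow> insert p0 \<sigma> \<in> K"
  shows "strong_deformation_retract K {\<sigma>\<in>K. \<sigma> \<inter> B = {} \<or> \<sigma> \<inter> D = {}}"
proof -
  let ?L = "{\<sigma>\<in>K. \<sigma> \<inter> B = {} \<or> \<sigma> \<inter> D = {}}"
  define mass where "mass E x = (\<Sum>v | v \<in> E \<and> x v \<noteq> 0. x v)" for E and x :: "'v \<Rightarrow> real"
  define r where "r x v = (if v \<in> B then min (x v) (mass D x) else if v \<in> D then min (x v) (mass B x) else 0)"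
    for x v
  define f where "f x v = x v - r x v + (if v = p0 then \<Sum>v | x v \<noteq> 0. r x v else 0)" for x v
  have mass: "mass E x = (\<Sum>v\<in>\<sigma>\<inter>E. x v)" if "x \<in> closed_simplex \<sigma>" "finite \<sigma>" for E x \<sigma>
    unfolding mass_def using that by (intro sum.mono_neutral_left) (auto simp: closed_simplex_def)
  have mass_nn: "0 \<le> mass E x" if "x \<in> closed_simplex \<sigma>" "finite \<sigma>" for E x \<sigma>
    using mass[OF that] that by (auto simp: closed_simplex_def intro: sum_nonneg)
  have r_0: "r x v = 0" if "x \<in> closed_simplex \<sigma>" "finite \<sigma>" "x v = 0" for x v \<sigma>
    using mass_nn[OF that(1,2)] that(3) by (simp add: r_def)
  have R: "(\<Sum>v | x v \<noteq> 0. r x v) = (\<Sum>v\<in>\<sigma>. r x v)" if "x \<in> closed_simplex \<sigma>" "finite \<sigma>" for x \<sigma>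
    using that r_0[OF that] by (intro sum.mono_neutral_left) (auto simp: closed_simplex_def)
  have r_bounds: "0 \<le> r x v" "r x v \<le> x v" if "x \<in> closed_simplex \<sigma>" "finite \<sigma>" for x v \<sigma>
    using mass_nn[OF that, of B] mass_nn[OF that, of D] that by (auto simp: r_def closed_simplex_def)
  have r_trivial: "r x v = 0" if "x \<in> closed_simplex \<sigma>" "finite \<sigma>" "\<sigma> \<inter> B = {} \<or> \<sigma> \<inter> D = {}" for x v \<sigma>
    using that(3)
  proof
    assume B: "\<sigma> \<inter> B = {}"
    then have "mass B x = 0" using mass[OF that(1,2)] by simp
    moreover have "0 \<le> x v" using that by (auto simp: closed_simplex_def)
    moreover have "x v = 0" if "v \<in> B" using B that \<open>x \<in> closed_simplex \<sigma>\<close> by (auto simp: closed_simplex_def)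
    ultimately show ?thesis using mass_nn[OF that(1,2)] by (auto simp: r_def)
  next
    assume D: "\<sigma> \<inter> D = {}"
    then have "mass D x = 0" using mass[OF that(1,2)] by simp
    moreover have "0 \<le> x v" using that by (auto simp: closed_simplex_def)
    moreover have "x v = 0" if "v \<in> D" using D that \<open>x \<in> closed_simplex \<sigma>\<close> by (auto simp: closed_simplex_def)
    ultimately show ?thesis using mass_nn[OF that(1,2)] by (auto simp: r_def)
  qed
  have f_trivial: "f x = x" if "x \<in> closed_simplex \<sigma>" "finite \<sigma>" "\<sigma> \<inter> B = {} \<or> \<sigma> \<inter> D = {}" for x \<sigma>
    using r_trivial[OF that] by (auto simp: f_def fun_eq_iff)
  have f_fix: "f x = x" if "x \<in> points ?L" for x
    using that f_trivial simplicialD(1)[OF K] by (auto elim!: pointsE)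
  have f_ins: "f x \<in> closed_simplex (insert p0 \<sigma>)" if "x \<in> closed_simplex \<sigma>" "finite \<sigma>" for x \<sigma>
  proof -
    have "(\<Sum>v\<in>insert p0 \<sigma>. f x v) = (\<Sum>v\<in>insert p0 \<sigma>. x v) - (\<Sum>v\<in>insert p0 \<sigma>. r x v) + (\<Sum>v\<in>\<sigma>. r x v)"
      using that by (simp add: f_def sum.distrib sum_subtractf R[OF that])
    also have "(\<Sum>v\<in>insert p0 \<sigma>. r x v) = (\<Sum>v\<in>\<sigma>. r x v)"
      using that BD r_0[OF that] by (intro sum.mono_neutral_right) (auto simp: closed_simplex_def)
    also have "(\<Sum>v\<in>insert p0 \<sigma>. x v) = (\<Sum>v\<in>\<sigma>. x v)"
      using that by (intro sum.mono_neutral_right) (auto simp: closed_simplex_def)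
    finally have "(\<Sum>v\<in>insert p0 \<sigma>. f x v) = 1" using that by (auto simp: closed_simplex_def)
    moreover have "0 \<le> f x v" for v
      using r_bounds[OF that] by (auto simp: f_def intro!: add_nonneg_nonneg sum_nonneg)
    moreover have "f x v = 0" if "v \<notin> insert p0 \<sigma>" for v
      using that r_0[OF \<open>x \<in> closed_simplex \<sigma>\<close> \<open>finite \<sigma>\<close>] \<open>x \<in> closed_simplex \<sigma>\<close> by (auto simp: f_def closed_simplex_def)
    ultimately show ?thesis by (auto simp: closed_simplex_def)
  qed
  have im: "\<exists>\<tau>\<in>K. \<sigma> \<subseteq> \<tau> \<and> f ` closed_simplex \<sigma> \<subseteq> closed_simplex \<tau>" if \<sigma>: "\<sigma> \<in> K" for \<sigma>
  proof (cases "\<sigma> \<inter> B = {} \<or> \<sigma> \<inter> D = {}")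
    case True
    then show ?thesis
      using f_trivial simplicialD(1)[OF K \<sigma>] \<sigma> by (intro bexI[of _ \<sigma>]) auto
  next
    case False
    then show ?thesis
      using f_ins simplicialD(1)[OF K \<sigma>] ins[OF \<sigma>] by (intro bexI[of _ "insert p0 \<sigma>"]) auto
  qed
  have cont: "continuous_on (closed_simplex \<sigma>) f" if \<sigma>: "\<sigma> \<in> K" for \<sigma>
  proof (rule continuous_on_coordinatewise_then_product)
    fix v
    have fin: "finite \<sigma>" using simplicialD[OF K \<sigma>] by auto
    have cont_coord: "continuous_on S (\<lambda>x :: 'v \<Rightarrow> real. x v)" for S v
      by (intro continuous_on_coordinate continuous_on_id)
    have "continuous_on (closed_simplex \<sigma>) (mass E)" for E
      by (subst continuous_on_cong[OF HOL.refl mass[OF _ fin]], assumption)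
        (intro continuous_on_sum_coordinates continuous_on_id)
    then have r: "continuous_on (closed_simplex \<sigma>) (\<lambda>x. r x v)" for v
      by (cases "v \<in> B"; cases "v \<in> D") (auto simp: r_def intro!: continuous_on_min cont_coord)
    have "continuous_on (closed_simplex \<sigma>)
       (\<lambda>x. x v - r x v + (if v = p0 then \<Sum>v\<in>\<sigma>. r x v else 0))"
      by (cases "v = p0") (auto intro!: continuous_on_add continuous_on_diff continuous_on_sum r cont_coord)
    then show "continuous_on (closed_simplex \<sigma>) (\<lambda>x. f x v)"
      by (rule continuous_on_eq) (simp add: f_def R[OF _ fin])
  qed
  have "f ` points K \<subseteq> points ?L"
  proof (rule image_subsetI)
    fix x assume "x \<in> points K"
    then obtain \<sigma> where \<sigma>: "\<sigma> \<in> K" "x \<in> closed_simplex \<sigma>" by (rule pointsE)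
    have fin: "finite \<sigma>" using simplicialD[OF K \<sigma>(1)] by auto
    have le: "x v \<le> mass E x" if "v \<in> E" for v E
    proof (cases "v \<in> \<sigma>")
      case True
      then show ?thesis
        unfolding mass[OF \<sigma>(2) fin] using \<sigma> fin that
        by (intro member_le_sum) (auto simp: closed_simplex_def)
    next
      case False
      then have "x v = 0" using \<sigma> by (auto simp: closed_simplex_def)
      then show ?thesis using mass_nn[OF \<sigma>(2) fin] by simp
    qed
    have "f x \<in> points K" using im[OF \<sigma>(1)] \<sigma>(2) by blast
    then have supp: "{v. f x v \<noteq> 0} \<in> K" "f x \<in> closed_simplex {v. f x v \<noteq> 0}"
      using points_support[OF K] by blast+
    have "{v. f x v \<noteq> 0} \<inter> B = {} \<or> {v. f x v \<noteq> 0} \<inter> D = {}"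
    proof (cases "mass B x \<le> mass D x")
      case True
      have "f x v = 0" if "v \<in> B" for v
        using le[OF that] True that BD by (auto simp: f_def r_def min_def)
      then show ?thesis by blast
    next
      case False
      have "f x v = 0" if "v \<in> D" for v
        using le[OF that] False that BD by (auto simp: f_def r_def min_def)
      then show ?thesis by blast
    qed
    then show "f x \<in> points ?L" using supp by blast
  qed
  moreover have "homotopic_with (\<lambda>h. \<forall>x\<in>points ?L. h x = x) (geometric_realization K) (geometric_realization K) id f"
    by (rule homotopic_straight_line[OF K cont im f_fix])
  ultimately show ?thesis unfolding strong_deformation_retract_def by blast
qed

text \<open>
  Deformations \<open>D n\<close> of the $(n+1)$-st space onto the $n$-th one are performed during the time intervals
  $[2^{-(n+1)}, 2^{-n}]$, so that a point of the $n$-th space rests until time $2^{-n}$.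
\<close>

primrec telescope :: "(nat \<Rightarrow> real \<times> 'x \<Rightarrow> 'x) \<Rightarrow> nat \<Rightarrow> real \<times> 'x \<Rightarrow> 'x" where
  "telescope D 0 = snd"
| "telescope D (Suc n) = (\<lambda>z. if fst z \<le> (1/2)^n then D n (max 0 (fst z * 2 ^ Suc n - 1), snd z)
     else telescope D n (fst z, D n (1, snd z)))"

lemma strong_deformation_retract_countable_union:
  fixes K :: "nat \<Rightarrow> 'v set set"
  assumes K: "\<And>n. simplicial (K n)" and mono: "\<And>n. K n \<subseteq> K (Suc n)"
    and strong_deformation_retract: "\<And>n. strong_deformation_retract (K (Suc n)) (K n)"
  shows "strong_deformation_retract (\<Union>n. K n) (K 0)"
proof -
  let ?X = "\<lambda>n. geometric_realization (K n)" and ?U = "\<Union>n. K n"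
  have KU: "simplicial ?U" using K unfolding simplicial_def by blast
  have "\<forall>n. \<exists>D. continuous_map (prod_topology unit_interval (?X (Suc n))) (?X (Suc n)) D \<and>
      (\<forall>x. D (0, x) = x) \<and> (\<forall>x\<in>points (K (Suc n)). D (1, x) \<in> points (K n)) \<and>
      (\<forall>t\<in>{0..1}. \<forall>x\<in>points (K n). D (t, x) = x)"
  proof
    fix n
    from strong_deformation_retract[of n] obtain f h where "f ` points (K (Suc n)) \<subseteq> points (K n)"
      and "continuous_map (prod_topology unit_interval (?X (Suc n))) (?X (Suc n)) h"
      "\<forall>x. h (0, x) = x" "\<forall>x. h (1, x) = f x" "\<forall>t\<in>{0..1}. \<forall>x\<in>points (K n). h (t, x) = x"
      unfolding strong_deformation_retract_def homotopic_with_def by auto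
    then show "\<exists>D. continuous_map (prod_topology unit_interval (?X (Suc n))) (?X (Suc n)) D \<and>
      (\<forall>x. D (0, x) = x) \<and> (\<forall>x\<in>points (K (Suc n)). D (1, x) \<in> points (K n)) \<and>
      (\<forall>t\<in>{0..1}. \<forall>x\<in>points (K n). D (t, x) = x)"
      by (intro exI[of _ h]) auto
  qed
  then obtain D where D: "\<And>n. continuous_map (prod_topology unit_interval (?X (Suc n))) (?X (Suc n)) (D n)"
      "\<And>n x. D n (0, x) = x" "\<And>n x. x \<in> points (K (Suc n)) \<Longrightarrow> D n (1, x) \<in> points (K n)"
      "\<And>n t x. t \<in> {0..1} \<Longrightarrow> x \<in> points (K n) \<Longrightarrow> D n (t, x) = x"
    by metis
  have sub: "subtopology (?X (Suc n)) (points (K n)) = ?X n" for n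
    by (rule geometric_realization_subcomplex[OF K K mono])
  have incl: "continuous_map (?X n) (?X (Suc n)) id" for n
    unfolding sub[of n, symmetric] by (simp add: continuous_map_from_subtopology)
  let ?E = "telescope D"
  have small: "?E n (t, x) = x" if "t \<le> (1/2)^n" for n t x
  proof (cases n)
    case (Suc m)
    have "t * 2 ^ Suc m \<le> (1/2) ^ Suc m * 2 ^ Suc m"
      using that Suc by (intro mult_right_mono) auto
    also have "\<dots> = 1" by (simp add: power_one_over)
    finally have "t * 2 ^ Suc m \<le> 1" .
    moreover have "t \<le> (1/2)^m" using that[unfolded Suc] by (rule order_trans) simp
    ultimately show ?thesis using Suc D(2) by (simp add: max_absorb1)
  qed simp
  have pos: "?E n (0, x) = x" for n x by (rule small) simp
  have step: "?E (Suc n) (t, x) = ?E n (t, x)" if "x \<in> points (K n)" "t \<in> {0..1}" for n t x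
  proof (cases "t \<le> (1/2)^n")
    case True
    have "t * 2 ^ Suc n \<le> (1/2)^n * 2 ^ Suc n"
      using True by (intro mult_right_mono) auto
    also have "\<dots> = 2" by (simp add: power_one_over)
    finally have "max 0 (t * 2 ^ Suc n - 1) \<in> {0..1}" by auto
    then have "?E (Suc n) (t, x) = x" using True D(4) that by simp
    then show ?thesis using small[OF True] by simp
  next
    case False
    then show ?thesis using D(4)[of 1 x n] that by simp
  qed
  have steps: "?E (n + k) (t, x) = ?E n (t, x)" if "x \<in> points (K n)" "t \<in> {0..1}" for n k t x
  proof (induction k)
    case (Suc k)
    have "K n \<subseteq> K (n + k)" using mono by (metis le_add1 lift_Suc_mono_le)
    then have "x \<in> points (K (n + k))" using that points_mono by blast
    then show ?case using step[of x "n + k" t] Suc that by simp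
  qed simp
  have cont: "continuous_map (prod_topology unit_interval (?X n)) (?X n) (?E n)" for n
  proof (induction n)
    case 0
    then show ?case by (rule continuous_map_eq[OF continuous_map_snd]) simp
  next
    case (Suc n)
    let ?P = "prod_topology unit_interval (?X (Suc n))"
    have fst: "continuous_map ?P euclideanreal fst"
      by (rule continuous_map_into_fulltopology[OF continuous_map_fst])
    have r: "continuous_map (?X (Suc n)) (?X n) (\<lambda>x. D n (1, x))"
    proof -
      have "continuous_map (?X (Suc n)) (?X (Suc n)) (D n \<circ> Pair 1)"
        by (rule continuous_map_o_Pair[OF D(1)]) simp
      then show ?thesis
        unfolding sub[of n, symmetric] using D(3) by (auto simp: continuous_map_in_subtopology o_def)
    qed
    have 2: "continuous_map ?P (?X (Suc n)) (\<lambda>z. ?E n (fst z, D n (1, snd z)))"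
    proof -
      have "continuous_map ?P (prod_topology unit_interval (?X n)) (\<lambda>z. (fst z, D n (1, snd z)))"
        by (intro continuous_map_pairedI continuous_map_fst continuous_map_compose[OF continuous_map_snd r, unfolded o_def])
      from continuous_map_compose[OF continuous_map_compose[OF this Suc] incl]
      show ?thesis by (simp add: o_def)
    qed
    have 1: "continuous_map (subtopology ?P {z \<in> topspace ?P. fst z \<le> (1/2)^n}) (?X (Suc n))
       (\<lambda>z. D n (max 0 (fst z * 2 ^ Suc n - 1), snd z))"
    proof -
      let ?Q = "subtopology ?P {z \<in> topspace ?P. fst z \<le> (1/2)^n}"
      have "continuous_map ?Q euclideanreal (\<lambda>z. max 0 (fst z * 2 ^ Suc n - 1))"
        by (intro continuous_map_real_max continuous_map_diff continuous_map_real_mult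
            continuous_map_from_subtopology[OF fst]) auto
      moreover have "max 0 (fst z * 2 ^ Suc n - 1) \<in> {0..1}" if "z \<in> topspace ?Q" for z :: "real \<times> ('v \<Rightarrow> real)"
      proof -
        have "fst z * 2 ^ Suc n \<le> (1/2)^n * 2 ^ Suc n"
          using that by (intro mult_right_mono) auto
        also have "\<dots> = 2" by (simp add: power_one_over)
        finally show ?thesis by auto
      qed
      ultimately have "continuous_map ?Q unit_interval (\<lambda>z. max 0 (fst z * 2 ^ Suc n - 1))"
        by (auto simp: continuous_map_in_subtopology)
      then have "continuous_map ?Q (prod_topology unit_interval (?X (Suc n))) (\<lambda>z. (max 0 (fst z * 2 ^ Suc n - 1), snd z))"
        by (intro continuous_map_pairedI continuous_map_from_subtopology[OF continuous_map_snd])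
      from continuous_map_compose[OF this D(1)]
      show ?thesis by (simp add: o_def)
    qed
    have "continuous_map ?P (?X (Suc n)) (\<lambda>z. if fst z \<le> (1/2)^n
        then D n (max 0 (fst z * 2 ^ Suc n - 1), snd z) else ?E n (fst z, D n (1, snd z)))"
    proof (rule continuous_map_cases_le[OF fst _ 1 continuous_map_from_subtopology[OF 2]])
      show "continuous_map ?P euclideanreal (\<lambda>z. (1/2)^n)" by simp
      fix z assume "z \<in> topspace ?P" and z: "fst z = (1/2)^n"
      have "fst z * 2 ^ Suc n = 2" unfolding z by (simp add: power_one_over)
      then have "max 0 (fst z * 2 ^ Suc n - 1) = 1" by simp
      moreover have "?E n (fst z, D n (1, snd z)) = D n (1, snd z)"
        by (rule small) (simp add: z)
      ultimately show "D n (max 0 (fst z * 2 ^ Suc n - 1), snd z) = ?E n (fst z, D n (1, snd z))"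
        by (simp only:)
    qed
    then show ?case by (rule continuous_map_eq) simp
  qed
  have final: "?E n (1, x) \<in> points (K 0)" if "x \<in> points (K n)" for n x
    using that
  proof (induction n arbitrary: x)
    case (Suc n)
    show ?case
    proof (cases n)
      case 0
      then show ?thesis using D(3)[of x 0] Suc by simp
    next
      case (Suc k)
      then have "(1/2::real)^n < 1" using power_strict_decreasing[of 0 n "1/2::real"] by simp
      then show ?thesis using Suc.IH[OF D(3)[OF Suc.prems]] by simp
    qed
  qed simp
  define N where "N x = (LEAST n. x \<in> points (K n))" for x
  define H where "H = (\<lambda>(t, x). ?E (N x) (t, x))"
  have H: "H (t, x) = ?E n (t, x)" if "x \<in> points (K n)" "t \<in> {0..1}" for n t x
  proof -
    have 1: "x \<in> points (K (N x))" unfolding N_def by (rule LeastI) (rule that(1))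
    have "N x \<le> n" unfolding N_def by (rule Least_le) (rule that(1))
    then have "n = N x + (n - N x)" by simp
    then show ?thesis using steps[OF 1 that(2), of "n - N x"] by (simp add: H_def)
  qed
  have "continuous_map (prod_topology unit_interval (geometric_realization ?U)) (geometric_realization ?U) H"
  proof (rule continuous_map_from_geometric_realization_prod)
    fix \<sigma> assume "\<sigma> \<in> ?U"
    then obtain n where n: "\<sigma> \<in> K n" by blast
    have "continuous_map (?X n) (geometric_realization ?U) id"
      unfolding geometric_realization_subcomplex[OF KU K UN_upper[OF UNIV_I], symmetric]
      by (simp add: continuous_map_from_subtopology)
    from continuous_map_compose[OF continuous_map_simplex_restrict[OF cont n] this]
    have "continuous_map (prod_topology unit_interval (top_of_set (closed_simplex \<sigma>))) (geometric_realization ?U) (?E n)"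
      by simp
    then show "continuous_map (prod_topology unit_interval (top_of_set (closed_simplex \<sigma>))) (geometric_realization ?U) H"
    proof (rule continuous_map_eq)
      fix z assume "z \<in> topspace (prod_topology unit_interval (top_of_set (closed_simplex \<sigma>)))"
      then have "fst z \<in> {0..1}" "snd z \<in> points (K n)" using n by auto
      then show "?E n z = H z" using H[of "snd z" n "fst z"] by simp
    qed
  qed
  moreover have inK: "\<exists>n. x \<in> points (K n)" if "x \<in> points ?U" for x
    using that unfolding points_def by blast
  moreover have "H (0, x) = x" for x
    by (simp add: H_def pos)
  moreover have "H (t, x) = x" if "t \<in> {0..1}" "x \<in> points (K 0)" for t x
    using H[OF that(2,1)] by simp
  ultimately have "homotopic_with (\<lambda>h. \<forall>x\<in>points (K 0). h x = x) (geometric_realization ?U)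
      (geometric_realization ?U) id (\<lambda>x. H (1, x))"
    unfolding homotopic_with_def by (intro exI[of _ H]) auto
  moreover have "(\<lambda>x. H (1, x)) ` points ?U \<subseteq> points (K 0)"
    using inK H final by fastforce
  ultimately show ?thesis unfolding strong_deformation_retract_def by blast
qed

lemma contractible_space_realization_image:
  fixes f :: "'v \<Rightarrow> 'w"
  assumes K: "simplicial K" and inj: "inj_on f (\<Union>K)"
    and contr: "contractible_space (geometric_realization K)"
  shows "contractible_space (geometric_realization ((`) f ` K))"
proof -
  define g where "g = inv_into (\<Union>K) f"
  define F where "F x w = (if w \<in> f ` \<Union>K then x (g w) else 0)" for x :: "'v \<Rightarrow> real" and w
  define G where "G y v = (if v \<in> \<Union>K then y (f v) else 0)" for y :: "'w \<Rightarrow> real" and v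
  have gf: "g (f v) = v" if "v \<in> \<Union>K" for v
    unfolding g_def by (rule inv_into_f_f[OF inj that])
  have F: "F ` closed_simplex \<sigma> \<subseteq> closed_simplex (f ` \<sigma>)" if \<sigma>: "\<sigma> \<in> K" for \<sigma>
  proof (rule image_subsetI)
    fix x assume x: "x \<in> closed_simplex \<sigma>"
    have "inj_on f \<sigma>" using inj \<sigma> by (meson Union_upper inj_on_subset)
    then have "(\<Sum>w\<in>f ` \<sigma>. F x w) = (\<Sum>v\<in>\<sigma>. F x (f v))" by (simp add: sum.reindex)
    also have "\<dots> = (\<Sum>v\<in>\<sigma>. x v)"
    proof (rule sum.cong)
      fix v assume "v \<in> \<sigma>"
      then have "v \<in> \<Union>K" using \<sigma> by blast
      then show "F x (f v) = x v" using gf[of v] by (simp only: F_def imageI if_True)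
    qed simp
    finally have "(\<Sum>w\<in>f ` \<sigma>. F x w) = (\<Sum>v\<in>\<sigma>. x v)" .
    moreover have "F x w = 0" if "w \<notin> f ` \<sigma>" for w
    proof (cases "w \<in> f ` \<Union>K")
      case True
      then obtain v where v: "v \<in> \<Union>K" "w = f v" by blast
      with that gf[OF v(1)] have "g w \<notin> \<sigma>" by auto
      then show ?thesis using x by (simp add: F_def closed_simplex_def)
    qed (simp add: F_def)
    ultimately show "F x \<in> closed_simplex (f ` \<sigma>)"
      using x by (simp add: closed_simplex_def) (simp add: F_def)
  qed
  have G: "G ` closed_simplex (f ` \<sigma>) \<subseteq> closed_simplex \<sigma>" if \<sigma>: "\<sigma> \<in> K" for \<sigma>
  proof (rule image_subsetI)
    fix y assume y: "y \<in> closed_simplex (f ` \<sigma>)"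
    have "inj_on f \<sigma>" using inj \<sigma> by (meson Union_upper inj_on_subset)
    then have "(\<Sum>v\<in>\<sigma>. y (f v)) = (\<Sum>w\<in>f ` \<sigma>. y w)" by (simp add: sum.reindex)
    moreover have "(\<Sum>v\<in>\<sigma>. G y v) = (\<Sum>v\<in>\<sigma>. y (f v))"
      using \<sigma> by (intro sum.cong) (auto simp: G_def)
    moreover have "y (f v) = 0" if "v \<in> \<Union>K" "v \<notin> \<sigma>" for v
    proof -
      have "f v \<notin> f ` \<sigma>" using inj that \<sigma> by (metis UnionI gf image_iff)
      then show ?thesis using y by (auto simp: closed_simplex_def)
    qed
    ultimately show "G y \<in> closed_simplex \<sigma>"
      using y by (auto simp: closed_simplex_def G_def)
  qed
  have cont: "continuous_on S F" "continuous_on T G" for S T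
  proof -
    show "continuous_on S F"
    proof (rule continuous_on_coordinatewise_then_product)
      fix w show "continuous_on S (\<lambda>x. F x w)"
        by (cases "w \<in> f ` \<Union>K") (simp_all only: F_def if_True if_False
            continuous_on_const continuous_on_coordinate[OF continuous_on_id])
    qed
    show "continuous_on T G"
    proof (rule continuous_on_coordinatewise_then_product)
      fix v show "continuous_on T (\<lambda>y. G y v)"
        by (cases "v \<in> \<Union>K") (simp_all only: G_def if_True if_False
            continuous_on_const continuous_on_coordinate[OF continuous_on_id])
    qed
  qed
  have GF: "G (F x) = x" if "x \<in> points K" for x
    using that gf by (auto simp: G_def F_def fun_eq_iff closed_simplex_def elim!: pointsE)
  have FG: "F (G y) = y" if "y \<in> points ((`) f ` K)" for y
  proof -
    from that obtain \<tau> where "\<tau> \<in> (`) f ` K" "y \<in> closed_simplex \<tau>" by (rule pointsE)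
    then obtain \<sigma> where \<sigma>: "\<sigma> \<in> K" "y \<in> closed_simplex (f ` \<sigma>)" by blast
    show ?thesis
    proof
      fix w
      show "F (G y) w = y w"
      proof (cases "w \<in> f ` \<Union>K")
        case True
        then obtain v where v: "v \<in> \<Union>K" "w = f v" by blast
        then have "F (G y) w = G y v" using True gf[OF v(1)] by (simp only: F_def if_True)
        then show ?thesis using v by (simp only: G_def if_True)
      next
        case False
        then have "w \<notin> f ` \<sigma>" using \<sigma>(1) by blast
        then show ?thesis using \<sigma>(2) False by (simp only: F_def if_False) (simp add: closed_simplex_def)
      qed
    qed
  qed
  have "homeomorphic_maps (geometric_realization K) (geometric_realization ((`) f ` K)) F G"
    unfolding homeomorphic_maps_def
  proof (intro conjI)
    show "continuous_map (geometric_realization K) (geometric_realization ((`) f ` K)) F"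
      by (rule continuous_map_simplexwise) (use cont F in blast)+
    show "continuous_map (geometric_realization ((`) f ` K)) (geometric_realization K) G"
      by (rule continuous_map_simplexwise) (use cont G in blast)+
  qed (simp_all add: GF FG)
  then show ?thesis
    using contr homeomorphic_maps_imp_homeomorphic_space homeomorphic_space_contractibility by blast
qed

section \<open>Gluing Rips complexes\<close>

lemma rips_complex_iff:
  "\<sigma> \<in> rips_complex M d r \<longleftrightarrow> \<sigma> \<subseteq> M \<and> finite \<sigma> \<and> \<sigma> \<noteq> {} \<and> (\<forall>x\<in>\<sigma>. \<forall>y\<in>\<sigma>. d x y \<le> r)"
proof -
  have "(SUP (x, y)\<in>\<sigma> \<times> \<sigma>. d x y) \<le> r \<longleftrightarrow> (\<forall>x\<in>\<sigma>. \<forall>y\<in>\<sigma>. d x y \<le> r)" if "finite \<sigma>" "\<sigma> \<noteq> {}"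
  proof -
    have "(SUP (x, y)\<in>\<sigma> \<times> \<sigma>. d x y) \<le> r \<longleftrightarrow> (\<forall>z\<in>(\<lambda>(x, y). d x y) ` (\<sigma> \<times> \<sigma>). z \<le> r)"
      using that by (intro cSup_le_iff) auto
    then show ?thesis by auto
  qed
  then show ?thesis unfolding rips_complex_def by blast
qed

lemma simplicial_rips_complex: "simplicial (rips_complex M d r)"
  unfolding simplicial_def
proof (intro ballI conjI allI impI)
  fix \<sigma> \<tau> assume "\<sigma> \<in> rips_complex M d r" "\<tau> \<subseteq> \<sigma>" "\<tau> \<noteq> {}"
  then show "\<tau> \<in> rips_complex M d r"
    unfolding rips_complex_iff by (meson finite_subset order_trans subsetD)
qed (auto simp: rips_complex_iff)

lemma rips_complex_mono: "M \<subseteq> M' \<Longrightarrow> rips_complex M d r \<subseteq> rips_complex M' d r"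
  by (intro subsetI, unfold rips_complex_iff) blast

lemma contractible_rips_complex_isometry:
  assumes inj: "inj_on f M" and d: "\<And>x y. x \<in> M \<Longrightarrow> y \<in> M \<Longrightarrow> d' (f x) (f y) = d x y"
    and contr: "contractible_space (geometric_realization (rips_complex M d r))"
  shows "contractible_space (geometric_realization (rips_complex (f ` M) d' r))"
proof -
  have "rips_complex (f ` M) d' r = (`) f ` rips_complex M d r"
  proof (intro subset_antisym subsetI)
    fix \<tau> assume \<tau>: "\<tau> \<in> rips_complex (f ` M) d' r"
    then obtain \<sigma> where \<sigma>: "\<sigma> \<subseteq> M" "\<tau> = f ` \<sigma>" by (auto simp: rips_complex_iff subset_image_iff)
    then have "finite \<sigma>" using \<tau> inj by (metis finite_imageD inj_on_subset rips_complex_iff)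
    moreover have "d x y \<le> r" if "x \<in> \<sigma>" "y \<in> \<sigma>" for x y
    proof -
      have "d' (f x) (f y) \<le> r" using \<tau> that \<sigma>(2) by (auto simp: rips_complex_iff)
      moreover have "d' (f x) (f y) = d x y" using d that \<sigma>(1) by blast
      ultimately show ?thesis by simp
    qed
    ultimately have "\<sigma> \<in> rips_complex M d r"
      using \<tau> \<sigma> by (simp add: rips_complex_iff)
    then show "\<tau> \<in> (`) f ` rips_complex M d r" using \<sigma> by blast
  next
    fix \<tau> assume "\<tau> \<in> (`) f ` rips_complex M d r"
    then show "\<tau> \<in> rips_complex (f ` M) d' r"
      using d by (auto simp: rips_complex_iff subset_iff)
  qed
  moreover have "\<Union> (rips_complex M d r) \<subseteq> M" by (auto simp: rips_complex_iff)
  ultimately show ?thesis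
    using contractible_space_realization_image[OF simplicial_rips_complex _ contr, of f] inj
    by (metis inj_on_subset)
qed

lemma contractible_geometric_realization_simplex:
  assumes "finite P" "P \<noteq> {}" 
  shows "contractible_space (geometric_realization {\<tau>. \<tau> \<subseteq> P \<and> \<tau> \<noteq> {}})"
proof -
  let ?K = "{\<tau>. \<tau> \<subseteq> P \<and> \<tau> \<noteq> {}}"
  obtain p where p: "p \<in> P" using assms by blast
  define c where "c v = (if v = p then 1 else 0 :: real)" for v
  have c: "c \<in> closed_simplex P"
    using p assms by (auto simp: c_def closed_simplex_def)
  have "homotopic_with (\<lambda>h. \<forall>x\<in>{}. h x = x) (geometric_realization ?K) (geometric_realization ?K) id (\<lambda>x. c)"
  proof (rule homotopic_straight_line[OF simplicial_faces[OF assms(1)]])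
    fix \<sigma> assume "\<sigma> \<in> ?K"
    then show "\<exists>\<tau>\<in>?K. \<sigma> \<subseteq> \<tau> \<and> (\<lambda>x. c) ` closed_simplex \<sigma> \<subseteq> closed_simplex \<tau>"
      using c assms by (intro bexI[of _ P]) auto
  qed auto
  then show ?thesis unfolding contractible_space_def by auto
qed

lemma strong_deformation_retract_rips_complex_glue:
  fixes d :: "'v \<Rightarrow> 'v \<Rightarrow> real"
  assumes P: "Y \<inter> W = P" "finite P" "P \<noteq> {}"
    and sym: "\<And>x y. x \<in> Y \<union> W \<Longrightarrow> y \<in> Y \<union> W \<Longrightarrow> d x y = d y x"
    and triangle: "\<And>x y z. x \<in> Y \<union> W \<Longrightarrow> y \<in> Y \<union> W \<Longrightarrow> z \<in> Y \<union> W \<Longrightarrow> d x z \<le> d x y + d y z"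
    and clique: "\<And>p q. p \<in> P \<Longrightarrow> q \<in> P \<Longrightarrow> d p q \<le> 1"
    and apart: "\<And>x y. x \<in> Y \<union> W \<Longrightarrow> y \<in> Y \<union> W \<Longrightarrow> x \<noteq> y \<Longrightarrow> 1 \<le> d x y"
    and through: "\<And>y w. y \<in> Y - P \<Longrightarrow> w \<in> W - P \<Longrightarrow> \<exists>p\<in>P. d y p + d p w \<le> d y w"
    and r: "1 \<le> r" and contr: "contractible_space (geometric_realization (rips_complex W d r))"
  shows "strong_deformation_retract (rips_complex (Y \<union> W) d r) (rips_complex Y d r)"
proof -
  let ?R = "\<lambda>M. rips_complex M d r"
  obtain p0 where p0: "p0 \<in> P" using P by blast
  have far: "d x p0 \<le> r" if x: "x \<in> \<sigma>" and \<sigma>: "\<sigma> \<in> ?R (Y \<union> W)" and y: "y \<in> \<sigma>" "y \<in> Y - P" and w: "w \<in> \<sigma>" "w \<in> W - P"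
    for x y w \<sigma>
  proof -
    have le: "d a b \<le> r" if "a \<in> \<sigma>" "b \<in> \<sigma>" for a b using \<sigma> that by (auto simp: rips_complex_iff)
    have xYW: "x \<in> Y \<union> W" using x \<sigma> by (auto simp: rips_complex_iff)
    have near: "d a p0 \<le> d a b" if ab: "a \<in> Y - P \<and> b \<in> W - P \<or> a \<in> W - P \<and> b \<in> Y - P" for a b
    proof -
      have in_un: "a \<in> Y \<union> W" "b \<in> Y \<union> W" using ab by auto
      have "\<exists>p\<in>P. d a p + d p b \<le> d a b"
        using ab
      proof
        assume "a \<in> W - P \<and> b \<in> Y - P"
        then obtain p where p: "p \<in> P" "d b p + d p a \<le> d b a" using through by blast
        moreover have "p \<in> Y \<union> W" using p P by blast
        ultimately show ?thesis using sym in_un by (intro bexI[of _ p]) (auto simp: add.commute)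
      qed (use through in blast)
      then obtain p where p: "p \<in> P" "d a p + d p b \<le> d a b" by blast
      have "p \<in> Y \<union> W" "p0 \<in> Y \<union> W" using p p0 P by auto
      then have "d a p0 \<le> d a p + d p p0" using triangle in_un by blast
      also have "\<dots> \<le> d a p + 1" using clique p p0 by auto
      also have "\<dots> \<le> d a p + d p b"
        using apart[of p b] ab p P \<open>p \<in> Y \<union> W\<close> in_un by auto
      finally show ?thesis using p by linarith
    qed
    consider "x \<in> P" | "x \<in> Y - P" | "x \<in> W - P" using xYW P by blast
    then show ?thesis
    proof cases
      case 1
      then show ?thesis using clique[OF _ p0, of x] r by linarith
    next
      case 2
      then have "d x p0 \<le> d x w" using near w by blast
      then show ?thesis using le x w by fastforce
    next
      case 3
      then have "d x p0 \<le> d x y" using near y by blast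
      then show ?thesis using le x y by fastforce
    qed
  qed
  have "strong_deformation_retract (?R (Y \<union> W)) {\<sigma>\<in>?R (Y \<union> W). \<sigma> \<inter> (Y - P) = {} \<or> \<sigma> \<inter> (W - P) = {}}"
  proof (rule strong_deformation_retract_push[where ?p0.0 = p0, OF simplicial_rips_complex])
    show "(Y - P) \<inter> (W - P) = {}" "p0 \<notin> Y - P" "p0 \<notin> W - P" using P p0 by auto
    fix \<sigma> assume \<sigma>: "\<sigma> \<in> ?R (Y \<union> W)" "\<sigma> \<inter> (Y - P) \<noteq> {}" "\<sigma> \<inter> (W - P) \<noteq> {}"
    then have *: "\<And>x. x \<in> \<sigma> \<Longrightarrow> d x p0 \<le> r" using far by blast
    have "p0 \<in> Y \<union> W" using P p0 by blast
    moreover have "d p0 p0 \<le> r" using clique[OF p0 p0] r by linarith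
    moreover have "d p0 x \<le> r" if "x \<in> \<sigma>" for x
      using *[OF that] sym[OF \<open>p0 \<in> Y \<union> W\<close>, of x] that \<sigma>(1) by (auto simp: rips_complex_iff)
    ultimately show "insert p0 \<sigma> \<in> ?R (Y \<union> W)"
      using \<sigma>(1) * by (simp add: rips_complex_iff)
  qed
  also have "{\<sigma>\<in>?R (Y \<union> W). \<sigma> \<inter> (Y - P) = {} \<or> \<sigma> \<inter> (W - P) = {}} = ?R Y \<union> ?R W"
  proof -
    have e: "\<sigma> \<subseteq> Y \<union> W \<and> (\<sigma> \<inter> (Y - P) = {} \<or> \<sigma> \<inter> (W - P) = {}) \<longleftrightarrow> \<sigma> \<subseteq> Y \<or> \<sigma> \<subseteq> W" for \<sigma>
      using P(1) by blast
    show ?thesis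
    proof (rule Set.set_eqI)
      fix \<sigma>
      show "\<sigma> \<in> {\<sigma>\<in>?R (Y \<union> W). \<sigma> \<inter> (Y - P) = {} \<or> \<sigma> \<inter> (W - P) = {}} \<longleftrightarrow> \<sigma> \<in> ?R Y \<union> ?R W"
        using e[of \<sigma>] unfolding mem_Collect_eq Un_iff[of \<sigma>] rips_complex_iff by argo
    qed
  qed
  finally have 1: "strong_deformation_retract (?R (Y \<union> W)) (?R Y \<union> ?R W)" .
  have PR: "{\<tau>. \<tau> \<subseteq> P \<and> \<tau> \<noteq> {}} = ?R P"
  proof (intro subset_antisym subsetI)
    fix \<tau> assume "\<tau> \<in> {\<tau>. \<tau> \<subseteq> P \<and> \<tau> \<noteq> {}}"
    then have \<tau>: "\<tau> \<subseteq> P" "\<tau> \<noteq> {}" by auto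
    have "d x y \<le> r" if "x \<in> \<tau>" "y \<in> \<tau>" for x y
      using clique[of x y] that \<tau>(1) r by force
    then show "\<tau> \<in> ?R P"
      using \<tau> finite_subset[OF \<tau>(1) P(2)] by (simp add: rips_complex_iff)
  qed (auto simp: rips_complex_iff)
  have "P \<in> ?R W" using P clique r by (force simp: rips_complex_iff)
  from strong_deformation_retract_faces[OF simplicial_rips_complex this contr]
  have "strong_deformation_retract (?R W) (?R P)" by (simp add: PR)
  moreover have "points (?R Y) \<inter> points (?R W) \<subseteq> points (?R P)"
  proof
    fix x assume x: "x \<in> points (?R Y) \<inter> points (?R W)"
    then have "{v. x v \<noteq> 0} \<in> ?R Y" "{v. x v \<noteq> 0} \<in> ?R W" "x \<in> closed_simplex {v. x v \<noteq> 0}"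
      using points_support[OF simplicial_rips_complex] by blast+
    then show "x \<in> points (?R P)"
      using P(1) by (intro pointsI[of "{v. x v \<noteq> 0}"]) (auto simp: rips_complex_iff)
  qed
  moreover have "?R P \<subseteq> ?R Y" using P by (intro rips_complex_mono) auto
  ultimately have "strong_deformation_retract (?R Y \<union> ?R W) (?R Y)"
    by (intro strong_deformation_retract_union[OF simplicial_rips_complex simplicial_rips_complex])
  moreover have "simplicial (?R Y \<union> ?R W)"
    using simplicial_rips_complex unfolding simplicial_def by blast
  moreover have "?R Y \<union> ?R W \<subseteq> ?R (Y \<union> W)"
    using rips_complex_mono[of Y "Y \<union> W" d r] rips_complex_mono[of W "Y \<union> W" d r] by simp
  ultimately show ?thesis
    using strong_deformation_retract_trans[OF simplicial_rips_complex _ _ _ 1] by simp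
qed

section \<open>Trees of graphs\<close>

definition graph_dist :: "('v \<times> 'v) set \<Rightarrow> 'v \<Rightarrow> 'v \<Rightarrow> nat" where
  "graph_dist E x y = (LEAST n. (x, y) \<in> E ^^ n)"

lemma graph_dist_le: "(x, y) \<in> E ^^ n \<Longrightarrow> graph_dist E x y \<le> n"
  unfolding graph_dist_def by (rule Least_le)

lemma graph_dist_path: "(x, y) \<in> E\<^sup>* \<Longrightarrow> (x, y) \<in> E ^^ graph_dist E x y"
  unfolding graph_dist_def by (rule LeastI_ex) (simp add: rtrancl_power)

lemma relpow_sym:
  assumes "Relation.sym E" "(x, y) \<in> E ^^ n"
  shows "(y, x) \<in> E ^^ n"
  using assms(2)
proof (induction n arbitrary: y)
  case (Suc n)
  then obtain z where "(x, z) \<in> E ^^ n" "(z, y) \<in> E" by auto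
  then have "(z, x) \<in> E ^^ n" "(y, z) \<in> E" using Suc.IH assms(1) by (auto dest: symD)
  then show ?case by (rule relpow_Suc_I2[rotated])
qed simp

lemma graph_dist_sym: "Relation.sym E \<Longrightarrow> graph_dist E x y = graph_dist E y x"
  unfolding graph_dist_def by (intro arg_cong[where f=Least] ext) (blast intro: relpow_sym)

lemma graph_dist_self [simp]: "graph_dist E x x = 0"
  using graph_dist_le[where n=0] by force

lemma graph_dist_triangle:
  assumes "(x, y) \<in> E\<^sup>*" "(y, z) \<in> E\<^sup>*"
  shows "graph_dist E x z \<le> graph_dist E x y + graph_dist E y z"
proof (rule graph_dist_le)
  show "(x, z) \<in> E ^^ (graph_dist E x y + graph_dist E y z)"
    unfolding relpow_add using graph_dist_path[OF assms(1)] graph_dist_path[OF assms(2)] by blast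
qed

lemma graph_dist_pos:
  assumes "(x, y) \<in> E\<^sup>*" "x \<noteq> y"
  shows "1 \<le> graph_dist E x y"
  using graph_dist_path[OF assms(1)] assms(2) by (cases "graph_dist E x y") auto

lemma lipschitz_relpow:
  fixes F :: "'v \<Rightarrow> nat"
  assumes "\<And>x y. (x, y) \<in> E \<Longrightarrow> F y \<le> F x + 1" "(x, y) \<in> E ^^ n"
  shows "F y \<le> F x + n"
  using assms(2)
proof (induction n arbitrary: y)
  case (Suc n)
  then obtain z where "(x, z) \<in> E ^^ n" "(z, y) \<in> E" by auto
  then show ?case using Suc.IH[of z] assms(1)[of z y] by simp
qed simp

lemma relpow_image:
  assumes "\<And>x y. (x, y) \<in> E \<Longrightarrow> (f x, f y) \<in> E'" "(x, y) \<in> E ^^ n"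
  shows "(f x, f y) \<in> E' ^^ n"
  using assms(2)
proof (induction n arbitrary: y)
  case (Suc n)
  then show ?case using assms(1) by auto
qed simp

text \<open>
  The vertices of the underlying tree are words, the parent of \<open>e # v\<close> being \<open>v\<close>. Each tree vertex
  carries a copy of the graph on \<open>A\<close>, and the edge from \<open>v\<close> to \<open>e # v\<close> is represented by the
  relation \<open>M e\<close> between the two copies.
\<close>

locale tree_of_graphs =
  fixes A :: "'a set" and EA :: "('a \<times> 'a) set" and V :: "'e list set" and M :: "'e \<Rightarrow> ('a \<times> 'a) set"
  assumes EA_sub: "EA \<subseteq> A \<times> A" and EA_sym: "Relation.sym EA"
    and EA_conn: "\<And>a b. a \<in> A \<Longrightarrow> b \<in> A \<Longrightarrow> (a, b) \<in> EA\<^sup>*"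
    and V_Nil: "[] \<in> V" and V_tl: "\<And>e v. e # v \<in> V \<Longrightarrow> v \<in> V" and V_countable: "countable V"
    and M_fin: "\<And>e v. e # v \<in> V \<Longrightarrow> finite (M e)" and M_ne: "\<And>e v. e # v \<in> V \<Longrightarrow> M e \<noteq> {}"
    and M_sub: "\<And>e v. e # v \<in> V \<Longrightarrow> M e \<subseteq> A \<times> A"
    and M_clique1: "\<And>e v p q p' q'. e # v \<in> V \<Longrightarrow> (p, q) \<in> M e \<Longrightarrow> (p', q') \<in> M e \<Longrightarrow> p = p' \<or> (p, p') \<in> EA"
    and M_clique2: "\<And>e v p q p' q'. e # v \<in> V \<Longrightarrow> (p, q) \<in> M e \<Longrightarrow> (p', q') \<in> M e \<Longrightarrow> q = q' \<or> (q, q') \<in> EA"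
begin

definition copy_edges :: "(('e list \<times> 'a) \<times> ('e list \<times> 'a)) set" where
  "copy_edges = {((v, a), (v, b)) | v a b. v \<in> V \<and> (a, b) \<in> EA}"

definition tree_edges :: "(('e list \<times> 'a) \<times> ('e list \<times> 'a)) set" where
  "tree_edges = {((v, p), (e # v, q)) | e v p q. e # v \<in> V \<and> (p, q) \<in> M e}"

definition edges :: "(('e list \<times> 'a) \<times> ('e list \<times> 'a)) set" where
  "edges = copy_edges \<union> tree_edges \<union> tree_edges\<inverse>"

lemma sym_edges: "Relation.sym edges"
  unfolding Relation.sym_def edges_def copy_edges_def using EA_sym by (auto dest: symD)

lemma edges_cases [consumes 1, case_names copy up down]:
  assumes "(x, y) \<in> edges"
  obtains v a b where "x = (v, a)" "y = (v, b)" "v \<in> V" "(a, b) \<in> EA"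
    | v e p q where "x = (v, p)" "y = (e # v, q)" "e # v \<in> V" "(p, q) \<in> M e"
    | v e p q where "y = (v, p)" "x = (e # v, q)" "e # v \<in> V" "(p, q) \<in> M e"
proof -
  from assms consider "(x, y) \<in> copy_edges" | "(x, y) \<in> tree_edges" | "(y, x) \<in> tree_edges"
    unfolding edges_def by blast
  then show thesis
  proof cases
    case 1
    then obtain v a b where "x = (v, a)" "y = (v, b)" "v \<in> V" "(a, b) \<in> EA"
      unfolding copy_edges_def by auto
    then show thesis by (rule that(1))
  next
    case 2
    then obtain v e p q where "x = (v, p)" "y = (e # v, q)" "e # v \<in> V" "(p, q) \<in> M e"
      unfolding tree_edges_def by auto
    then show thesis by (rule that(2))
  next
    case 3
    then obtain v e p q where "y = (v, p)" "x = (e # v, q)" "e # v \<in> V" "(p, q) \<in> M e"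
      unfolding tree_edges_def by auto
    then show thesis by (rule that(3))
  qed
qed

lemma copy_edgeI: "v \<in> V \<Longrightarrow> (a, b) \<in> EA \<Longrightarrow> ((v, a), (v, b)) \<in> edges"
  unfolding edges_def copy_edges_def by blast

lemma tree_edgeI: "e # v \<in> V \<Longrightarrow> (p, q) \<in> M e \<Longrightarrow> ((v, p), (e # v, q)) \<in> edges"
  unfolding edges_def tree_edges_def by blast

lemma tree_edgeI': "e # v \<in> V \<Longrightarrow> (p, q) \<in> M e \<Longrightarrow> ((e # v, q), (v, p)) \<in> edges"
  unfolding edges_def tree_edges_def by blast

lemma V_suffix: "suffix w v \<Longrightarrow> v \<in> V \<Longrightarrow> w \<in> V"
proof (induction v)
  case (Cons e v)
  then show ?case using V_tl by (auto simp: suffix_Cons)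
qed simp

abbreviation dA :: "'a \<Rightarrow> 'a \<Rightarrow> nat" where "dA \<equiv> graph_dist EA"

lemma dA_edge:
  assumes "a \<in> A" "b = b' \<or> (b, b') \<in> EA" "b \<in> A"
  shows "dA a b' \<le> dA a b + 1"
  using assms(2)
proof
  assume b: "(b, b') \<in> EA"
  have "(a, b') \<in> EA ^^ (dA a b + 1)"
    using graph_dist_path[OF EA_conn[OF assms(1,3)]] b by auto
  then show ?thesis by (rule graph_dist_le)
qed simp

definition gate :: "'e list \<Rightarrow> 'e list \<Rightarrow> 'a set" where
  "gate w v = (if strict_suffix w v then fst ` M (v ! (length v - Suc (length w))) else snd ` M (hd w))"

lemma gate_clique:
  assumes "w \<in> V" "v \<in> V" "v \<noteq> w"
  shows "finite (gate w v)" "gate w v \<noteq> {}" "gate w v \<subseteq> A"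
    "\<And>p p'. p \<in> gate w v \<Longrightarrow> p' \<in> gate w v \<Longrightarrow> p = p' \<or> (p, p') \<in> EA"
proof -
  have "finite (gate w v) \<and> gate w v \<noteq> {} \<and> gate w v \<subseteq> A \<and>
    (\<forall>p\<in>gate w v. \<forall>p'\<in>gate w v. p = p' \<or> (p, p') \<in> EA)"
  proof (cases "strict_suffix w v")
    case True
    then obtain u where u: "v = u @ w" "u \<noteq> []" by (auto simp: strict_suffix_def suffix_def)
    then obtain u' e where "u = u' @ [e]" by (metis append_butlast_last_id)
    then have v: "v = u' @ e # w" using u by simp
    then have ew: "e # w \<in> V" using V_suffix[of "e # w" v] assms(2) by (simp add: suffix_def)
    have "gate w v = fst ` M e" using True v by (simp add: gate_def)
    then show ?thesis using M_fin[OF ew] M_ne[OF ew] M_sub[OF ew] M_clique1[OF ew] by force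
  next
    case False
    then have "w \<noteq> []" using assms(3) by (auto simp: strict_suffix_def)
    then have ew: "hd w # tl w \<in> V" using assms(1) by simp
    have "gate w v = snd ` M (hd w)" using False by (simp add: gate_def)
    then show ?thesis using M_fin[OF ew] M_ne[OF ew] M_sub[OF ew] M_clique2[OF ew] by force
  qed
  then show "finite (gate w v)" "gate w v \<noteq> {}" "gate w v \<subseteq> A"
    "\<And>p p'. p \<in> gate w v \<Longrightarrow> p' \<in> gate w v \<Longrightarrow> p = p' \<or> (p, p') \<in> EA" by blast+
qed

lemma gate_Cons:
  assumes "v \<noteq> w" "e # v \<noteq> w"
  shows "gate w (e # v) = gate w v"
proof (cases "strict_suffix w v")
  case True
  then obtain u where u: "v = u @ w" "u \<noteq> []" by (auto simp: strict_suffix_def suffix_def)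
  then obtain u' e' where "u = u' @ [e']" by (metis append_butlast_last_id)
  then have v: "v = u' @ e' # w" using u by simp
  have "strict_suffix w (e # v)" using True assms(2) by (auto simp: strict_suffix_def suffix_Cons)
  moreover have "(e # v) ! (length (e # v) - Suc (length w)) = e'"
    using nth_append_length[of "e # u'" e' w] v by simp
  moreover have "v ! (length v - Suc (length w)) = e'" using v by simp
  ultimately show ?thesis using True by (simp only: gate_def if_True)
next
  case False
  then have "\<not> strict_suffix w (e # v)"
    using assms by (auto simp: strict_suffix_def suffix_Cons)
  then show ?thesis using False by (simp add: gate_def)
qed

lemma Min_clique:
  assumes "finite Q" "Q \<subseteq> A" "\<And>p p'. p \<in> Q \<Longrightarrow> p' \<in> Q \<Longrightarrow> p = p' \<or> (p, p') \<in> EA" "q \<in> Q" "a \<in> A"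
  shows "Min (dA a ` Q) \<le> dA a q" "dA a q \<le> Min (dA a ` Q) + 1"
proof -
  show "Min (dA a ` Q) \<le> dA a q" using assms by auto
  have "Min (dA a ` Q) \<in> dA a ` Q" using assms by (intro Min_in) auto
  then obtain p where "p \<in> Q" "Min (dA a ` Q) = dA a p" by auto
  then show "dA a q \<le> Min (dA a ` Q) + 1" using dA_edge[of a p q] assms by auto
qed

text \<open>
  The distance from \<open>a\<close>, extended to the branches at the copy \<open>w\<close> by a constant on each branch, is
  1-Lipschitz: hence leaving the copy does not give shortcuts.
\<close>

definition branch_dist :: "'e list \<Rightarrow> 'a \<Rightarrow> 'e list \<times> 'a \<Rightarrow> nat" where
  "branch_dist w a x = (if fst x = w then dA a (snd x) else Min (dA a ` gate w (fst x)))"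

lemma branch_dist_tree_edge:
  assumes w: "w \<in> V" and a: "a \<in> A" and ev: "e # v \<in> V" and pq: "(p, q) \<in> M e"
  shows "branch_dist w a (v, p) \<le> branch_dist w a (e # v, q) + 1"
    "branch_dist w a (e # v, q) \<le> branch_dist w a (v, p) + 1"
proof -
  have v: "v \<in> V" using V_tl[OF ev] .
  consider "v = w" | "e # v = w" | "v \<noteq> w" "e # v \<noteq> w" by blast
  then have "branch_dist w a (v, p) \<le> branch_dist w a (e # v, q) + 1 \<and>
    branch_dist w a (e # v, q) \<le> branch_dist w a (v, p) + 1"
  proof cases
    case 1
    then have ne: "e # v \<noteq> w" by auto
    have "gate w (e # v) = fst ` M e" using 1 by (simp add: gate_def strict_suffix_def suffix_Cons)
    then have "p \<in> gate w (e # v)" using pq by force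
    from Min_clique[OF gate_clique(1,3,4)[OF w ev ne] this a]
    show ?thesis using 1 ne by (simp add: branch_dist_def)
  next
    case 2
    then have ne: "v \<noteq> w" by auto
    have "\<not> strict_suffix w v" using 2 by (auto simp: strict_suffix_def suffix_def)
    then have "gate w v = snd ` M e" using 2 by (auto simp: gate_def)
    then have "q \<in> gate w v" using pq by force
    from Min_clique[OF gate_clique(1,3,4)[OF w v ne] this a]
    show ?thesis using 2 ne by (simp add: branch_dist_def)
  next
    case 3
    then show ?thesis by (simp add: branch_dist_def gate_Cons)
  qed
  then show "branch_dist w a (v, p) \<le> branch_dist w a (e # v, q) + 1"
    "branch_dist w a (e # v, q) \<le> branch_dist w a (v, p) + 1" by blast+
qed

lemma branch_dist_lipschitz:
  assumes w: "w \<in> V" and a: "a \<in> A" and xy: "(x, y) \<in> edges"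
  shows "branch_dist w a y \<le> branch_dist w a x + 1"
  using xy
proof (cases rule: edges_cases)
  case (copy v b c)
  then show ?thesis
    using dA_edge[OF a, of b c] EA_sub by (auto simp: branch_dist_def)
next
  case (up v e p q)
  then show ?thesis using branch_dist_tree_edge[OF w a] by simp
next
  case (down v e p q)
  then show ?thesis using branch_dist_tree_edge[OF w a] by simp
qed

lemma copy_reachable:
  assumes "w \<in> V" "a \<in> A" "b \<in> A"
  shows "((w, a), (w, b)) \<in> edges ^^ dA a b"
  using relpow_image[of EA "Pair w" edges, OF _ graph_dist_path[OF EA_conn[OF assms(2,3)]]]
    copy_edgeI[OF assms(1)] by blast

lemma graph_dist_copy:
  assumes "w \<in> V" "a \<in> A" "b \<in> A"
  shows "graph_dist edges (w, a) (w, b) = dA a b"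
proof (rule antisym)
  show "graph_dist edges (w, a) (w, b) \<le> dA a b"
    by (rule graph_dist_le[OF copy_reachable[OF assms]])
  have "((w, a), (w, b)) \<in> edges ^^ graph_dist edges (w, a) (w, b)"
    using copy_reachable[OF assms] by (intro graph_dist_path) (auto simp: rtrancl_power)
  from lipschitz_relpow[where F="branch_dist w a", OF branch_dist_lipschitz[OF assms(1,2)] this]
  show "dA a b \<le> graph_dist edges (w, a) (w, b)"
    by (simp add: branch_dist_def)
qed

lemma reachable_root:
  assumes "v \<in> V" "a \<in> A" "b \<in> A"
  shows "((v, a), ([], b)) \<in> edges\<^sup>*"
  using assms(1,2)
proof (induction v arbitrary: a)
  case Nil
  then show ?case using copy_reachable[OF V_Nil _ assms(3)] by (auto simp: rtrancl_power)
next
  case (Cons e v)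
  obtain p q where pq: "(p, q) \<in> M e" using M_ne[OF Cons.prems(1)] by auto
  then have A: "p \<in> A" "q \<in> A" using M_sub[OF Cons.prems(1)] by auto
  have "((e # v, a), (e # v, q)) \<in> edges\<^sup>*"
    using copy_reachable[OF Cons.prems(1) Cons.prems(2) A(2)] by (auto simp: rtrancl_power)
  moreover have "((e # v, q), (v, p)) \<in> edges" by (rule tree_edgeI'[OF Cons.prems(1) pq])
  moreover have "((v, p), ([], b)) \<in> edges\<^sup>*"
    using Cons.IH V_tl[OF Cons.prems(1)] A by blast
  ultimately show ?case by (meson rtrancl.rtrancl_into_rtrancl rtrancl_trans)
qed

lemma reachable:
  assumes "x \<in> V \<times> A" "y \<in> V \<times> A"
  shows "(x, y) \<in> edges\<^sup>*"
proof -
  obtain v a w b where xy: "x = (v, a)" "y = (w, b)" "v \<in> V" "a \<in> A" "w \<in> V" "b \<in> A"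
    using assms by auto
  have "((w, b), ([], a)) \<in> edges\<^sup>*" using reachable_root xy by blast
  then have "(([], a), y) \<in> edges\<^sup>*"
    using sym_edges xy by (metis sym_rtrancl symD)
  moreover have "(x, ([], a)) \<in> edges\<^sup>*" using reachable_root xy by blast
  ultimately show ?thesis by (rule rtrancl_trans[rotated])
qed

lemma relpow_crossing:
  assumes "e # u \<in> V" "\<not> suffix (e # u) (fst x)" "suffix (e # u) (fst y)" "(x, y) \<in> edges ^^ n"
  shows "\<exists>p q i j. (p, q) \<in> M e \<and> n = i + 1 + j \<and> (x, (u, p)) \<in> edges ^^ i \<and> ((e # u, q), y) \<in> edges ^^ j"
  using assms(2,4)
proof (induction n arbitrary: x)
  case 0
  then show ?case using assms(3) by simp
next
  case (Suc n)
  then obtain z where z: "(x, z) \<in> edges" "(z, y) \<in> edges ^^ n" by (meson relpow_Suc_D2)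
  show ?case
  proof (cases "suffix (e # u) (fst z)")
    case False
    from Suc.IH[OF this z(2)] obtain p q i j where
      "(p, q) \<in> M e" "n = i + 1 + j" "(z, (u, p)) \<in> edges ^^ i" "((e # u, q), y) \<in> edges ^^ j" by blast
    moreover from this(3) have "(x, (u, p)) \<in> edges ^^ Suc i" using z(1) by (meson relpow_Suc_I2)
    ultimately show ?thesis by (metis add_Suc)
  next
    case True
    from z(1) show ?thesis
    proof (cases rule: edges_cases)
      case (copy v a b)
      then show ?thesis using True Suc.prems by simp
    next
      case (up v e' p q)
      then have "e' # v = e # u" using True Suc.prems by (auto simp: suffix_Cons)
      then show ?thesis using up z(2) by (intro exI[of _ p] exI[of _ q] exI[of _ 0] exI[of _ n]) auto
    next
      case (down v e' p q)
      then show ?thesis using True Suc.prems by (auto simp: suffix_Cons)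
    qed
  qed
qed

abbreviation dN :: "'e list \<times> 'a \<Rightarrow> 'e list \<times> 'a \<Rightarrow> real" where
  "dN x y \<equiv> real (graph_dist edges x y)"

lemma dN_sym: "dN x y = dN y x"
  using graph_dist_sym[OF sym_edges] by simp

lemma dN_triangle: "x \<in> V \<times> A \<Longrightarrow> y \<in> V \<times> A \<Longrightarrow> z \<in> V \<times> A \<Longrightarrow> dN x z \<le> dN x y + dN y z"
  using graph_dist_triangle[OF reachable reachable] by (metis of_nat_add of_nat_mono)

lemma dN_apart: "x \<in> V \<times> A \<Longrightarrow> y \<in> V \<times> A \<Longrightarrow> x \<noteq> y \<Longrightarrow> 1 \<le> dN x y"
  using graph_dist_pos[OF reachable] by (metis of_nat_1 of_nat_mono)

lemma dN_crossing:
  assumes eu: "e # u \<in> V" and x: "x \<in> V \<times> A" "\<not> suffix (e # u) (fst x)"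
    and y: "y \<in> V \<times> A" "suffix (e # u) (fst y)"
  shows "\<exists>(p, q)\<in>M e. dN x (u, p) + dN (u, p) y \<le> dN x y \<and> dN x (e # u, q) + dN (e # u, q) y \<le> dN x y"
proof -
  from relpow_crossing[OF eu x(2) y(2) graph_dist_path[OF reachable[OF x(1) y(1)]]]
  obtain p q i j where pq: "(p, q) \<in> M e" and n: "graph_dist edges x y = i + 1 + j"
    and i: "(x, (u, p)) \<in> edges ^^ i" and j: "((e # u, q), y) \<in> edges ^^ j" by blast
  note edge = tree_edgeI[OF eu pq]
  have "graph_dist edges x (u, p) \<le> i" "graph_dist edges (e # u, q) y \<le> j"
    by (rule graph_dist_le, fact)+
  moreover have "graph_dist edges x (e # u, q) \<le> Suc i"
    by (rule graph_dist_le) (use i edge in auto)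
  moreover have "graph_dist edges (u, p) y \<le> Suc j"
    by (rule graph_dist_le) (rule relpow_Suc_I2[OF edge j])
  ultimately have "dN x (u, p) + dN (u, p) y \<le> dN x y \<and> dN x (e # u, q) + dN (e # u, q) y \<le> dN x y"
    using n by linarith
  then show ?thesis using pq by blast
qed

lemma contractible_copy:
  assumes "contractible_space (geometric_realization (rips_complex A (\<lambda>a b. real (dA a b)) r))" "v \<in> V"
  shows "contractible_space (geometric_realization (rips_complex ({v} \<times> A) dN r))"
proof -
  have "contractible_space (geometric_realization (rips_complex (Pair v ` A) dN r))"
    by (rule contractible_rips_complex_isometry[OF _ _ assms(1)]) (auto simp: graph_dist_copy[OF assms(2)] inj_on_def)
  moreover have "Pair v ` A = {v} \<times> A" by auto
  ultimately show ?thesis by simp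
qed

lemma strong_deformation_retract_attach_copy:
  assumes eu: "e # u \<in> V" and Y: "Y \<subseteq> V" "u \<in> Y" "\<And>v. v \<in> Y \<Longrightarrow> \<not> suffix (e # u) v"
    and r: "3 \<le> r"
    and contr: "contractible_space (geometric_realization (rips_complex A (\<lambda>a b. real (dA a b)) r))"
  shows "strong_deformation_retract (rips_complex (insert (e # u) Y \<times> A) dN r) (rips_complex (Y \<times> A) dN r)"
proof -
  define P where "P = {u} \<times> fst ` M e"
  define Q where "Q = {e # u} \<times> snd ` M e"
  have u: "u \<in> V" using Y by blast
  have MA: "fst ` M e \<subseteq> A" "snd ` M e \<subseteq> A" using M_sub[OF eu] by auto
  have P: "finite P" "P \<noteq> {}" "P \<subseteq> Y \<times> A" and Q: "finite Q" "Q \<noteq> {}" "Q \<subseteq> {e # u} \<times> A"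
    unfolding P_def Q_def using M_fin[OF eu] M_ne[OF eu] MA Y by auto
  have QV: "Q \<subseteq> V \<times> A" and PV: "P \<subseteq> V \<times> A" and YV: "Y \<times> A \<subseteq> V \<times> A" and WV: "{e # u} \<times> A \<subseteq> V \<times> A"
    using P Q eu Y by auto
  have new: "e # u \<notin> Y" using Y(3) by blast
  have edge1: "dN x y \<le> 1" if "x = y \<or> (x, y) \<in> edges" for x y
    using that graph_dist_le[of x y 1 edges] by auto
  have cliqueP: "dN p q \<le> 1" if "p \<in> P" "q \<in> P" for p q
    using that M_clique1[OF eu] copy_edgeI[OF u] by (intro edge1) (force simp: P_def)
  have cliqueQ: "dN p q \<le> 1" if "p \<in> Q" "q \<in> Q" for p q
    using that M_clique2[OF eu] copy_edgeI[OF eu] by (intro edge1) (force simp: Q_def)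
  have PQ: "dN p q \<le> 3" if pq: "p \<in> P" "q \<in> Q" for p q
  proof -
    obtain p' q' where m: "(p', q') \<in> M e" using M_ne[OF eu] by auto
    have in_PQ: "(u, p') \<in> P" "(e # u, q') \<in> Q" using m by (force simp: P_def Q_def)+
    have 1: "dN p (u, p') \<le> 1" using cliqueP pq(1) in_PQ(1) by blast
    have 2: "dN (u, p') (e # u, q') \<le> 1" using edge1 tree_edgeI[OF eu m] by blast
    have 3: "dN (e # u, q') q \<le> 1" using cliqueQ pq(2) in_PQ(2) by blast
    have "dN p q \<le> dN p (u, p') + dN (u, p') q" using dN_triangle pq in_PQ PV QV by blast
    moreover have "dN (u, p') q \<le> dN (u, p') (e # u, q') + dN (e # u, q') q"
      using dN_triangle pq in_PQ PV QV by blast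
    ultimately show ?thesis using 1 2 3 by linarith
  qed
  have "rips_complex (P \<union> Q) dN r = {\<tau>. \<tau> \<subseteq> P \<union> Q \<and> \<tau> \<noteq> {}}"
  proof (intro subset_antisym subsetI)
    fix \<tau> assume \<tau>: "\<tau> \<in> {\<tau>. \<tau> \<subseteq> P \<union> Q \<and> \<tau> \<noteq> {}}"
    have "dN x y \<le> r" if xy: "x \<in> P \<union> Q" "y \<in> P \<union> Q" for x y
    proof -
      have "dN x y \<le> 3"
        using xy cliqueP[of x y] cliqueQ[of x y] PQ[of x y] PQ[of y x] dN_sym[of x y] by force
      then show ?thesis using r by linarith
    qed
    moreover have "finite \<tau>" using \<tau> P(1) Q(1) by (auto intro: finite_subset)
    ultimately show "\<tau> \<in> rips_complex (P \<union> Q) dN r"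
      using \<tau> unfolding rips_complex_iff by blast
  qed (auto simp: rips_complex_iff)
  then have contrPQ: "contractible_space (geometric_realization (rips_complex (P \<union> Q) dN r))"
    using contractible_geometric_realization_simplex[of "P \<union> Q"] P Q by simp
  have 1: "strong_deformation_retract (rips_complex (Y \<times> A \<union> (P \<union> Q)) dN r) (rips_complex (Y \<times> A) dN r)"
  proof (rule strong_deformation_retract_rips_complex_glue[OF _ P(1,2) dN_sym _ cliqueP _ _ _ contrPQ])
    show "Y \<times> A \<inter> (P \<union> Q) = P" using P Q new by blast
    fix x y w
    show "y \<in> Y \<times> A - P \<Longrightarrow> w \<in> (P \<union> Q) - P \<Longrightarrow> \<exists>p\<in>P. dN y p + dN p w \<le> dN y w"
    proof -
      assume y: "y \<in> Y \<times> A - P" and w: "w \<in> (P \<union> Q) - P"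
      have "\<exists>(p, q)\<in>M e. dN y (u, p) + dN (u, p) w \<le> dN y w \<and> dN y (e # u, q) + dN (e # u, q) w \<le> dN y w"
      proof (rule dN_crossing[OF eu])
        show "y \<in> V \<times> A" using y YV by blast
        show "\<not> suffix (e # u) (fst y)" using y Y(3) by auto
        have "w \<in> Q" using w by blast
        then show "w \<in> V \<times> A" "suffix (e # u) (fst w)" using QV by (auto simp: Q_def)
      qed
      then show ?thesis by (force simp: P_def)
    qed
    show "x \<in> Y \<times> A \<union> (P \<union> Q) \<Longrightarrow> y \<in> Y \<times> A \<union> (P \<union> Q) \<Longrightarrow> w \<in> Y \<times> A \<union> (P \<union> Q) \<Longrightarrow> dN x w \<le> dN x y + dN y w"
      using PV QV YV by (intro dN_triangle) blast+
    show "x \<in> Y \<times> A \<union> (P \<union> Q) \<Longrightarrow> y \<in> Y \<times> A \<union> (P \<union> Q) \<Longrightarrow> x \<noteq> y \<Longrightarrow> 1 \<le> dN x y"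
      using PV QV YV by (intro dN_apart) blast+
  qed (use r in auto)
  have un: "Y \<times> A \<union> (P \<union> Q) = Y \<times> A \<union> Q" using P by blast
  have 2: "strong_deformation_retract (rips_complex ((Y \<times> A \<union> Q) \<union> {e # u} \<times> A) dN r) (rips_complex (Y \<times> A \<union> Q) dN r)"
  proof (rule strong_deformation_retract_rips_complex_glue[OF _ Q(1,2) dN_sym _ cliqueQ _ _ _ contractible_copy[OF contr eu]])
    show "(Y \<times> A \<union> Q) \<inter> {e # u} \<times> A = Q" using Q new by blast
    fix x y w
    show "y \<in> (Y \<times> A \<union> Q) - Q \<Longrightarrow> w \<in> {e # u} \<times> A - Q \<Longrightarrow> \<exists>p\<in>Q. dN y p + dN p w \<le> dN y w"
    proof -
      assume y: "y \<in> (Y \<times> A \<union> Q) - Q" and w: "w \<in> {e # u} \<times> A - Q"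
      have "\<exists>(p, q)\<in>M e. dN y (u, p) + dN (u, p) w \<le> dN y w \<and> dN y (e # u, q) + dN (e # u, q) w \<le> dN y w"
      proof (rule dN_crossing[OF eu])
        show "y \<in> V \<times> A" using y YV by blast
        show "\<not> suffix (e # u) (fst y)" using y Y(3) by auto
        show "w \<in> V \<times> A" "suffix (e # u) (fst w)" using w WV by auto
      qed
      then show ?thesis by (force simp: Q_def)
    qed
    show "x \<in> (Y \<times> A \<union> Q) \<union> {e # u} \<times> A \<Longrightarrow> y \<in> (Y \<times> A \<union> Q) \<union> {e # u} \<times> A \<Longrightarrow>
       w \<in> (Y \<times> A \<union> Q) \<union> {e # u} \<times> A \<Longrightarrow> dN x w \<le> dN x y + dN y w"
      using WV QV YV by (intro dN_triangle) blast+
    show "x \<in> (Y \<times> A \<union> Q) \<union> {e # u} \<times> A \<Longrightarrow> y \<in> (Y \<times> A \<union> Q) \<union> {e # u} \<times> A \<Longrightarrow> x \<noteq> y \<Longrightarrow> 1 \<le> dN x y"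
      using WV QV YV by (intro dN_apart) blast+
  qed (use r in auto)
  have all: "(Y \<times> A \<union> Q) \<union> {e # u} \<times> A = insert (e # u) Y \<times> A" using Q by blast
  show ?thesis
    using strong_deformation_retract_trans[OF simplicial_rips_complex simplicial_rips_complex _ _ 2[unfolded all] 1[unfolded un]]
      rips_complex_mono[of "Y \<times> A \<union> Q" "insert (e # u) Y \<times> A" dN r]
      rips_complex_mono[of "Y \<times> A" "Y \<times> A \<union> Q" dN r] all by blast
qed

definition code :: "'e list \<Rightarrow> nat" where
  "code v = list_encode (map (to_nat_on (\<Union>v\<in>V. set v)) v)"

lemma code_Cons: "code v < code (e # v)"
proof -
  have "code v \<le> prod_encode (x, code v)" for x by (rule le_prod_encode_2)
  then show ?thesis by (simp add: code_def le_imp_less_Suc)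
qed

lemma code_suffix: "suffix w v \<Longrightarrow> code w \<le> code v"
proof (induction v)
  case (Cons e v)
  then show ?case using code_Cons[of v e] by (auto simp: suffix_Cons)
qed simp

lemma inj_on_code: "inj_on code V"
proof (rule inj_onI)
  have "countable (\<Union>v\<in>V. set v)" using V_countable by (intro countable_UN) (auto intro: countable_finite)
  then have inj: "inj_on (to_nat_on (\<Union>v\<in>V. set v)) (\<Union>v\<in>V. set v)" by (rule inj_on_to_nat_on)
  fix v w assume "v \<in> V" "w \<in> V" "code v = code w"
  then have "map (to_nat_on (\<Union>v\<in>V. set v)) v = map (to_nat_on (\<Union>v\<in>V. set v)) w"
    by (simp add: code_def list_encode_eq)
  moreover have "inj_on (to_nat_on (\<Union>v\<in>V. set v)) (set v \<union> set w)"
    by (rule inj_on_subset[OF inj]) (use \<open>v \<in> V\<close> \<open>w \<in> V\<close> in blast)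
  ultimately show "v = w" by (simp add: inj_on_map_eq_map)
qed

theorem contractible_tree_of_graphs:
  assumes r: "3 \<le> r"
    and contr: "contractible_space (geometric_realization (rips_complex A (\<lambda>a b. real (dA a b)) r))"
  shows "contractible_space (geometric_realization (rips_complex (V \<times> A) dN r))"
proof -
  define Y where "Y n = {v \<in> V. code v \<le> n}" for n
  define K where "K n = rips_complex (Y n \<times> A) dN r" for n
  have mono: "K n \<subseteq> K (Suc n)" for n
    unfolding K_def Y_def by (intro rips_complex_mono) auto
  have step: "strong_deformation_retract (K (Suc n)) (K n)" for n
  proof (cases "\<exists>v\<in>V. code v = Suc n")
    case False
    then have "Y (Suc n) = Y n" unfolding Y_def by (auto simp: le_Suc_eq)
    then show ?thesis unfolding K_def strong_deformation_retract_def by (intro exI[of _ id]) simp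
  next
    case True
    then obtain v where v: "v \<in> V" "code v = Suc n" by blast
    then obtain e u where eu: "v = e # u" by (cases v) (auto simp: code_def)
    have "Y (Suc n) = insert (e # u) (Y n)"
      using v inj_on_code unfolding Y_def eu by (auto simp: le_Suc_eq inj_on_def)
    moreover have "strong_deformation_retract (rips_complex (insert (e # u) (Y n) \<times> A) dN r) (rips_complex (Y n \<times> A) dN r)"
    proof (rule strong_deformation_retract_attach_copy[OF _ _ _ _ r contr])
      show "e # u \<in> V" using v eu by simp
      then show "u \<in> Y n" using V_tl code_Cons[of u e] v eu by (auto simp: Y_def)
      show "\<not> suffix (e # u) w" if "w \<in> Y n" for w
        using that code_suffix[of "e # u" w] v eu by (auto simp: Y_def)
    qed (auto simp: Y_def)
    ultimately show ?thesis by (simp add: K_def)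
  qed
  have K0: "contractible_space (geometric_realization (K 0))"
  proof -
    have "v = []" if "code v = 0" for v using that code_Cons by (cases v) (auto, metis not_less0)
    moreover have "code [] = 0" by (simp add: code_def)
    ultimately have "Y 0 = {[]}" using V_Nil by (auto simp: Y_def)
    then show ?thesis using contractible_copy[OF contr V_Nil] by (simp add: K_def)
  qed
  have "(\<Union>n. K n) = rips_complex (V \<times> A) dN r"
  proof (intro subset_antisym subsetI)
    fix \<sigma> assume \<sigma>: "\<sigma> \<in> rips_complex (V \<times> A) dN r"
    then have fin: "finite \<sigma>" by (simp add: rips_complex_iff)
    have "\<sigma> \<subseteq> Y (Max ((code \<circ> fst) ` \<sigma>)) \<times> A"
    proof
      fix x assume x: "x \<in> \<sigma>"
      then have "(code \<circ> fst) x \<le> Max ((code \<circ> fst) ` \<sigma>)" using fin by (intro Max_ge) auto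
      moreover have "x \<in> V \<times> A" using \<sigma> x by (auto simp: rips_complex_iff)
      ultimately show "x \<in> Y (Max ((code \<circ> fst) ` \<sigma>)) \<times> A" by (auto simp: Y_def)
    qed
    then have "\<sigma> \<in> K (Max ((code \<circ> fst) ` \<sigma>))" using \<sigma> by (simp add: K_def rips_complex_iff)
    then show "\<sigma> \<in> (\<Union>n. K n)" by blast
  next
    fix \<sigma> assume "\<sigma> \<in> (\<Union>n. K n)"
    then obtain n where "\<sigma> \<in> K n" by blast
    moreover have "K n \<subseteq> rips_complex (V \<times> A) dN r"
      unfolding K_def Y_def by (intro rips_complex_mono) auto
    ultimately show "\<sigma> \<in> rips_complex (V \<times> A) dN r" by blast
  qed
  moreover have "strong_deformation_retract (\<Union>n. K n) (K 0)"
    by (rule strong_deformation_retract_countable_union[where K=K, OF _ mono step]) (simp add: K_def simplicial_rips_complex)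
  moreover have "K 0 \<subseteq> (\<Union>n. K n)" by blast
  ultimately show ?thesis
    using contractible_space_sdr[OF simplicial_rips_complex _ _ _ K0, of "V \<times> A" dN r]
    by (simp add: K_def simplicial_rips_complex)
qed

end

section \<open>Cayley graphs\<close>

definition cayley_graph :: "('a, 'b) monoid_scheme \<Rightarrow> 'a set \<Rightarrow> ('a \<times> 'a) set" where
  "cayley_graph G S = {(g, g \<otimes>\<^bsub>G\<^esub> s) | g s. g \<in> carrier G \<and> s \<in> S \<union> m_inv G ` S}"

context group
begin

lemma sym_gens_closed: "S \<subseteq> carrier G \<Longrightarrow> S \<union> m_inv G ` S \<subseteq> carrier G"
  by auto

lemma cayley_graph_sub:
  assumes "S \<subseteq> carrier G"
  shows "cayley_graph G S \<subseteq> carrier G \<times> carrier G"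
  using assms by (auto simp: cayley_graph_def)

lemma sym_cayley_graph:
  assumes S: "S \<subseteq> carrier G"
  shows "Relation.sym (cayley_graph G S)"
proof (rule symI)
  fix g h assume "(g, h) \<in> cayley_graph G S"
  then obtain s where s: "g \<in> carrier G" "s \<in> S \<union> m_inv G ` S" "h = g \<otimes> s"
    by (auto simp: cayley_graph_def)
  then have "s \<in> carrier G" using S by auto
  then have "h \<in> carrier G" "g = h \<otimes> inv s" using s by (auto simp: m_assoc)
  moreover have "inv s \<in> S \<union> m_inv G ` S" using s(2) S by (auto simp: subset_iff)
  ultimately show "(h, g) \<in> cayley_graph G S" unfolding cayley_graph_def by blast
qed

lemma foldr_mult_closed: "set ss \<subseteq> carrier G \<Longrightarrow> foldr (mult G) ss \<one> \<in> carrier G"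
  by (induction ss) auto

lemma relpow_cayley_graph:
  assumes S: "S \<subseteq> carrier G" and "g \<in> carrier G" "h \<in> carrier G"
  shows "(g, h) \<in> cayley_graph G S ^^ k \<longleftrightarrow>
    (\<exists>ss. length ss = k \<and> set ss \<subseteq> S \<union> m_inv G ` S \<and> inv g \<otimes> h = foldr (mult G) ss \<one>)"
  using assms(2)
proof (induction k arbitrary: g)
  case 0
  have "g = h \<longleftrightarrow> inv g \<otimes> h = \<one>"
    using 0 assms(3) by (metis inv_closed inv_equality inv_inv l_inv)
  then show ?case by auto
next
  case (Suc k)
  let ?T = "S \<union> m_inv G ` S"
  have T: "?T \<subseteq> carrier G" using S by (rule sym_gens_closed)
  have "(g, h) \<in> cayley_graph G S ^^ Suc k \<longleftrightarrow> (\<exists>z. (g, z) \<in> cayley_graph G S \<and> (z, h) \<in> cayley_graph G S ^^ k)"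
    by (metis relpow_Suc_D2 relpow_Suc_I2)
  also have "\<dots> \<longleftrightarrow> (\<exists>s\<in>?T. (g \<otimes> s, h) \<in> cayley_graph G S ^^ k)"
    using Suc.prems unfolding cayley_graph_def by blast
  also have "\<dots> \<longleftrightarrow> (\<exists>s\<in>?T. \<exists>ss. length ss = k \<and> set ss \<subseteq> ?T \<and> inv (g \<otimes> s) \<otimes> h = foldr (mult G) ss \<one>)"
  proof (rule bex_cong[OF HOL.refl])
    fix s assume "s \<in> ?T"
    then have "g \<otimes> s \<in> carrier G" using T Suc.prems by blast
    then show "(g \<otimes> s, h) \<in> cayley_graph G S ^^ k \<longleftrightarrow>
      (\<exists>ss. length ss = k \<and> set ss \<subseteq> ?T \<and> inv (g \<otimes> s) \<otimes> h = foldr (mult G) ss \<one>)"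
      by (rule Suc.IH)
  qed
  also have "\<dots> \<longleftrightarrow> (\<exists>s\<in>?T. \<exists>ss. length ss = k \<and> set ss \<subseteq> ?T \<and> inv g \<otimes> h = s \<otimes> foldr (mult G) ss \<one>)"
  proof -
    have "inv (g \<otimes> s) \<otimes> h = p \<longleftrightarrow> inv g \<otimes> h = s \<otimes> p" if "s \<in> carrier G" "p \<in> carrier G" for s p
    proof -
      have "inv (g \<otimes> s) \<otimes> h = inv s \<otimes> (inv g \<otimes> h)"
        using that Suc.prems assms(3) by (simp add: inv_mult_group m_assoc)
      then show ?thesis
        using that Suc.prems assms(3) by (metis inv_closed inv_solve_left m_closed)
    qed
    moreover have "foldr (mult G) ss \<one> \<in> carrier G" if "set ss \<subseteq> ?T" for ss
      using that T foldr_mult_closed by blast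
    ultimately show ?thesis using T by (meson subsetD)
  qed
  also have "\<dots> \<longleftrightarrow> (\<exists>ss. length ss = Suc k \<and> set ss \<subseteq> ?T \<and> inv g \<otimes> h = foldr (mult G) ss \<one>)"
  proof
    assume "\<exists>s\<in>?T. \<exists>ss. length ss = k \<and> set ss \<subseteq> ?T \<and> inv g \<otimes> h = s \<otimes> foldr (mult G) ss \<one>"
    then obtain s ss where "s \<in> ?T" "length ss = k" "set ss \<subseteq> ?T" "inv g \<otimes> h = s \<otimes> foldr (mult G) ss \<one>" by blast
    then show "\<exists>ss. length ss = Suc k \<and> set ss \<subseteq> ?T \<and> inv g \<otimes> h = foldr (mult G) ss \<one>"
      by (intro exI[of _ "s # ss"]) simp
  next
    assume "\<exists>ss. length ss = Suc k \<and> set ss \<subseteq> ?T \<and> inv g \<otimes> h = foldr (mult G) ss \<one>"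
    then obtain ss where ss: "length ss = Suc k" "set ss \<subseteq> ?T" "inv g \<otimes> h = foldr (mult G) ss \<one>" by blast
    then obtain s ss' where "ss = s # ss'" by (cases ss) auto
    then show "\<exists>s\<in>?T. \<exists>ss. length ss = k \<and> set ss \<subseteq> ?T \<and> inv g \<otimes> h = s \<otimes> foldr (mult G) ss \<one>"
      using ss by (intro bexI[of _ s] exI[of _ ss']) auto
  qed
  finally show ?case .
qed

lemma word_metric_eq_graph_dist:
  assumes "S \<subseteq> carrier G" "g \<in> carrier G" "h \<in> carrier G"
  shows "word_metric G S g h = real (graph_dist (cayley_graph G S) g h)"
proof (cases "g = h")
  case False
  then show ?thesis
    unfolding word_metric_def graph_dist_def relpow_cayley_graph[OF assms] by simp
qed (simp add: word_metric_def)

lemma generate_imp_reachable: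
  assumes S: "S \<subseteq> carrier G" and "x \<in> generate G S" "g \<in> carrier G"
  shows "(g, g \<otimes> x) \<in> (cayley_graph G S)\<^sup>*"
  using assms(2,3)
proof (induction x arbitrary: g)
  case (eng x y)
  have "x \<in> carrier G" "y \<in> carrier G" using eng generate_in_carrier[OF S] by auto
  then have "(g \<otimes> x, g \<otimes> (x \<otimes> y)) \<in> (cayley_graph G S)\<^sup>*"
    using eng.IH(2)[of "g \<otimes> x"] eng.prems by (simp add: m_assoc)
  with eng.IH(1)[OF eng.prems] show ?case by (rule rtrancl_trans)
qed (auto simp: cayley_graph_def)

lemma cayley_graph_connected:
  assumes "marked_group G S" "a \<in> carrier G" "b \<in> carrier G"
  shows "(a, b) \<in> (cayley_graph G S)\<^sup>*"
proof -
  have "(a, a \<otimes> (inv a \<otimes> b)) \<in> (cayley_graph G S)\<^sup>*"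
    using assms by (intro generate_imp_reachable) (auto simp: marked_group_def)
  then show ?thesis using assms by (simp add: m_assoc[symmetric])
qed

lemma marked_groupI:
  assumes "finite S" "S \<subseteq> carrier G" "\<And>g. g \<in> carrier G \<Longrightarrow> (\<one>, g) \<in> (cayley_graph G S)\<^sup>*"
  shows "marked_group G S"
proof -
  have "g \<in> generate G S" if "(\<one>, g) \<in> (cayley_graph G S)\<^sup>*" for g
    using that
  proof (induction rule: rtrancl_induct)
    case (step y z)
    then obtain s where "s \<in> S \<union> m_inv G ` S" "z = y \<otimes> s" by (auto simp: cayley_graph_def)
    then show ?case using step.IH generate.incl generate.inv by (metis UnE generate.eng imageE)
  qed (rule generate.one)
  then have "generate G S = carrier G"
    using generate_in_carrier[OF assms(2)] assms(3) by blast
  then show ?thesis unfolding marked_group_def using assms is_group by blast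
qed

lemma countable_carrier_marked_group:
  assumes "marked_group G S"
  shows "countable (carrier G)"
proof -
  have S: "S \<subseteq> carrier G" "finite S" using assms by (auto simp: marked_group_def)
  have "carrier G \<subseteq> (\<lambda>ss. foldr (mult G) ss \<one>) ` lists (S \<union> m_inv G ` S)"
  proof
    fix g assume g: "g \<in> carrier G"
    obtain k where "(\<one>, g) \<in> cayley_graph G S ^^ k"
      using cayley_graph_connected[OF assms one_closed g] by (auto simp: rtrancl_power)
    then obtain ss where "set ss \<subseteq> S \<union> m_inv G ` S" "inv \<one> \<otimes> g = foldr (mult G) ss \<one>"
      using relpow_cayley_graph[OF S(1) one_closed g] by blast
    then show "g \<in> (\<lambda>ss. foldr (mult G) ss \<one>) ` lists (S \<union> m_inv G ` S)"
      using g by (intro image_eqI[of _ _ ss]) auto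
  qed
  moreover have "countable (lists (S \<union> m_inv G ` S))"
    using S by (intro countable_lists countable_finite) auto
  ultimately show ?thesis using countable_image countable_subset by meson
qed

end

lemma graph_dist_isomorphism:
  assumes inj: "inj_on f N" and E: "E \<subseteq> N \<times> N" and E': "E' \<subseteq> f ` N \<times> f ` N"
    and iff: "\<And>x y. x \<in> N \<Longrightarrow> y \<in> N \<Longrightarrow> (x, y) \<in> E \<longleftrightarrow> (f x, f y) \<in> E'"
    and xy: "x \<in> N" "y \<in> N"
  shows "graph_dist E x y = graph_dist E' (f x) (f y)"
proof -
  have "(x, y) \<in> E ^^ n \<longleftrightarrow> (f x, f y) \<in> E' ^^ n" for n
  proof
    show "(x, y) \<in> E ^^ n \<Longrightarrow> (f x, f y) \<in> E' ^^ n"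
      using E iff by (intro relpow_image[of E f]) blast+
    assume "(f x, f y) \<in> E' ^^ n"
    moreover have "(inv_into N f a, inv_into N f b) \<in> E" if ab: "(a, b) \<in> E'" for a b
    proof -
      obtain u w where "u \<in> N" "w \<in> N" "a = f u" "b = f w" using ab E' by blast
      then show ?thesis using ab iff inj by simp
    qed
    ultimately have "(inv_into N f (f x), inv_into N f (f y)) \<in> E ^^ n"
      by (intro relpow_image[of E' "inv_into N f"])
    then show "(x, y) \<in> E ^^ n" using inj xy by simp
  qed
  then show ?thesis unfolding graph_dist_def by simp
qed

lemma rips_complex_cong:
  assumes "\<And>x y. x \<in> M \<Longrightarrow> y \<in> M \<Longrightarrow> d x y = d' x y"
  shows "rips_complex M d r = rips_complex M d' r"
proof (rule Set.set_eqI)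
  fix \<sigma>
  show "\<sigma> \<in> rips_complex M d r \<longleftrightarrow> \<sigma> \<in> rips_complex M d' r"
    unfolding rips_complex_iff using assms by (metis subsetD)
qed

section \<open>Normal forms in HNN-extensions\<close>

locale hnn = group A for A (structure) +
  fixes C :: "'a set" and \<phi> :: "'a \<Rightarrow> 'a"
  assumes C_subgroup: "subgroup C A" and \<phi>_mon: "\<phi> \<in> mon (A\<lparr>carrier := C\<rparr>) A"
begin

lemma C_sub: "c \<in> C \<Longrightarrow> c \<in> carrier A"
  using subgroup.subset[OF C_subgroup] by blast

lemma \<phi>_closed: "c \<in> C \<Longrightarrow> \<phi> c \<in> carrier A"
  and \<phi>_mult: "c \<in> C \<Longrightarrow> d \<in> C \<Longrightarrow> \<phi> (c \<otimes> d) = \<phi> c \<otimes> \<phi> d"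
  and \<phi>_inj: "inj_on \<phi> C"
  using \<phi>_mon by (auto simp: mon_def hom_def)

text \<open>
  Exponents of the stable letter are Booleans, as in \<^typ>\<open>'g gword\<close>. Elements of the two associated
  subgroups are moved across it by $h t = t\,\varphi^{-1}(h)$ for $h \in \varphi(C)$ and
  $h t^{-1} = t^{-1} \varphi(h)$ for $h \in C$.
\<close>

definition side :: "bool \<Rightarrow> 'a set" where
  "side \<epsilon> = (if \<epsilon> then \<phi> ` C else C)"

definition across :: "bool \<Rightarrow> 'a \<Rightarrow> 'a" where
  "across \<epsilon> h = (if \<epsilon> then inv_into C \<phi> h else \<phi> h)"

lemma side_subgroup: "subgroup (side \<epsilon>) A"
proof (cases \<epsilon>)
  case True
  have "group_hom (A\<lparr>carrier := C\<rparr>) A \<phi>"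
    using subgroup.subgroup_is_group[OF C_subgroup is_group] \<phi>_mon
    by (simp add: group_hom_def group_hom_axioms_def mon_def)
  from group_hom.img_is_subgroup[OF this] show ?thesis using True by (simp add: side_def)
qed (simp add: side_def C_subgroup)

lemma side_sub: "h \<in> side \<epsilon> \<Longrightarrow> h \<in> carrier A"
  using subgroup.subset[OF side_subgroup] by blast

lemma side_one: "\<one> \<in> side \<epsilon>"
  by (rule subgroup.one_closed[OF side_subgroup])

lemma side_mult: "h \<in> side \<epsilon> \<Longrightarrow> k \<in> side \<epsilon> \<Longrightarrow> h \<otimes> k \<in> side \<epsilon>"
  by (rule subgroup.m_closed[OF side_subgroup])

lemma side_inv: "h \<in> side \<epsilon> \<Longrightarrow> inv h \<in> side \<epsilon>"
  by (rule subgroup.m_inv_closed[OF side_subgroup])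

lemma side_mult_iff:
  assumes "a \<in> carrier A" "h \<in> side \<epsilon>"
  shows "a \<otimes> h \<in> side \<epsilon> \<longleftrightarrow> a \<in> side \<epsilon>"
proof
  assume "a \<otimes> h \<in> side \<epsilon>"
  then have "(a \<otimes> h) \<otimes> inv h \<in> side \<epsilon>" using side_mult side_inv assms by blast
  then show "a \<in> side \<epsilon>" using assms side_sub[of h \<epsilon>] by (simp add: m_assoc)
qed (use assms side_mult in blast)

lemma across_side: "h \<in> side \<epsilon> \<Longrightarrow> across \<epsilon> h \<in> side (\<not> \<epsilon>)"
  by (auto simp: side_def across_def inv_into_into)

lemma across_across: "h \<in> side \<epsilon> \<Longrightarrow> across (\<not> \<epsilon>) (across \<epsilon> h) = h"
  using \<phi>_inj by (auto simp: side_def across_def f_inv_into_f)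

lemma across_mult:
  assumes "h \<in> side \<epsilon>" "k \<in> side \<epsilon>"
  shows "across \<epsilon> (h \<otimes> k) = across \<epsilon> h \<otimes> across \<epsilon> k"
proof (cases \<epsilon>)
  case True
  then obtain c d where cd: "c \<in> C" "d \<in> C" "h = \<phi> c" "k = \<phi> d" using assms by (auto simp: side_def)
  then have "c \<otimes> d \<in> C" using C_subgroup by (simp add: subgroup.m_closed)
  then have "inv_into C \<phi> (\<phi> (c \<otimes> d)) = c \<otimes> d" using \<phi>_inj by simp
  then show ?thesis using True cd \<phi>_inj by (simp add: across_def \<phi>_mult)
qed (use assms \<phi>_mult in \<open>auto simp: side_def across_def\<close>)

lemma across_closed: "h \<in> side \<epsilon> \<Longrightarrow> across \<epsilon> h \<in> carrier A"
  using across_side side_sub by blast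

lemma across_one: "across \<epsilon> \<one> = \<one>"
proof -
  have "across \<epsilon> \<one> \<otimes> across \<epsilon> \<one> = across \<epsilon> \<one>"
    using across_mult[OF side_one side_one, of \<epsilon>] by simp
  then show ?thesis using across_closed[OF side_one, of \<epsilon>] by (metis l_cancel_one)
qed

definition rep :: "bool \<Rightarrow> 'a \<Rightarrow> 'a" where
  "rep \<epsilon> a = (if a \<in> side \<epsilon> then \<one> else SOME s. s \<in> a <# side \<epsilon>)"

definition rest :: "bool \<Rightarrow> 'a \<Rightarrow> 'a" where
  "rest \<epsilon> a = inv (rep \<epsilon> a) \<otimes> a"

lemma rep_coset:
  assumes a: "a \<in> carrier A"
  shows "\<exists>h\<in>side \<epsilon>. rep \<epsilon> a = a \<otimes> h"
proof (cases "a \<in> side \<epsilon>")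
  case True
  then show ?thesis using a side_inv by (intro bexI[of _ "inv a"]) (auto simp: rep_def)
next
  case False
  have "a \<otimes> \<one> \<in> a <# side \<epsilon>" unfolding l_coset_def using side_one by blast
  then have "(SOME s. s \<in> a <# side \<epsilon>) \<in> a <# side \<epsilon>" by (rule someI)
  then show ?thesis using False by (auto simp: rep_def l_coset_def)
qed

lemma rep_closed: "a \<in> carrier A \<Longrightarrow> rep \<epsilon> a \<in> carrier A"
  using rep_coset side_sub by (metis m_closed)

lemma rest_side:
  assumes a: "a \<in> carrier A"
  shows "rest \<epsilon> a \<in> side \<epsilon>"
proof -
  obtain h where h: "h \<in> side \<epsilon>" "rep \<epsilon> a = a \<otimes> h" using rep_coset[OF a] by blast
  have "rest \<epsilon> a = inv h" using h a side_sub[OF h(1)] by (simp add: rest_def inv_mult_group m_assoc)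
  then show ?thesis using h side_inv by simp
qed

lemma rep_rest: "a \<in> carrier A \<Longrightarrow> rep \<epsilon> a \<otimes> rest \<epsilon> a = a"
  using rep_closed by (simp add: rest_def m_assoc[symmetric])

lemma rep_mult:
  assumes a: "a \<in> carrier A" and h: "h \<in> side \<epsilon>"
  shows "rep \<epsilon> (a \<otimes> h) = rep \<epsilon> a"
proof -
  have "(a \<otimes> h) <# side \<epsilon> = a <# side \<epsilon>"
  proof -
    have "(a \<otimes> h) <# side \<epsilon> = a <# (h <# side \<epsilon>)"
      using a h side_sub subgroup.subset[OF side_subgroup] by (simp add: lcos_m_assoc)
    moreover have "h <# side \<epsilon> = side \<epsilon>"
      using h side_subgroup by (simp add: coset_join3 side_sub)
    ultimately show ?thesis by simp
  qed
  then show ?thesis using side_mult_iff[OF a h] by (simp add: rep_def)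
qed

lemma rest_mult:
  assumes "a \<in> carrier A" "h \<in> side \<epsilon>"
  shows "rest \<epsilon> (a \<otimes> h) = rest \<epsilon> a \<otimes> h"
  using assms rep_mult[OF assms] rep_closed side_sub by (simp add: rest_def m_assoc)

lemma rep_side: "a \<in> side \<epsilon> \<Longrightarrow> rep \<epsilon> a = \<one>"
  by (simp add: rep_def)

lemma rep_eq_one_iff:
  assumes "a \<in> carrier A"
  shows "rep \<epsilon> a = \<one> \<longleftrightarrow> a \<in> side \<epsilon>"
  using rest_side[OF assms, of \<epsilon>] assms by (auto simp: rep_side rest_def)

lemma rep_rep: "a \<in> carrier A \<Longrightarrow> rep \<epsilon> (rep \<epsilon> a) = rep \<epsilon> a"
  using rep_coset rep_mult by metis

text \<open>
  The pair \<open>([(s\<^sub>n, \<epsilon>\<^sub>n), \<dots>, (s\<^sub>1, \<epsilon>\<^sub>1)], a)\<close> with first component in \<open>reduced\<close> stands for the normal form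
  $s_1 t^{\epsilon_1} \cdots s_n t^{\epsilon_n} a$: the letters are listed backwards, so that the parent of a
  vertex of the Bass--Serre tree is the tail of the list.
\<close>

inductive_set reduced :: "('a \<times> bool) list set" where
  Nil: "[] \<in> reduced"
| Cons: "v \<in> reduced \<Longrightarrow> s \<in> carrier A \<Longrightarrow> rep \<epsilon> s = s \<Longrightarrow>
    \<not> (v \<noteq> [] \<and> s = \<one> \<and> snd (hd v) = (\<not> \<epsilon>)) \<Longrightarrow> (s, \<epsilon>) # v \<in> reduced"

inductive_cases reduced_ConsE: "(s, \<epsilon>) # v \<in> reduced"

abbreviation normal_forms :: "(('a \<times> bool) list \<times> 'a) set" where
  "normal_forms \<equiv> reduced \<times> carrier A"

text \<open>Right multiplication by a generator, transported to normal forms.\<close>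

fun act :: "'a hnn_gen \<times> bool \<Rightarrow> ('a \<times> bool) list \<times> 'a \<Rightarrow> ('a \<times> bool) list \<times> 'a" where
  "act (Base b, \<epsilon>) (v, a) = (v, a \<otimes> (if \<epsilon> then b else inv b))"
| "act (Stable, \<epsilon>) (v, a) =
     (if v \<noteq> [] \<and> a \<in> side \<epsilon> \<and> snd (hd v) = (\<not> \<epsilon>) then (tl v, fst (hd v) \<otimes> across \<epsilon> a)
      else ((rep \<epsilon> a, \<epsilon>) # v, across \<epsilon> (rest \<epsilon> a)))"

lemma act_Stable_cases:
  assumes "(v, a) \<in> normal_forms"
  obtains (cancel) s w where "v = (s, \<not> \<epsilon>) # w" "a \<in> side \<epsilon>" "act (Stable, \<epsilon>) (v, a) = (w, s \<otimes> across \<epsilon> a)"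
      "w \<in> reduced" "s \<in> carrier A" "rep (\<not> \<epsilon>) s = s" "\<not> (w \<noteq> [] \<and> s = \<one> \<and> snd (hd w) = \<epsilon>)"
    | (extend) "act (Stable, \<epsilon>) (v, a) = ((rep \<epsilon> a, \<epsilon>) # v, across \<epsilon> (rest \<epsilon> a))" "(rep \<epsilon> a, \<epsilon>) # v \<in> reduced"
proof (cases "v \<noteq> [] \<and> a \<in> side \<epsilon> \<and> snd (hd v) = (\<not> \<epsilon>)")
  case True
  then obtain s w where v: "v = (s, \<not> \<epsilon>) # w" by (cases v) auto
  then have "(s, \<not> \<epsilon>) # w \<in> reduced" using assms by simp
  then show thesis
    using True v by (elim reduced_ConsE) (intro cancel[of s w], auto)
next
  case False
  have a: "a \<in> carrier A" "v \<in> reduced" using assms by auto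
  have "(rep \<epsilon> a, \<epsilon>) # v \<in> reduced"
    using False a rep_closed rep_rep rep_eq_one_iff by (intro reduced.Cons) auto
  moreover have "act (Stable, \<epsilon>) (v, a) = ((rep \<epsilon> a, \<epsilon>) # v, across \<epsilon> (rest \<epsilon> a))"
    using False by (simp only: act.simps if_False)
  ultimately show thesis by (intro extend)
qed

lemma act_closed:
  assumes "x \<in> hnn_gens A" "n \<in> normal_forms"
  shows "act (x, \<epsilon>) n \<in> normal_forms"
proof -
  obtain v a where n: "n = (v, a)" "v \<in> reduced" "a \<in> carrier A" using assms(2) by auto
  show ?thesis
  proof (cases x)
    case (Base b)
    then have "b \<in> carrier A" using assms(1) by (auto simp: hnn_gens_def)
    then show ?thesis using n Base by simp
  next
    case Stable
    have "(v, a) \<in> normal_forms" using n by simp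
    then show ?thesis
    proof (cases rule: act_Stable_cases[where \<epsilon>=\<epsilon>])
      case (cancel s w)
      then show ?thesis using n Stable across_closed by simp
    next
      case extend
      then show ?thesis using n Stable across_closed[OF rest_side[OF n(3)]] by simp
    qed
  qed
qed

lemma rep_rest_fixed:
  assumes "s \<in> carrier A" "rep \<epsilon> s = s" "h \<in> side \<epsilon>"
  shows "rep \<epsilon> (s \<otimes> h) = s" "rest \<epsilon> (s \<otimes> h) = h"
proof -
  show 1: "rep \<epsilon> (s \<otimes> h) = s" using rep_mult assms by simp
  show "rest \<epsilon> (s \<otimes> h) = h"
    unfolding rest_def 1 using assms side_sub[of h] by (simp add: m_assoc[symmetric])
qed

lemma act_cancel:
  assumes "x \<in> hnn_gens A" "n \<in> normal_forms"
  shows "act (x, \<not> \<epsilon>) (act (x, \<epsilon>) n) = n"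
proof -
  obtain v a where n: "n = (v, a)" "v \<in> reduced" "a \<in> carrier A" using assms(2) by auto
  show ?thesis
  proof (cases x)
    case (Base b)
    then have "b \<in> carrier A" using assms(1) by (auto simp: hnn_gens_def)
    then show ?thesis using n Base by (simp add: m_assoc)
  next
    case Stable
    have "(v, a) \<in> normal_forms" using n by simp
    then show ?thesis
    proof (cases rule: act_Stable_cases[where \<epsilon>=\<epsilon>])
      case (cancel s w)
      let ?k = "across \<epsilon> a"
      have k: "?k \<in> side (\<not> \<epsilon>)" using across_side cancel by blast
      have "s \<otimes> ?k \<in> side (\<not> \<epsilon>) \<longleftrightarrow> s = \<one>"
        using side_mult_iff[OF cancel(5) k] rep_eq_one_iff[OF cancel(5), of "\<not> \<epsilon>"] cancel(6) by auto
      then have "\<not> (w \<noteq> [] \<and> s \<otimes> ?k \<in> side (\<not> \<epsilon>) \<and> snd (hd w) = (\<not> \<not> \<epsilon>))" using cancel(7) by auto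
      then have "act (Stable, \<not> \<epsilon>) (w, s \<otimes> ?k) = ((s, \<not> \<epsilon>) # w, across (\<not> \<epsilon>) ?k)"
        using rep_rest_fixed[OF cancel(5,6) k] by (simp only: act.simps if_False)
      then show ?thesis using cancel n Stable across_across by simp
    next
      case extend
      have h: "rest \<epsilon> a \<in> side \<epsilon>" using rest_side n by blast
      then show ?thesis
        using n Stable extend(1) across_side[OF h] across_across[OF h] rep_rest[OF n(3)] by simp
    qed
  qed
qed

lemma act_across:
  assumes "(v, a) \<in> normal_forms" "h \<in> side \<epsilon>"
  shows "act (Stable, \<epsilon>) (v, a \<otimes> h) =
    (fst (act (Stable, \<epsilon>) (v, a)), snd (act (Stable, \<epsilon>) (v, a)) \<otimes> across \<epsilon> h)"
proof -
  have a: "a \<in> carrier A" and v: "v \<in> reduced" using assms by auto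
  show ?thesis
  proof (cases "v \<noteq> [] \<and> a \<in> side \<epsilon> \<and> snd (hd v) = (\<not> \<epsilon>)")
    case True
    then obtain s w where v': "v = (s, \<not> \<epsilon>) # w" by (cases v) auto
    then have "s \<in> carrier A" using v by (auto elim: reduced_ConsE)
    then show ?thesis
      using True v' side_mult_iff[OF a assms(2)] across_mult[OF _ assms(2), of a]
        across_closed[OF assms(2)] across_closed[of a \<epsilon>] by (simp add: m_assoc)
  next
    case False
    then have "\<not> (v \<noteq> [] \<and> a \<otimes> h \<in> side \<epsilon> \<and> snd (hd v) = (\<not> \<epsilon>))"
      using side_mult_iff[OF a assms(2)] by simp
    then show ?thesis
      using False rep_mult[OF a assms(2)] rest_mult[OF a assms(2)] across_mult[OF rest_side[OF a] assms(2)]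
      by (simp only: act.simps if_False fst_conv snd_conv)
  qed
qed

abbreviation acts :: "'a hnn_gen gword \<Rightarrow> ('a \<times> bool) list \<times> 'a \<Rightarrow> ('a \<times> bool) list \<times> 'a" where
  "acts u \<equiv> fold act u"

lemma acts_closed:
  assumes "u \<in> gwords (hnn_gens A)" "n \<in> normal_forms"
  shows "acts u n \<in> normal_forms"
  using assms
proof (induction u arbitrary: n)
  case (Cons l u)
  then obtain x \<epsilon> where "l = (x, \<epsilon>)" "x \<in> hnn_gens A" by (auto simp: gwords_def)
  then have "act l n \<in> normal_forms" using act_closed Cons.prems by simp
  moreover have "u \<in> gwords (hnn_gens A)" using Cons.prems by (simp add: gwords_def)
  ultimately show ?case using Cons.IH by simp
qed simp

abbreviation hrel :: "('a hnn_gen gword \<times> 'a hnn_gen gword) set" where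
  "hrel \<equiv> presentation_rel (hnn_gens A) (hnn_rels A C \<phi>)"

lemma acts_presentation_rel:
  assumes "(u, w) \<in> hrel" "n \<in> normal_forms"
  shows "acts u n = acts w n"
  using assms
proof (induction arbitrary: n)
  case (append u u' v v')
  have "acts u n \<in> normal_forms"
    using append.prems presentation_rel_gwords[OF append.hyps(1)] acts_closed by blast
  then show ?case using append.IH append.prems by simp
next
  case (cancel x b)
  then show ?case using act_cancel by simp
next
  case (relation u v)
  obtain w a where n: "n = (w, a)" "w \<in> reduced" "a \<in> carrier A" using relation.prems by auto
  from relation.hyps(1) consider b c where "u = [(Base b, True), (Base c, True)]" "v = [(Base (b \<otimes> c), True)]"
      "b \<in> carrier A" "c \<in> carrier A"
    | c where "u = [(Stable, True), (Base c, True), (Stable, False)]" "v = [(Base (\<phi> c), True)]" "c \<in> C"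
    unfolding hnn_rels_def by blast
  then show ?case
  proof cases
    case 1
    then show ?thesis using n by (simp add: m_assoc)
  next
    case 2
    have h: "\<phi> c \<in> side True" using 2 by (simp add: side_def)
    have "across True (\<phi> c) = c" using 2 \<phi>_inj by (simp add: across_def)
    then have "act (Base c, True) (act (Stable, True) n) = act (Stable, True) (act (Base (\<phi> c), True) n)"
      using act_across[OF _ h, of w a] n by (cases "act (Stable, True) (w, a)") simp
    moreover have "act (Base (\<phi> c), True) n \<in> normal_forms"
      using n \<phi>_closed[OF 2(3)] by simp
    then have "act (Stable, \<not> True) (act (Stable, True) (act (Base (\<phi> c), True) n)) = act (Base (\<phi> c), True) n"
      by (intro act_cancel) (simp_all add: hnn_gens_def)
    ultimately show ?thesis using 2 by simp
  qed
qed auto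

fun nf_word :: "('a \<times> bool) list \<Rightarrow> 'a hnn_gen gword" where
  "nf_word [] = []"
| "nf_word ((s, \<epsilon>) # v) = nf_word v @ [(Base s, True), (Stable, \<epsilon>)]"

lemma nf_word_gwords: "v \<in> reduced \<Longrightarrow> nf_word v \<in> gwords (hnn_gens A)"
  by (induction rule: reduced.induct) (auto simp: gwords_def hnn_gens_def)

lemma acts_nf_word:
  assumes "v \<in> reduced"
  shows "acts (nf_word v) ([], \<one>) = (v, \<one>)"
  using assms
proof (induction rule: reduced.induct)
  case (Cons v s \<epsilon>)
  have "\<not> (v \<noteq> [] \<and> s \<in> side \<epsilon> \<and> snd (hd v) = (\<not> \<epsilon>))"
    using Cons.hyps(3,4) rep_side[of s \<epsilon>] by auto
  then have "act (Stable, \<epsilon>) (v, s) = ((rep \<epsilon> s, \<epsilon>) # v, across \<epsilon> (rest \<epsilon> s))"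
    by (simp only: act.simps if_False)
  moreover have "rest \<epsilon> s = \<one>" using Cons.hyps by (simp add: rest_def)
  ultimately show ?case using Cons by (simp add: across_one)
qed simp

abbreviation HNN :: "'a hnn_gen gword set monoid" where
  "HNN \<equiv> hnn_extension A C \<phi>"

abbreviation cls :: "'a hnn_gen gword \<Rightarrow> 'a hnn_gen gword set" where
  "cls u \<equiv> hrel `` {u}"

abbreviation emb :: "'a \<Rightarrow> 'a hnn_gen gword set" where
  "emb \<equiv> hnn_embedding A C \<phi>"

definition stab :: "bool \<Rightarrow> 'a hnn_gen gword set" where
  "stab \<epsilon> = cls [(Stable, \<epsilon>)]"

lemma group_HNN: "group HNN"
  unfolding hnn_extension_def by (rule group_presented_group)

sublocale HNN: group HNN
  by (rule group_HNN)

lemma cls_mult: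
  assumes "u \<in> gwords (hnn_gens A)" "v \<in> gwords (hnn_gens A)"
  shows "cls u \<otimes>\<^bsub>HNN\<^esub> cls v = cls (u @ v)"
  unfolding hnn_extension_def by (rule presented_group_mult[OF assms])

lemma cls_closed: "u \<in> gwords (hnn_gens A) \<Longrightarrow> cls u \<in> carrier HNN"
  by (auto simp: hnn_extension_def presented_group_def quotient_def)

lemma carrier_HNN: "P \<in> carrier HNN \<Longrightarrow> \<exists>u\<in>gwords (hnn_gens A). P = cls u"
  by (auto simp: hnn_extension_def presented_group_def quotient_def)

lemma one_HNN: "\<one>\<^bsub>HNN\<^esub> = cls []"
  by (simp add: hnn_extension_def presented_group_def)

lemma cls_eq: "(u, v) \<in> hrel \<Longrightarrow> cls u = cls v"
  by (rule equiv_class_eq[OF equiv_presentation_rel])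

lemma gword_letters:
  "a \<in> carrier A \<Longrightarrow> [(Base a, \<epsilon>)] \<in> gwords (hnn_gens A)" "[(Stable, \<epsilon>)] \<in> gwords (hnn_gens A)"
  by (auto simp: gwords_def hnn_gens_def)

lemma emb_closed [simp]: "a \<in> carrier A \<Longrightarrow> emb a \<in> carrier HNN"
  unfolding hnn_embedding_def by (intro cls_closed gword_letters)

lemma stab_closed [simp]: "stab \<epsilon> \<in> carrier HNN"
  unfolding stab_def by (intro cls_closed gword_letters)

lemma emb_mult:
  assumes "a \<in> carrier A" "b \<in> carrier A"
  shows "emb a \<otimes>\<^bsub>HNN\<^esub> emb b = emb (a \<otimes> b)"
proof -
  have "([(Base a, True), (Base b, True)], [(Base (a \<otimes> b), True)]) \<in> hrel"
  proof (rule presentation_rel.relation)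
    show "([(Base a, True), (Base b, True)], [(Base (a \<otimes> b), True)]) \<in> hnn_rels A C \<phi>"
      unfolding hnn_rels_def using assms by blast
  qed (use assms in \<open>simp_all add: gwords_def hnn_gens_def\<close>)
  then show ?thesis
    unfolding hnn_embedding_def using cls_mult[OF gword_letters(1)[OF assms(1)] gword_letters(1)[OF assms(2)]]
      cls_eq by simp
qed

lemma emb_one: "emb \<one> = \<one>\<^bsub>HNN\<^esub>"
  using emb_mult[of \<one> \<one>] by (metis HNN.l_cancel_one emb_closed l_one one_closed)

lemma emb_inv: "a \<in> carrier A \<Longrightarrow> emb (inv a) = inv\<^bsub>HNN\<^esub> (emb a)"
  using emb_mult[of "inv a" a] emb_one by (simp add: HNN.inv_equality)

lemma cls_Base:
  assumes "b \<in> carrier A"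
  shows "cls [(Base b, \<epsilon>)] = emb (if \<epsilon> then b else inv b)"
proof (cases \<epsilon>)
  case False
  have "cls [(Base b, False)] \<otimes>\<^bsub>HNN\<^esub> emb b = cls [(Base b, False), (Base b, \<not> False)]"
    unfolding hnn_embedding_def using assms by (subst cls_mult) (auto intro: gword_letters)
  also have "\<dots> = \<one>\<^bsub>HNN\<^esub>"
    unfolding one_HNN using assms by (intro cls_eq presentation_rel.cancel) (simp add: hnn_gens_def)
  finally have "inv\<^bsub>HNN\<^esub> (emb b) = cls [(Base b, False)]"
    using assms by (intro HNN.inv_equality) (auto intro: cls_closed gword_letters)
  then show ?thesis using False assms emb_inv by simp
qed (simp add: hnn_embedding_def)

lemma stab_cancel: "stab \<epsilon> \<otimes>\<^bsub>HNN\<^esub> stab (\<not> \<epsilon>) = \<one>\<^bsub>HNN\<^esub>"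
proof -
  have "([(Stable, \<epsilon>), (Stable, \<not> \<epsilon>)], []) \<in> hrel"
    by (rule presentation_rel.cancel) (simp add: hnn_gens_def)
  then show ?thesis
    unfolding stab_def one_HNN using cls_mult[OF gword_letters(2) gword_letters(2)] cls_eq by simp
qed

lemma inv_stab: "inv\<^bsub>HNN\<^esub> (stab \<epsilon>) = stab (\<not> \<epsilon>)"
  using stab_cancel[of "\<not> \<epsilon>"] by (intro HNN.inv_equality) auto

lemma stab_conj:
  assumes "c \<in> C"
  shows "stab True \<otimes>\<^bsub>HNN\<^esub> emb c \<otimes>\<^bsub>HNN\<^esub> stab False = emb (\<phi> c)"
proof -
  have gw: "[(Stable, True)] \<in> gwords (hnn_gens A)" "[(Base c, True)] \<in> gwords (hnn_gens A)"
    "[(Stable, True), (Base c, True)] \<in> gwords (hnn_gens A)" "[(Stable, False)] \<in> gwords (hnn_gens A)"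
    "[(Stable, True), (Base c, True), (Stable, False)] \<in> gwords (hnn_gens A)"
    "[(Base (\<phi> c), True)] \<in> gwords (hnn_gens A)"
    using C_sub[OF assms] \<phi>_closed[OF assms] by (auto simp: gwords_def hnn_gens_def)
  have "stab True \<otimes>\<^bsub>HNN\<^esub> emb c \<otimes>\<^bsub>HNN\<^esub> stab False = cls [(Stable, True), (Base c, True), (Stable, False)]"
    unfolding stab_def hnn_embedding_def using gw by (simp add: cls_mult)
  also have "\<dots> = emb (\<phi> c)"
    unfolding hnn_embedding_def
    using assms gw by (intro cls_eq presentation_rel.relation) (auto simp: hnn_rels_def)
  finally show ?thesis .
qed

lemma emb_stab:
  assumes h: "h \<in> side \<epsilon>"
  shows "emb h \<otimes>\<^bsub>HNN\<^esub> stab \<epsilon> = stab \<epsilon> \<otimes>\<^bsub>HNN\<^esub> emb (across \<epsilon> h)"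
proof (cases \<epsilon>)
  case True
  then obtain c where c: "c \<in> C" "h = \<phi> c" using h by (auto simp: side_def)
  then have "across \<epsilon> h = c" using True \<phi>_inj by (simp add: across_def)
  moreover have "emb h \<otimes>\<^bsub>HNN\<^esub> stab True = stab True \<otimes>\<^bsub>HNN\<^esub> emb c"
    using stab_conj[OF c(1)] stab_cancel[of False] C_sub[OF c(1)] c
    by (metis HNN.m_assoc HNN.m_closed HNN.r_one emb_closed not_False_eq_True stab_closed)
  ultimately show ?thesis using True by simp
next
  case False
  then have c: "h \<in> C" "across \<epsilon> h = \<phi> h" using h by (auto simp: side_def across_def)
  have "stab False \<otimes>\<^bsub>HNN\<^esub> emb (\<phi> h) = stab False \<otimes>\<^bsub>HNN\<^esub> (stab True \<otimes>\<^bsub>HNN\<^esub> (emb h \<otimes>\<^bsub>HNN\<^esub> stab False))"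
    using stab_conj[OF c(1)] C_sub[OF c(1)] by (simp add: HNN.m_assoc)
  also have "\<dots> = (stab False \<otimes>\<^bsub>HNN\<^esub> stab True) \<otimes>\<^bsub>HNN\<^esub> (emb h \<otimes>\<^bsub>HNN\<^esub> stab False)"
    using C_sub[OF c(1)] by (simp add: HNN.m_assoc)
  also have "\<dots> = emb h \<otimes>\<^bsub>HNN\<^esub> stab False"
    using stab_cancel[of False] C_sub[OF c(1)] by simp
  finally show ?thesis using False c by simp
qed

definition value_of :: "('a \<times> bool) list \<times> 'a \<Rightarrow> 'a hnn_gen gword set" where
  "value_of n = cls (nf_word (fst n) @ [(Base (snd n), True)])"

lemma value_of_eq:
  assumes "v \<in> reduced" "a \<in> carrier A"
  shows "value_of (v, a) = cls (nf_word v) \<otimes>\<^bsub>HNN\<^esub> emb a"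
  unfolding value_of_def hnn_embedding_def
  using cls_mult[OF nf_word_gwords[OF assms(1)] gword_letters(1)[OF assms(2)]] by simp

lemma cls_nf_word_closed [simp]: "v \<in> reduced \<Longrightarrow> cls (nf_word v) \<in> carrier HNN"
  by (intro cls_closed nf_word_gwords)

lemma cls_nf_word_Cons:
  assumes "(s, \<epsilon>) # v \<in> reduced"
  shows "cls (nf_word ((s, \<epsilon>) # v)) = cls (nf_word v) \<otimes>\<^bsub>HNN\<^esub> (emb s \<otimes>\<^bsub>HNN\<^esub> stab \<epsilon>)"
proof -
  from assms have v: "v \<in> reduced" and s: "s \<in> carrier A" by (auto elim: reduced_ConsE)
  have "emb s \<otimes>\<^bsub>HNN\<^esub> stab \<epsilon> = cls [(Base s, True), (Stable, \<epsilon>)]"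
    unfolding hnn_embedding_def stab_def using s by (simp add: cls_mult gword_letters)
  moreover have "[(Base s, True), (Stable, \<epsilon>)] \<in> gwords (hnn_gens A)"
    using s by (auto simp: gwords_def hnn_gens_def)
  ultimately show ?thesis using nf_word_gwords[OF v] by (simp add: cls_mult)
qed

lemma value_of_closed: "n \<in> normal_forms \<Longrightarrow> value_of n \<in> carrier HNN"
  by (cases n) (auto simp: value_of_eq)

lemma value_of_inj: "inj_on value_of normal_forms"
proof (rule inj_onI)
  fix m n assume mn: "m \<in> normal_forms" "n \<in> normal_forms" "value_of m = value_of n"
  let ?w = "\<lambda>n. nf_word (fst n) @ [(Base (snd n), True)]"
  have gw: "?w n \<in> gwords (hnn_gens A)" if "n \<in> normal_forms" for n
    using that nf_word_gwords[of "fst n"] gword_letters(1)[of "snd n" True]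
    by (auto simp: gwords_def)
  have "(?w m, ?w n) \<in> hrel"
    using mn gw unfolding value_of_def by (intro eq_equiv_class[OF _ equiv_presentation_rel]) auto
  from acts_presentation_rel[OF this, of "([], \<one>)"]
  have "acts (?w m) ([], \<one>) = acts (?w n) ([], \<one>)" by (simp add: reduced.Nil)
  moreover have "acts (?w n) ([], \<one>) = n" if "n \<in> normal_forms" for n
    using that acts_nf_word[of "fst n"] by auto
  ultimately show "m = n" using mn by simp
qed

lemma value_of_act:
  assumes "x \<in> hnn_gens A" "n \<in> normal_forms"
  shows "value_of (act (x, \<epsilon>) n) = value_of n \<otimes>\<^bsub>HNN\<^esub> cls [(x, \<epsilon>)]"
proof -
  obtain v a where n: "n = (v, a)" "v \<in> reduced" "a \<in> carrier A" using assms(2) by auto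
  show ?thesis
  proof (cases x)
    case (Base b)
    then have b: "b \<in> carrier A" using assms(1) by (auto simp: hnn_gens_def)
    define b' where "b' = (if \<epsilon> then b else inv b)"
    have b': "b' \<in> carrier A" using b by (simp add: b'_def)
    have "value_of (act (x, \<epsilon>) n) = cls (nf_word v) \<otimes>\<^bsub>HNN\<^esub> emb (a \<otimes> b')"
      using n b' Base by (simp add: value_of_eq b'_def)
    also have "\<dots> = value_of n \<otimes>\<^bsub>HNN\<^esub> emb b'"
      using n b' by (simp add: value_of_eq emb_mult[symmetric] HNN.m_assoc)
    finally show ?thesis using Base cls_Base[OF b, of \<epsilon>] by (simp add: b'_def)
  next
    case Stable
    have x: "cls [(x, \<epsilon>)] = stab \<epsilon>" using Stable by (simp add: stab_def)
    have "(v, a) \<in> normal_forms" using n by simp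
    then show ?thesis
    proof (cases rule: act_Stable_cases[where \<epsilon>=\<epsilon>])
      case (cancel s w)
      let ?k = "across \<epsilon> a"
      have k: "?k \<in> carrier A" using across_closed cancel by blast
      have "value_of n \<otimes>\<^bsub>HNN\<^esub> stab \<epsilon>
          = cls (nf_word w) \<otimes>\<^bsub>HNN\<^esub> (emb s \<otimes>\<^bsub>HNN\<^esub> (stab (\<not> \<epsilon>) \<otimes>\<^bsub>HNN\<^esub> (emb a \<otimes>\<^bsub>HNN\<^esub> stab \<epsilon>)))"
        using n cancel cls_nf_word_Cons[of s "\<not> \<epsilon>" w] by (simp add: value_of_eq HNN.m_assoc)
      also have "emb a \<otimes>\<^bsub>HNN\<^esub> stab \<epsilon> = stab \<epsilon> \<otimes>\<^bsub>HNN\<^esub> emb ?k"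
        using emb_stab cancel by blast
      also have "stab (\<not> \<epsilon>) \<otimes>\<^bsub>HNN\<^esub> (stab \<epsilon> \<otimes>\<^bsub>HNN\<^esub> emb ?k) = emb ?k"
        using stab_cancel[of "\<not> \<epsilon>"] k by (simp add: HNN.m_assoc[symmetric])
      also have "emb s \<otimes>\<^bsub>HNN\<^esub> emb ?k = emb (s \<otimes> ?k)"
        using cancel k by (simp add: emb_mult)
      finally show ?thesis
        using x n Stable cancel k by (simp add: value_of_eq)
    next
      case extend
      let ?h = "rest \<epsilon> a"
      have h: "?h \<in> side \<epsilon>" using rest_side n by blast
      have c: "rep \<epsilon> a \<in> carrier A" "?h \<in> carrier A" "across \<epsilon> ?h \<in> carrier A"
        using rep_closed n side_sub[OF h] across_closed[OF h] by auto
      have "value_of (act (x, \<epsilon>) n)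
         = cls (nf_word v) \<otimes>\<^bsub>HNN\<^esub> (emb (rep \<epsilon> a) \<otimes>\<^bsub>HNN\<^esub> (stab \<epsilon> \<otimes>\<^bsub>HNN\<^esub> emb (across \<epsilon> ?h)))"
        using n Stable extend c cls_nf_word_Cons[OF extend(2)] by (simp add: value_of_eq HNN.m_assoc)
      also have "stab \<epsilon> \<otimes>\<^bsub>HNN\<^esub> emb (across \<epsilon> ?h) = emb ?h \<otimes>\<^bsub>HNN\<^esub> stab \<epsilon>"
        using emb_stab[OF h] by simp
      also have "emb (rep \<epsilon> a) \<otimes>\<^bsub>HNN\<^esub> (emb ?h \<otimes>\<^bsub>HNN\<^esub> stab \<epsilon>) = emb a \<otimes>\<^bsub>HNN\<^esub> stab \<epsilon>"
        using c rep_rest[OF n(3), of \<epsilon>] by (simp add: HNN.m_assoc[symmetric] emb_mult)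
      finally show ?thesis
        using x n by (simp add: value_of_eq HNN.m_assoc)
    qed
  qed
qed

lemma value_of_surj: "value_of ` normal_forms = carrier HNN"
proof
  show "value_of ` normal_forms \<subseteq> carrier HNN" using value_of_closed by blast
  have "value_of (acts u n) = value_of n \<otimes>\<^bsub>HNN\<^esub> cls u"
    if "u \<in> gwords (hnn_gens A)" "n \<in> normal_forms" for u n
    using that
  proof (induction u arbitrary: n)
    case Nil
    then show ?case using value_of_closed by (simp add: one_HNN[symmetric])
  next
    case (Cons l u)
    obtain x \<epsilon> where l: "l = (x, \<epsilon>)" "x \<in> hnn_gens A" using Cons.prems by (auto simp: gwords_def)
    have u: "u \<in> gwords (hnn_gens A)" "[l] \<in> gwords (hnn_gens A)" using Cons.prems by (auto simp: gwords_def)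
    have "value_of (acts (l # u) n) = value_of (act l n) \<otimes>\<^bsub>HNN\<^esub> cls u"
      using Cons.IH[OF u(1)] act_closed Cons.prems l by simp
    also have "\<dots> = value_of n \<otimes>\<^bsub>HNN\<^esub> cls [l] \<otimes>\<^bsub>HNN\<^esub> cls u"
      using value_of_act l Cons.prems by simp
    also have "\<dots> = value_of n \<otimes>\<^bsub>HNN\<^esub> cls (l # u)"
      using value_of_closed Cons.prems(2) cls_closed u cls_mult[OF u(2,1)] by (simp add: HNN.m_assoc)
    finally show ?case .
  qed
  moreover have "value_of ([], \<one>) = \<one>\<^bsub>HNN\<^esub>"
    using emb_one by (simp add: value_of_def hnn_embedding_def)
  moreover have n0: "([], \<one>) \<in> normal_forms" by (simp add: reduced.Nil)
  ultimately have "value_of (acts u ([], \<one>)) = cls u" if "u \<in> gwords (hnn_gens A)" for u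
    using that cls_closed by simp
  note acts_value = this
  show "carrier HNN \<subseteq> value_of ` normal_forms"
  proof
    fix P assume "P \<in> carrier HNN"
    then obtain u where u: "u \<in> gwords (hnn_gens A)" "P = cls u" using carrier_HNN by blast
    then have "P = value_of (acts u ([], \<one>))" using acts_value by simp
    then show "P \<in> value_of ` normal_forms" using acts_closed[OF u(1) n0] by (rule image_eqI)
  qed
qed

end

section \<open>The Cayley graph of an HNN-extension\<close>

locale hnn_marked = hnn A C \<phi> for A (structure) and C \<phi> +
  fixes S :: "'a set"
  assumes C_finite: "finite C" and marked: "marked_group A S"
    and C_gens: "C - {\<one>} \<subseteq> S" and \<phi>_gens: "\<phi> ` (C - {\<one>}) \<subseteq> S"
begin

lemma S_sub: "S \<subseteq> carrier A" and S_finite: "finite S"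
  using marked by (auto simp: marked_group_def)

lemma side_gens: "h \<in> side \<epsilon> \<Longrightarrow> h \<noteq> \<one> \<Longrightarrow> h \<in> S"
proof (cases \<epsilon>)
  case True
  assume h: "h \<in> side \<epsilon>" "h \<noteq> \<one>"
  then obtain c where c: "c \<in> C" "h = \<phi> c" using True by (auto simp: side_def)
  moreover have "\<phi> \<one> = \<one>" using across_one[of False] by (simp add: across_def)
  ultimately have "c \<noteq> \<one>" using h by auto
  then show ?thesis using c \<phi>_gens by blast
qed (use C_gens in \<open>auto simp: side_def\<close>)

abbreviation EA :: "('a \<times> 'a) set" where
  "EA \<equiv> cayley_graph A S"

definition matching :: "'a \<times> bool \<Rightarrow> ('a \<times> 'a) set" where
  "matching e = {(fst e \<otimes> h, across (snd e) h) | h. h \<in> side (snd e)}"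

lemma side_adjacent:
  assumes "s \<in> carrier A" "h \<in> side \<epsilon>" "h' \<in> side \<epsilon>"
  shows "s \<otimes> h = s \<otimes> h' \<or> (s \<otimes> h, s \<otimes> h') \<in> EA"
proof (cases "h = h'")
  case False
  have c: "h \<in> carrier A" "h' \<in> carrier A" using assms side_sub by auto
  then have "inv h \<otimes> h' \<noteq> \<one>" using False by (metis inv_closed inv_equality inv_inv)
  then have "inv h \<otimes> h' \<in> S" using side_gens assms side_mult side_inv by blast
  moreover have "s \<otimes> h' = (s \<otimes> h) \<otimes> (inv h \<otimes> h')"
    using assms(1) c by (simp add: m_assoc[symmetric]) (simp add: m_assoc)
  ultimately show ?thesis using assms(1) c unfolding cayley_graph_def by blast
qed simp

sublocale tree_of_graphs "carrier A" EA reduced matching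
proof
  show "EA \<subseteq> carrier A \<times> carrier A" by (rule cayley_graph_sub[OF S_sub])
  show "Relation.sym EA" by (rule sym_cayley_graph[OF S_sub])
  show "(a, b) \<in> EA\<^sup>*" if "a \<in> carrier A" "b \<in> carrier A" for a b
    using cayley_graph_connected[OF marked that] .
  show "[] \<in> reduced" by (rule reduced.Nil)
  show "v \<in> reduced" if "e # v \<in> reduced" for e v
    using that by (cases e) (auto elim: reduced_ConsE)
  have "v \<in> lists (carrier A \<times> UNIV)" if "v \<in> reduced" for v
    using that by induction auto
  moreover have "countable (lists (carrier A \<times> (UNIV :: bool set)))"
    using countable_carrier_marked_group[OF marked] by (intro countable_lists countable_SIGMA) auto
  ultimately show "countable reduced" by (meson countable_subset subsetI)
  fix e v assume "e # v \<in> reduced"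
  then obtain s \<epsilon> where e: "e = (s, \<epsilon>)" "s \<in> carrier A" by (cases e) (auto elim: reduced_ConsE)
  have "finite (side \<epsilon>)" using C_finite by (simp add: side_def)
  then have "finite ((\<lambda>h. (s \<otimes> h, across \<epsilon> h)) ` side \<epsilon>)" by (rule finite_imageI)
  moreover have "matching e = (\<lambda>h. (s \<otimes> h, across \<epsilon> h)) ` side \<epsilon>"
    unfolding matching_def e by auto
  ultimately show "finite (matching e)" by simp
  show "matching e \<noteq> {}" unfolding matching_def using side_one by blast
  show "matching e \<subseteq> carrier A \<times> carrier A"
    unfolding matching_def e using e(2) side_sub across_closed by auto
  fix p q p' q' assume "(p, q) \<in> matching e" "(p', q') \<in> matching e"
  then obtain h h' where h: "h \<in> side \<epsilon>" "h' \<in> side \<epsilon>" "p = s \<otimes> h" "p' = s \<otimes> h'"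
      "q = across \<epsilon> h" "q' = across \<epsilon> h'"
    unfolding matching_def e by auto
  then show "p = p' \<or> (p, p') \<in> EA" using side_adjacent e(2) by blast
  show "q = q' \<or> (q, q') \<in> EA"
    using side_adjacent[OF one_closed across_side[OF h(1)] across_side[OF h(2)]] h across_closed by simp
qed

definition gens :: "'a hnn_gen gword set set" where
  "gens = insert (stable_letter A C \<phi>) (emb ` S)"

lemma gens_sub: "gens \<subseteq> carrier HNN"
  unfolding gens_def stable_letter_def
  using S_sub stab_closed[of True] by (auto simp: stab_def)

lemma sym_gens: "gens \<union> m_inv HNN ` gens = range stab \<union> emb ` (S \<union> m_inv A ` S)"
proof -
  have 1: "stable_letter A C \<phi> = stab True" by (simp add: stable_letter_def stab_def)
  have "m_inv HNN ` emb ` S = emb ` m_inv A ` S"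
    unfolding image_image using emb_inv S_sub by (intro image_cong) auto
  moreover have "range stab = {stab True, stab False}" by (auto simp: UNIV_bool)
  ultimately show ?thesis unfolding gens_def 1 using inv_stab[of True] by auto
qed

lemma value_of_edge_up:
  assumes e: "(s, \<epsilon>) # v \<in> reduced" and h: "h \<in> side \<epsilon>"
  shows "value_of ((s, \<epsilon>) # v, across \<epsilon> h) = value_of (v, s \<otimes> h) \<otimes>\<^bsub>HNN\<^esub> stab \<epsilon>"
proof -
  from e have v: "v \<in> reduced" and s: "s \<in> carrier A" by (auto elim: reduced_ConsE)
  have c: "h \<in> carrier A" "across \<epsilon> h \<in> carrier A" using h side_sub across_closed by auto
  have "value_of ((s, \<epsilon>) # v, across \<epsilon> h)
     = cls (nf_word v) \<otimes>\<^bsub>HNN\<^esub> (emb s \<otimes>\<^bsub>HNN\<^esub> (stab \<epsilon> \<otimes>\<^bsub>HNN\<^esub> emb (across \<epsilon> h)))"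
    using v s c cls_nf_word_Cons[OF e] e by (simp add: value_of_eq HNN.m_assoc)
  also have "stab \<epsilon> \<otimes>\<^bsub>HNN\<^esub> emb (across \<epsilon> h) = emb h \<otimes>\<^bsub>HNN\<^esub> stab \<epsilon>"
    using emb_stab[OF h] by simp
  also have "cls (nf_word v) \<otimes>\<^bsub>HNN\<^esub> (emb s \<otimes>\<^bsub>HNN\<^esub> (emb h \<otimes>\<^bsub>HNN\<^esub> stab \<epsilon>)) = value_of (v, s \<otimes> h) \<otimes>\<^bsub>HNN\<^esub> stab \<epsilon>"
    using v s c by (simp add: value_of_eq HNN.m_assoc emb_mult[symmetric])
  finally show ?thesis .
qed

lemma value_of_translate:
  assumes "v \<in> reduced" "a \<in> carrier A" "b \<in> carrier A"
  shows "value_of (v, a \<otimes> b) = value_of (v, a) \<otimes>\<^bsub>HNN\<^esub> emb b"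
  using assms by (simp add: value_of_eq HNN.m_assoc emb_mult[symmetric])

lemma edges_sub: "edges \<subseteq> normal_forms \<times> normal_forms"
proof (rule subrelI)
  fix x y assume "(x, y) \<in> edges"
  then show "(x, y) \<in> normal_forms \<times> normal_forms"
  proof (cases rule: edges_cases)
    case (copy v a b)
    then show ?thesis using EA_sub by auto
  next
    case (up v e p q)
    then show ?thesis using M_sub[OF up(3)] V_tl[OF up(3)] by auto
  next
    case (down v e p q)
    then show ?thesis using M_sub[OF down(3)] V_tl[OF down(3)] by auto
  qed
qed

lemma edges_imp_cayley_graph:
  assumes "(x, y) \<in> edges"
  shows "(value_of x, value_of y) \<in> cayley_graph HNN gens"
  using assms
proof (cases rule: edges_cases)
  case (copy v a b)
  then obtain s where s: "a \<in> carrier A" "s \<in> S \<union> m_inv A ` S" "b = a \<otimes> s" by (auto simp: cayley_graph_def)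
  then have "s \<in> carrier A" using S_sub by auto
  then have "value_of y = value_of x \<otimes>\<^bsub>HNN\<^esub> emb s" using copy s value_of_translate by simp
  moreover have "emb s \<in> gens \<union> m_inv HNN ` gens" unfolding sym_gens using s by blast
  moreover have "value_of x \<in> carrier HNN" using copy s value_of_closed by simp
  ultimately show ?thesis unfolding cayley_graph_def by blast
next
  case (up v e p q)
  then obtain h where h: "h \<in> side (snd e)" "p = fst e \<otimes> h" "q = across (snd e) h" by (auto simp: matching_def)
  then have "value_of y = value_of x \<otimes>\<^bsub>HNN\<^esub> stab (snd e)"
    using value_of_edge_up[of "fst e" "snd e" v h] up by simp
  moreover have "stab (snd e) \<in> gens \<union> m_inv HNN ` gens" unfolding sym_gens by blast
  moreover have "value_of x \<in> carrier HNN" using assms edges_sub value_of_closed by blast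
  ultimately show ?thesis unfolding cayley_graph_def by blast
next
  case (down v e p q)
  then obtain h where h: "h \<in> side (snd e)" "p = fst e \<otimes> h" "q = across (snd e) h" by (auto simp: matching_def)
  then have "value_of x = value_of y \<otimes>\<^bsub>HNN\<^esub> stab (snd e)"
    using value_of_edge_up[of "fst e" "snd e" v h] down by simp
  moreover have "stab (snd e) \<in> gens \<union> m_inv HNN ` gens" unfolding sym_gens by blast
  moreover have "value_of y \<in> carrier HNN" using assms edges_sub value_of_closed by blast
  ultimately have "(value_of y, value_of x) \<in> cayley_graph HNN gens" unfolding cayley_graph_def by blast
  then show ?thesis using HNN.sym_cayley_graph[OF gens_sub] by (rule symD[rotated])
qed

lemma act_Base_edge:
  assumes "n \<in> normal_forms" "b \<in> S \<union> m_inv A ` S"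
  shows "(n, act (Base b, True) n) \<in> edges"
proof -
  obtain v a where n: "n = (v, a)" "v \<in> reduced" "a \<in> carrier A" using assms(1) by auto
  have "(a, a \<otimes> b) \<in> EA" unfolding cayley_graph_def using n assms(2) by blast
  then show ?thesis using copy_edgeI[OF n(2)] n by simp
qed

lemma act_Stable_edge:
  assumes "n \<in> normal_forms"
  shows "(n, act (Stable, \<epsilon>) n) \<in> edges"
proof -
  obtain v a where n: "n = (v, a)" "v \<in> reduced" "a \<in> carrier A" using assms(1) by auto
  have "(v, a) \<in> normal_forms" using n by simp
  then show ?thesis
  proof (cases rule: act_Stable_cases[where \<epsilon>=\<epsilon>])
    case (cancel s w)
    have "across \<epsilon> a \<in> side (\<not> \<epsilon>)" using cancel across_side by blast
    moreover have "across (\<not> \<epsilon>) (across \<epsilon> a) = a" using cancel across_across by blast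
    ultimately have "(s \<otimes> across \<epsilon> a, a) \<in> matching (s, \<not> \<epsilon>)"
      unfolding matching_def by (auto intro!: exI[of _ "across \<epsilon> a"])
    then show ?thesis using tree_edgeI'[of "(s, \<not> \<epsilon>)" w] n cancel by simp
  next
    case extend
    have "(rep \<epsilon> a \<otimes> rest \<epsilon> a, across \<epsilon> (rest \<epsilon> a)) \<in> matching (rep \<epsilon> a, \<epsilon>)"
      unfolding matching_def using rest_side[OF n(3)] by auto
    then show ?thesis using tree_edgeI[OF extend(2)] n extend rep_rest[OF n(3)] by simp
  qed
qed

lemma cayley_graph_imp_edges:
  assumes x: "x \<in> normal_forms" and y: "y \<in> normal_forms"
    and xy: "(value_of x, value_of y) \<in> cayley_graph HNN gens"
  shows "(x, y) \<in> edges"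
proof -
  obtain g where g: "g \<in> range stab \<union> emb ` (S \<union> m_inv A ` S)" "value_of y = value_of x \<otimes>\<^bsub>HNN\<^esub> g"
    using xy unfolding cayley_graph_def sym_gens by blast
  from g(1) show ?thesis
  proof
    assume "g \<in> range stab"
    then obtain \<epsilon> where \<epsilon>: "g = stab \<epsilon>" by blast
    have St: "Stable \<in> hnn_gens A" by (simp add: hnn_gens_def)
    have "value_of (act (Stable, \<epsilon>) x) = value_of y"
      using value_of_act[OF St x] g(2) \<epsilon> by (simp add: stab_def)
    then have "act (Stable, \<epsilon>) x = y"
      using inj_onD[OF value_of_inj] act_closed[OF St x] y by blast
    then show ?thesis using act_Stable_edge[OF x] by blast
  next
    assume "g \<in> emb ` (S \<union> m_inv A ` S)"
    then obtain b where b: "b \<in> S \<union> m_inv A ` S" "g = emb b" by blast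
    then have bc: "b \<in> carrier A" using S_sub by auto
    then have B: "Base b \<in> hnn_gens A" by (simp add: hnn_gens_def)
    have "value_of (act (Base b, True) x) = value_of y"
      using value_of_act[OF B x] g(2) b(2) cls_Base[OF bc, of True] by simp
    then have "act (Base b, True) x = y"
      using inj_onD[OF value_of_inj] act_closed[OF B x] y by blast
    then show ?thesis using act_Base_edge[OF x b(1)] by blast
  qed
qed

lemma marked_HNN: "marked_group HNN gens"
proof (rule HNN.marked_groupI)
  show "finite gens" using S_finite by (simp add: gens_def)
  show "gens \<subseteq> carrier HNN" by (rule gens_sub)
  fix g assume "g \<in> carrier HNN"
  then obtain n where n: "n \<in> normal_forms" "g = value_of n" using value_of_surj by blast
  have n0: "([], \<one>) \<in> normal_forms" by (simp add: reduced.Nil)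
  have "(([], \<one>), n) \<in> edges\<^sup>*" using reachable[OF n0 n(1)] .
  then obtain k where "(([], \<one>), n) \<in> edges ^^ k" by (auto simp: rtrancl_power)
  then have "(value_of ([], \<one>), value_of n) \<in> cayley_graph HNN gens ^^ k"
    using edges_imp_cayley_graph by (rule relpow_image[rotated])
  moreover have "value_of ([], \<one>) = \<one>\<^bsub>HNN\<^esub>"
    using emb_one by (simp add: value_of_def hnn_embedding_def)
  ultimately show "(\<one>\<^bsub>HNN\<^esub>, g) \<in> (cayley_graph HNN gens)\<^sup>*"
    using n by (auto simp: rtrancl_power)
qed

lemma word_metric_value_of:
  assumes "x \<in> normal_forms" "y \<in> normal_forms"
  shows "word_metric HNN gens (value_of x) (value_of y) = dN x y"
proof -
  have "graph_dist edges x y = graph_dist (cayley_graph HNN gens) (value_of x) (value_of y)"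
  proof (rule graph_dist_isomorphism[OF value_of_inj edges_sub _ _ assms])
    show "cayley_graph HNN gens \<subseteq> value_of ` normal_forms \<times> value_of ` normal_forms"
      using HNN.cayley_graph_sub[OF gens_sub] by (simp add: value_of_surj)
  qed (use edges_imp_cayley_graph cayley_graph_imp_edges in blast)
  then show ?thesis
    using HNN.word_metric_eq_graph_dist[OF gens_sub] assms value_of_closed by simp
qed

lemma type_R_HNN:
  assumes "type_R A S"
  shows "type_R HNN gens"
proof -
  obtain r0 where r0: "\<And>r. r \<ge> r0 \<Longrightarrow> contractible_space
      (geometric_realization (rips_complex (carrier A) (word_metric A S) r))"
    using assms unfolding type_R_def by blast
  have "contractible_space (geometric_realization (rips_complex (carrier HNN) (word_metric HNN gens) r))"
    if r: "max 3 r0 \<le> r" for r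
  proof -
    have "rips_complex (carrier A) (word_metric A S) r = rips_complex (carrier A) (\<lambda>a b. real (dA a b)) r"
      by (intro rips_complex_cong word_metric_eq_graph_dist S_sub)
    then have "contractible_space (geometric_realization (rips_complex (carrier A) (\<lambda>a b. real (dA a b)) r))"
      using r0[of r] r by simp
    then have "contractible_space (geometric_realization (rips_complex normal_forms dN r))"
      using r by (intro contractible_tree_of_graphs) auto
    from contractible_rips_complex_isometry[OF value_of_inj word_metric_value_of this]
    show ?thesis by (simp add: value_of_surj)
  qed
  then show ?thesis
    unfolding type_R_def using marked_HNN by (intro conjI exI[of _ "max 3 r0"]) auto
qed

end

theorem theorem1p4:
  fixes A :: "('a, 'b) monoid_scheme" and C S\<^sub>A :: "'a set" and \<phi> :: "'a \<Rightarrow> 'a"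
  assumes "group A"
    and "subgroup C A" and "finite C"
    and "\<phi> \<in> mon (A\<lparr>carrier := C\<rparr>) A"
    and "marked_group A S\<^sub>A"
    and "C - {\<one>\<^bsub>A\<^esub>} \<subseteq> S\<^sub>A" and "\<phi> ` (C - {\<one>\<^bsub>A\<^esub>}) \<subseteq> S\<^sub>A"
    and "type_R A S\<^sub>A"
  shows "type_R (hnn_extension A C \<phi>) (insert (stable_letter A C \<phi>) (hnn_embedding A C \<phi> ` S\<^sub>A))"
proof -
  interpret hnn A C \<phi>
    by (intro hnn.intro hnn_axioms.intro assms)
  interpret hnn_marked A C \<phi> S\<^sub>A
    by unfold_locales fact+
  show ?thesis using type_R_HNN[OF assms(8)] by (simp add: gens_def)
qed

end
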